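(* Let $d\ge1$, let $\kappa=(\kappa_1,\dots,\kappa_d)$ with all $\kappa_i\ge0$, let $\mu\ge0$, let $\alpha=\alpha_{\kappa,\mu}=|\kappa|+\mu+\frac{d-1}{2}>0$, and let $n\in\mathbb{N}_0$. Then for $(x,t),(y,s)\in\mathbb{V}^{d+1}$, $$\mathbf{P}_n(W_{\kappa,\mu};(x,t),(y,s))=C_{\kappa,\mu}\int_{[-1,1]^{d+1}}\int_0^\pi L_n^{2\alpha}\big(t+s+2\boldsymbol\rho\cos\theta\big)\,e^{-\boldsymbol\rho\cos\theta}\,j_{\alpha-1}\big(\boldsymbol\rho\sin\theta\big)(\sin\theta)^{2\alpha-1}\,d\theta\,\Phi_\kappa(u')(1-u_{d+1}^2)^{\mu-1}\,du,$$ where $u=(u',u_{d+1})$ with $u'\in[-1,1]^d$, $C_{\kappa,\mu}=\frac{2^{\alpha-1}\Gamma(\alpha+\frac12)}{\sqrt\pi}\,c_{\kappa-\frac{\mathbf 1}{2}}\,c_{\mu-\frac12}$, and $$\boldsymbol\rho=\boldsymbol\rho(x,t,y,s;u)=\sqrt{\tfrac12\Big(ts+x_1y_1u_1+\dots+x_dy_du_d+\sqrt{t^2-\|x\|^2}\sqrt{s^2-\|y\|^2}\,u_{d+1}\Big)}.$$ The identity holds in the limit sense if one or more of $\kappa_1,\dots,\kappa_d,\mu$ is zero (see the convention in the context), and if $\alpha_{\kappa,\mu}=0$ (i.e. $d=1$, $\kappa=0$, $\mu=0$) it holds with the right-hand side replaced by its limit as $\mu\to0+$ (with $d=1$, $\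kappa=0$).
   Context: Notation: $|\kappa|=\kappa_1+\dots+\kappa_d$, $h_\kappa(x)=\prod_{i=1}^d|x_i|^{\kappa_i}$. The solid cone is $\mathbb{V}^{d+1}=\{(x,t)\in\mathbb{R}^d\times[0,\infty):\|x\|\le t\}$, with weight $W_{\kappa,\mu}(x,t)=h_\kappa^2(x)(t^2-\|x\|^2)^{\mu-\frac12}e^{-t}$ and inner product $\langle f,g\rangle_{\kappa,\mu}=\mathbf{b}_{\kappa,\mu}\int_{\mathbb{V}^{d+1}}fg\,W_{\kappa,\mu}\,dx\,dt$ normalized by $\langle1,1\rangle_{\kappa,\mu}=1$. $\mathcal{V}_n(\mathbb{V}^{d+1},W_{\kappa,\mu})$ is the space of polynomials in $(x,t)$ of degree at most $n$ orthogonal to all polynomials of degree at most $n-1$, and $\mathbf{P}_n(W_{\kappa,\mu};\cdot,\cdot)$ is its reproducing kernel with respect to $\langle\cdot,\cdot\rangle_{\kappa,\mu}$. $L_n^\alpha$ is the Laguerre polynomial, $\sum_{n\ge0}L_n^\alpha(t)r^n=(1-r)^{-\alpha-1}e^{-tr/(1-r)}$; $j_\alpha(z)=z^{-\alpha}J_\alpha(z)$ with $J_\alpha$ the Bessel function of the first kind (extended continuously to $z=0$); $c_\lambda=\frac{\Gamma(\lambda+1)}{\Gamma(\frac12)\Gamma(\lambda+\frac12)}$; $c_{\kappa-\frac{\mathbf 1}{2}}=\prod_{i=1}^dc_{\kappa_i-\frac12}$; $\Phi_\kappa(u')=\prod_{i=1}^d(1+u_i)(1-u_i^2)^{\kappa_i-1}$.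 Convention: if $\kappa_i=0$, $c_{\kappa_i-\frac12}\int_{-1}^1f(u_i)(1+u_i)(1-u_i^2)^{\kappa_i-1}du_i$ is replaced by its limit $f(1)$; if $\mu=0$, $c_{\mu-\frac12}\int_{-1}^1f(u_{d+1})(1-u_{d+1}^2)^{\mu-1}du_{d+1}$ is replaced by its limit $\frac12[f(1)+f(-1)]$. *)

theory Defs
  imports "HOL-Probability.Probability"
    "HOL-Computational_Algebra.Formal_Power_Series"
begin

text \<open>The dimension \<open>d\<close> is \<open>CARD('d)\<close>; a point \<open>(x, t)\<close> has type \<open>(real ^ 'd) \<times> real\<close>.\<close>

definition solid_cone :: "((real ^ 'd::finite) \<times> real) set" where
  "solid_cone = {(x, t). 0 \<le> t \<and> norm x \<le> t}"

definition h_weight :: "real ^ 'd::finite \<Rightarrow> real ^ 'd \<Rightarrow> real" where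
  "h_weight \<kappa> x = (\<Prod>i\<in>UNIV. \<bar>x $ i\<bar> powr (\<kappa> $ i))"

text \<open>In HOL \<open>0 powr a = 0\<close> for every \<open>a\<close>, so the weight vanishes on the boundary of the cone
  and on the coordinate hyperplanes, whatever the exponents. These are null sets, and the weight
  is only used under the integral.\<close>

definition cone_weight :: "real ^ 'd::finite \<Rightarrow> real \<Rightarrow> (real ^ 'd) \<times> real \<Rightarrow> real" where
  "cone_weight \<kappa> \<mu> = (\<lambda>(x, t).
     (h_weight \<kappa> x)\<^sup>2 * (t\<^sup>2 - (norm x)\<^sup>2) powr (\<mu> - 1/2) * exp (- t))"

definition cone_normalization :: "real ^ 'd::finite \<Rightarrow> real \<Rightarrow> real" where
  "cone_normalization \<kappa> \<mu> = 1 / (LINT z:solid_cone|lborel. cone_weight \<kappa> \<mu> z)"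

definition cone_inner ::
  "real ^ 'd::finite \<Rightarrow> real \<Rightarrow> ((real ^ 'd) \<times> real \<Rightarrow> real) \<Rightarrow> ((real ^ 'd) \<times> real \<Rightarrow> real) \<Rightarrow> real" where
  "cone_inner \<kappa> \<mu> f g =
     cone_normalization \<kappa> \<mu> * (LINT z:solid_cone|lborel. f z * g z * cone_weight \<kappa> \<mu> z)"

definition exponents_upto :: "nat \<Rightarrow> (('d::finite \<Rightarrow> nat) \<times> nat) set" where
  "exponents_upto n = {(\<beta>, k). (\<Sum>i\<in>UNIV. \<beta> i) + k \<le> n}"

lemma finite_exponents_upto: "finite (exponents_upto n :: (('d::finite \<Rightarrow> nat) \<times> nat) set)"
proof (rule finite_subset)
  have "\<beta> i \<le> n" if "(\<Sum>i\<in>UNIV. \<beta> i) + k \<le> n" for \<beta> :: "'d \<Rightarrow> nat" and k i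
    using member_le_sum[of i UNIV \<beta>] that by auto
  then show "exponents_upto n \<subseteq> (PiE UNIV (\<lambda>_::'d. {..n})) \<times> {..n}"
    by (auto simp: exponents_upto_def PiE_UNIV_domain)
  show "finite ((PiE UNIV (\<lambda>_::'d. {..n})) \<times> {..n})"
    by (intro finite_cartesian_product finite_PiE) auto
qed

text \<open>Real polynomial functions in \<open>(x, t)\<close> of total degree at most \<open>n\<close>. The cone has nonempty
  interior, so a polynomial may be identified with its restriction to the cone.\<close>

definition poly_upto :: "nat \<Rightarrow> ((real ^ 'd::finite) \<times> real \<Rightarrow> real) set" where
  "poly_upto n = {p. \<exists>c. p = (\<lambda>(x, t).
     \<Sum>(\<beta>, k)\<in>exponents_upto n. c (\<beta>, k) * (\<Prod>i\<in>UNIV. (x $ i) ^ \<beta> i) * t ^ k)}"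

definition cone_orth_space ::
  "real ^ 'd::finite \<Rightarrow> real \<Rightarrow> nat \<Rightarrow> ((real ^ 'd) \<times> real \<Rightarrow> real) set" where
  "cone_orth_space \<kappa> \<mu> n =
     {p \<in> poly_upto n. \<forall>m<n. \<forall>q\<in>poly_upto m. cone_inner \<kappa> \<mu> p q = 0}"

text \<open>\<open>cone_kernel \<kappa> \<mu> n z w\<close> is the value at \<open>z\<close> of the element of the orthogonal space that
  represents evaluation at \<open>w\<close>.\<close>

definition cone_kernel ::
  "real ^ 'd::finite \<Rightarrow> real \<Rightarrow> nat \<Rightarrow> (real ^ 'd) \<times> real \<Rightarrow> (real ^ 'd) \<times> real \<Rightarrow> real" where
  "cone_kernel \<kappa> \<mu> n z w =
     (THE k. k \<in> cone_orth_space \<kappa> \<mu> n \<and>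
        (\<forall>p\<in>cone_orth_space \<kappa> \<mu> n. cone_inner \<kappa> \<mu> p k = p w)) z"

text \<open>The coefficient of \<open>r ^ n\<close> in \<open>(1 - r) powr (-\<alpha> - 1) * exp (- t * r / (1 - r))\<close>, with the
  generating function read as a formal power series in \<open>r\<close>.\<close>

definition laguerre :: "nat \<Rightarrow> real \<Rightarrow> real \<Rightarrow> real" where
  "laguerre n \<alpha> t = fps_nth
     ((fps_binomial (- \<alpha> - 1) oo (- fps_X)) * (fps_exp (- t) oo (fps_X / (1 - fps_X)))) n"

text \<open>Only used for \<open>z > 0\<close>, where \<open>powr\<close> is the usual power.\<close>

definition bessel_J :: "real \<Rightarrow> real \<Rightarrow> real" where
  "bessel_J \<alpha> z =
     (\<Sum>m. (-1) ^ m / fact m * rGamma (real m + \<alpha> + 1) * (z / 2) powr (2 * real m + \<alpha>))"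

definition bessel_j :: "real \<Rightarrow> real \<Rightarrow> real" where
  "bessel_j \<alpha> z =
     (if z = 0 then Lim (at_right 0) (\<lambda>w. w powr (- \<alpha>) * bessel_J \<alpha> w)
      else z powr (- \<alpha>) * bessel_J \<alpha> z)"

definition c_const :: "real \<Rightarrow> real" where
  "c_const l = Gamma (l + 1) / (Gamma (1/2) * Gamma (l + 1/2))"

text \<open>The normalized weights of the variables \<open>u\<^sub>1, \<dots>, u\<^sub>d\<close> and \<open>u\<^sub>d\<^sub>+\<^sub>1\<close>, including the
  constants \<open>c\<close>, are packaged as measures on the line. When the parameter is zero the measure is
  the one that realizes the stated limit of the normalized integral: the unit mass at \<open>1\<close>,
  respectively the mean of the unit masses at \<open>1\<close> and \<open>-1\<close>.\<close>

definition kappa_measure :: "real \<Rightarrow> real measure" where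
  "kappa_measure k =
     (if k = 0 then return borel 1
      else density lborel (\<lambda>u. ennreal (indicator {-1..1} u *
             (c_const (k - 1/2) * ((1 + u) * (1 - u\<^sup>2) powr (k - 1))))))"

definition mu_measure :: "real \<Rightarrow> real measure" where
  "mu_measure m =
     (if m = 0 then distr (uniform_count_measure {-1, 1}) borel (\<lambda>u. u)
      else density lborel (\<lambda>u. ennreal (indicator {-1..1} u *
             (c_const (m - 1/2) * (1 - u\<^sup>2) powr (m - 1)))))"

lemma c_const_nonneg: "k > 0 \<Longrightarrow> c_const (k - 1/2) \<ge> 0"
  by (auto simp: c_const_def intro!: divide_nonneg_nonneg mult_nonneg_nonneg less_imp_le)

lemma integral_kappa_measure:
  fixes f :: "real \<Rightarrow> real"
  assumes [measurable]: "f \<in> borel_measurable borel"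
  shows "(LINT u|kappa_measure 0. f u) = f 1"
    and "k > 0 \<Longrightarrow> (LINT u|kappa_measure k. f u) =
           c_const (k - 1/2) * (LINT u:{-1..1}|lborel. f u * (1 + u) * (1 - u\<^sup>2) powr (k - 1))"
proof -
  show "(LINT u|kappa_measure 0. f u) = f 1"
    by (simp add: kappa_measure_def integral_return)
  assume k: "k > 0"
  have "(LINT u|kappa_measure k. f u) = (LINT u|lborel. (indicator {-1..1} u *
             (c_const (k - 1/2) * ((1 + u) * (1 - u\<^sup>2) powr (k - 1)))) * f u)"
    using k c_const_nonneg[OF k] unfolding kappa_measure_def
    by (simp, subst integral_density) (auto simp: indicator_def)
  also have "\<dots> = (LINT u|lborel. c_const (k - 1/2) *
               (indicator {-1..1} u * (f u * (1 + u) * (1 - u\<^sup>2) powr (k - 1))))"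
    by (simp add: mult_ac)
  finally show "(LINT u|kappa_measure k. f u) =
           c_const (k - 1/2) * (LINT u:{-1..1}|lborel. f u * (1 + u) * (1 - u\<^sup>2) powr (k - 1))"
    by (simp add: set_lebesgue_integral_def)
qed

lemma integral_mu_measure:
  fixes f :: "real \<Rightarrow> real"
  assumes [measurable]: "f \<in> borel_measurable borel"
  shows "(LINT u|mu_measure 0. f u) = 1/2 * (f 1 + f (-1))"
    and "m > 0 \<Longrightarrow> (LINT u|mu_measure m. f u) =
           c_const (m - 1/2) * (LINT u:{-1..1}|lborel. f u * (1 - u\<^sup>2) powr (m - 1))"
proof -
  have "(\<lambda>u. u) \<in> measurable (uniform_count_measure {-1, 1::real}) borel"
    by (auto simp: measurable_def sets_uniform_count_measure space_uniform_count_measure)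
  then show "(LINT u|mu_measure 0. f u) = 1/2 * (f 1 + f (-1))"
    by (simp add: mu_measure_def integral_distr integral_uniform_count_measure)
  assume m: "m > 0"
  have "(LINT u|mu_measure m. f u) = (LINT u|lborel. (indicator {-1..1} u *
             (c_const (m - 1/2) * (1 - u\<^sup>2) powr (m - 1))) * f u)"
    using m c_const_nonneg[OF m] unfolding mu_measure_def
    by (simp, subst integral_density) (auto simp: indicator_def)
  also have "\<dots> = (LINT u|lborel. c_const (m - 1/2) *
               (indicator {-1..1} u * (f u * (1 - u\<^sup>2) powr (m - 1))))"
    by (simp add: mult_ac)
  finally show "(LINT u|mu_measure m. f u) =
           c_const (m - 1/2) * (LINT u:{-1..1}|lborel. f u * (1 - u\<^sup>2) powr (m - 1))"
    by (simp add: set_lebesgue_integral_def)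
qed

definition alpha_index :: "real ^ 'd::finite \<Rightarrow> real \<Rightarrow> real" where
  "alpha_index \<kappa> \<mu> = (\<Sum>i\<in>UNIV. \<kappa> $ i) + \<mu> + (real CARD('d) - 1) / 2"

text \<open>The argument \<open>u\<close> is split as \<open>(u', v)\<close> with \<open>v = u\<^sub>d\<^sub>+\<^sub>1\<close>.\<close>

definition rho :: "(real ^ 'd::finite) \<times> real \<Rightarrow> (real ^ 'd) \<times> real \<Rightarrow> ('d \<Rightarrow> real) \<times> real \<Rightarrow> real" where
  "rho = (\<lambda>(x, t) (y, s) (u', v). sqrt (1/2 *
     (t * s + (\<Sum>i\<in>UNIV. x $ i * y $ i * u' i)
      + sqrt (t\<^sup>2 - (norm x)\<^sup>2) * sqrt (s\<^sup>2 - (norm y)\<^sup>2) * v)))"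

text \<open>The factors \<open>c\<close> of the constant \<open>C\<close> and the weight in \<open>u\<close> are contained in the product
  measure.\<close>

definition kernel_formula ::
  "real ^ 'd::finite \<Rightarrow> real \<Rightarrow> nat \<Rightarrow> (real ^ 'd) \<times> real \<Rightarrow> (real ^ 'd) \<times> real \<Rightarrow> real" where
  "kernel_formula \<kappa> \<mu> n z w =
     (let \<alpha> = alpha_index \<kappa> \<mu> in
      2 powr (\<alpha> - 1) * Gamma (\<alpha> + 1/2) / sqrt pi *
      (LINT u|(PiM UNIV (\<lambda>i. kappa_measure (\<kappa> $ i)) \<Otimes>\<^sub>M mu_measure \<mu>).
         (LINT \<theta>:{0..pi}|lborel.
           laguerre n (2 * \<alpha>) (snd z + snd w + 2 * rho z w u * cos \<theta>)
           * exp (- rho z w u * cos \<theta>)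
           * bessel_j (\<alpha> - 1) (rho z w u * sin \<theta>)
           * sin \<theta> powr (2 * \<alpha> - 1))))"

end

theory Submission
  imports Defs
begin

text \<open>
  Both sides are shown to equal one explicit polynomial kernel. The one-dimensional Dunkl
  exponential \<open>\<Sum>\<^sub>g \<tau> ^ g / \<gamma> g\<close> (with \<open>\<gamma> = dunkl_fact\<close>) gives, as a product over the coordinates and
  one even factor for \<open>t\<^sup>2 - \<parallel>x\<parallel>\<^sup>2\<close>, a pairing \<open>S n z w\<close> that is homogeneous of degree \<open>n\<close> in each
  argument, and the kernel is \<open>K N z w = \<Sum>n\<le>N. S n z w * laguerre (N - n) (2 * \<alpha> + 2 * n) (t + s)\<close>.

  On monomials the inner product with \<open>K N\<close> is computed in closed form: the moments of the cone weight
  are, up to a factor depending only on the degrees, Gaussian moments, for which the Dunkl exponential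
  reproduces polynomials; what remains is a terminating Kummer-type sum. The result is a generating
  function in \<open>N\<close> that is a polynomial of degree \<open>m + k\<close> with value \<open>y ^ \<beta> * s ^ k\<close> at \<open>1\<close>, when the monomial
  is \<open>x ^ \<beta> * t ^ k\<close> and \<open>m = |\<beta>|\<close>. Hence \<open>K N\<close> is orthogonal to lower degrees and reproducing, and since
  it is symmetric and polynomial in both arguments it is the only such kernel.

  For the integral formula, expanding the exponential and the Bessel function in powers of \<open>\<rho>\<close> and
  integrating over \<open>\<theta>\<close> leaves \<open>\<Sum>k\<le>n. \<rho> ^ (2 * k) / (k! (\<alpha> + 1/2)\<^sub>k) * laguerre (n - k) (2 * \<alpha> + 2 * k) (t + s)\<close>,
  and the moments \<open>j! / \<gamma> j\<close> of the measures in \<open>u\<close> turn \<open>\<rho> ^ (2 * k)\<close> into \<open>S k\<close>. The kernel \<open>K\<close> is continuous in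
  \<open>\<mu>\<close>, which gives the limit statement at \<open>\<alpha> = 0\<close>.
\<close>

text \<open>Introduce a further coordinate x' = sqrt (t^2 - |x|^2), so that |(x, x')| = t. The
  weight becomes the product of the |x_i|^(2\<kappa>_i) and of x'^(2\<mu>), times exp (-t) / t. A
  homogeneous function therefore has the same integral as against a Gaussian, up to a radial factor;
  \<mu> behaves like one more \<kappa>_i, and its factor is even because only x'^2 is a polynomial
  in (x, t). The kernel has a generating function of Mehler type: the sum of \<open>K N\<close> r^N
  is (1 - r)^(-2\<alpha> - 1) exp (-(t + s) r / (1 - r)) times the sum of \<open>S n\<close> (r / (1
  - r)^2)^n. Integrating a monomial in z against it produces a polynomial in r / (1 - r) times exp
  (s r / (1 - r)), and this exponential cancels the one already present; that is why only a
  polynomial in r is left. Zero values of \<kappa>_i or \<mu> need no limit as long as \<alpha> > 0,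
  since the point masses obey the same moment formula as the densities. At \<alpha> = 0 the Bessel
  index is -1 and sin \<theta> has exponent -1, but \<open>K\<close> contains only rising factorials
  of \<alpha> + 1/2 and stays regular.\<close>

unbundle no vec_syntax
unbundle fps_syntax

section \<open>Dunkl factorials and Gaussian moments\<close>

text \<open>The Dunkl operator f' + k (f(x) - f(-x)) / x sends x^i to this multiple of
  x^(i-1).\<close>

definition dunkl_step :: "real \<Rightarrow> nat \<Rightarrow> real" where
  "dunkl_step k i = real i + (if odd i then 2 * k else 0)"

primrec dunkl_fact :: "real \<Rightarrow> nat \<Rightarrow> real" where
  "dunkl_fact k 0 = 1"
| "dunkl_fact k (Suc n) = dunkl_step k (Suc n) * dunkl_fact k n"

text \<open>Moments of |x|^(2k) exp (-x^2/2), normalized to total mass 1; the recursion is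
  integration by parts.\<close>

fun gauss_moment :: "real \<Rightarrow> nat \<Rightarrow> real" where
  "gauss_moment k 0 = 1"
| "gauss_moment k (Suc 0) = 0"
| "gauss_moment k (Suc (Suc n)) = dunkl_step k (Suc n) * gauss_moment k n"

lemma dunkl_step_pos: "k \<ge> 0 \<Longrightarrow> i > 0 \<Longrightarrow> dunkl_step k i > 0"
  by (auto simp: dunkl_step_def add_pos_nonneg)

lemma dunkl_fact_pos: "k \<ge> 0 \<Longrightarrow> dunkl_fact k n > 0"
  by (induction n) (auto simp: dunkl_step_pos)

lemma dunkl_fact_nonzero [simp]: "k \<ge> 0 \<Longrightarrow> dunkl_fact k n \<noteq> 0"
  using dunkl_fact_pos[of k n] by simp

lemma gauss_moment_odd: "odd m \<Longrightarrow> gauss_moment k m = 0"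
  by (induction k m rule: gauss_moment.induct) auto

section \<open>Even Gaussian series and the Dunkl operator conjugated by them\<close>

definition gauss_fps :: "real \<Rightarrow> real fps" where
  "gauss_fps c = fps_exp c oo fps_X ^ 2"

lemma gauss_fps_nth: "gauss_fps c $ n = (if even n then c ^ (n div 2) / fact (n div 2) else 0)"
proof -
  have "gauss_fps c $ n = (\<Sum>i=0..n. if n = 2 * i then c ^ i / fact i else 0)"
    by (simp add: gauss_fps_def fps_compose_nth fps_X_power_nth flip: power_mult)
       (rule sum.cong, auto)
  also have "\<dots> = (\<Sum>i=0..n. if i = n div 2 then (if even n then c ^ i / fact i else 0) else 0)"
    by (rule sum.cong) auto
  finally show ?thesis by simp
qed

lemma gauss_fps_add: "gauss_fps (a + b) = gauss_fps a * gauss_fps b"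
  by (simp add: gauss_fps_def fps_exp_add_mult fps_compose_mult_distrib)

lemma gauss_fps_0: "gauss_fps 0 = 1"
  by (simp add: gauss_fps_def)

lemma gauss_fps_sum: "finite I \<Longrightarrow> gauss_fps (\<Sum>i\<in>I. f i) = (\<Prod>i\<in>I. gauss_fps (f i))"
  by (induction I rule: finite_induct) (auto simp: gauss_fps_0 gauss_fps_add)

definition fps_scale :: "real \<Rightarrow> real fps \<Rightarrow> real fps" where
  "fps_scale c f = f oo (fps_const c * fps_X)"

lemma fps_scale_nth [simp]: "fps_scale c f $ n = c ^ n * f $ n"
  by (simp add: fps_scale_def)

lemma fps_scale_mult: "fps_scale c (f * g) = fps_scale c f * fps_scale c g"
  by (simp add: fps_scale_def fps_compose_mult_distrib)

lemma fps_scale_gauss: "fps_scale c (gauss_fps a) = gauss_fps (a * c ^ 2)"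
  by (rule fps_ext) (auto simp: gauss_fps_nth power_mult_distrib elim!: evenE simp flip: power_mult)

text \<open>This is (f(X) - f(-X)) / (2 X), the difference part of the Dunkl operator.\<close>

definition odd_quotient :: "real fps \<Rightarrow> real fps" where
  "odd_quotient f = Abs_fps (\<lambda>g. if even g then f $ Suc g else 0)"

text \<open>With T the Dunkl operator this is exp (-X^2/2) T^m exp (X^2/2), a generalized Hermite
  polynomial without the alternating signs.\<close>

primrec dunkl_hermite :: "real \<Rightarrow> nat \<Rightarrow> real fps" where
  "dunkl_hermite k 0 = 1"
| "dunkl_hermite k (Suc m) = fps_X * dunkl_hermite k m + fps_deriv (dunkl_hermite k m)
     + fps_const (2 * k) * odd_quotient (dunkl_hermite k m)"

lemma dunkl_hermite_zero:
  "m < i \<or> odd (m + i) \<Longrightarrow> dunkl_hermite k m $ i = 0"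
proof (induction m arbitrary: i)
  case 0
  then show ?case by (auto simp: odd_pos)
next
  case (Suc m)
  have "(fps_X * dunkl_hermite k m) $ i = 0"
    using Suc.prems by (cases i) (auto intro!: Suc.IH)
  moreover have "dunkl_hermite k m $ Suc i = 0"
    using Suc.prems by (intro Suc.IH) auto
  ultimately show ?case by (simp add: odd_quotient_def)
qed

lemma dunkl_hermite_monic [simp]: "dunkl_hermite k m $ m = 1"
  by (induction m) (auto simp: odd_quotient_def dunkl_hermite_zero)

lemma gauss_fps_deriv: "fps_deriv (gauss_fps c) = fps_const (2 * c) * (fps_X * gauss_fps c)"
proof (rule fps_ext)
  fix n
  show "fps_deriv (gauss_fps c) $ n = (fps_const (2 * c) * (fps_X * gauss_fps c)) $ n"
  proof (cases n)
    case (Suc m)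
    show ?thesis
    proof (cases "even m")
      case True
      then obtain j where "m = 2 * j" by (auto elim: evenE)
      have "real (2 * (1 + j)) * (c ^ (1 + j) / fact (1 + j)) = 2 * c * (c ^ j / fact j)"
        by (simp add: divide_simps)
      then show ?thesis using Suc \<open>m = 2 * j\<close>
        by (simp add: gauss_fps_nth)
    next
      case False
      then show ?thesis using Suc by (auto simp: gauss_fps_nth)
    qed
  qed (auto simp: gauss_fps_nth)
qed

text \<open>The Gaussian is even, so it passes through the difference quotient unchanged.\<close>

lemma odd_quotient_gauss_mult:
  "odd_quotient (gauss_fps c * f) = gauss_fps c * odd_quotient f"
proof (rule fps_ext)
  fix n
  have "(gauss_fps c * f) $ Suc n = (\<Sum>i=0..n. gauss_fps c $ i * f $ (Suc n - i))" if "even n"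
    using that by (simp add: fps_mult_nth gauss_fps_nth)
  moreover have "(\<Sum>i=0..n. gauss_fps c $ i * f $ (Suc n - i)) =
      (\<Sum>i=0..n. gauss_fps c $ i * odd_quotient f $ (n - i))" if "even n"
    using that by (intro sum.cong) (auto simp: odd_quotient_def gauss_fps_nth Suc_diff_le)
  moreover have "(\<Sum>i=0..n. gauss_fps c $ i * odd_quotient f $ (n - i)) = 0" if "odd n"
    using that by (intro sum.neutral) (auto simp: odd_quotient_def gauss_fps_nth)
  ultimately show "odd_quotient (gauss_fps c * f) $ n = (gauss_fps c * odd_quotient f) $ n"
    by (auto simp: odd_quotient_def fps_mult_nth)
qed

text \<open>Multiplication by the variable turns, after integration against the Dunkl exponential, into
  the Dunkl operator on the other variable; the induction step is the conjugation of that operator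
  by the Gaussian.\<close>

lemma dunkl_gauss_transform:
  assumes "k \<ge> 0"
  shows "Abs_fps (\<lambda>g. gauss_moment k (m + g) / dunkl_fact k g) =
    gauss_fps (1/2) * dunkl_hermite k m" (is "?E m = _")
proof (induction m)
  case 0
  have "gauss_moment k g / dunkl_fact k g = gauss_fps (1/2) $ g" for g
    using assms
  proof (induction k g rule: gauss_moment.induct)
    case (3 k n)
    note assms' = \<open>0 \<le> k\<close>
    show ?case
    proof (cases "even n")
      case True
      \<comment> \<open>The odd step n + 1 occurs in both the moment and the factorial. After it
        cancels, only the even step n + 2 is left, which does not involve k; hence the result is the
        classical Gaussian.\<close>
      have "gauss_moment k (Suc (Suc n)) / dunkl_fact k (Suc (Suc n)) =
          (dunkl_step k (Suc n) / dunkl_step k (Suc n)) * (gauss_moment k n / dunkl_fact k n) / dunkl_step k (Suc (Suc n))"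
        by simp
      also have "\<dots> = (dunkl_step k (Suc n) / dunkl_step k (Suc n)) * (gauss_fps (1/2) $ n) / dunkl_step k (Suc (Suc n))"
        using 3 by simp
      also have "\<dots> = gauss_fps (1/2) $ (Suc (Suc n))"
      proof -
        obtain j where n: "n = 2 * j" using True by (auto elim: evenE)
        have nz: "dunkl_step k (Suc n) \<noteq> 0" using dunkl_step_pos[OF assms', of "Suc n"] by simp
        have "(1/2) ^ j / fact j / real (2 * j + 2) = (1/2) ^ (1 + j) / (fact (1 + j) :: real)"
          by (simp add: divide_simps)
        then show ?thesis using nz by (simp add: n gauss_fps_nth dunkl_step_def)
      qed
      finally show ?thesis .
    qed (auto simp: gauss_moment_odd gauss_fps_nth)
  qed (auto simp: gauss_fps_nth)
  then show ?case by (auto simp: fps_eq_iff)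
next
  case (Suc m)
  have "?E (Suc m) = fps_deriv (?E m) + fps_const (2 * k) * odd_quotient (?E m)"
  proof (rule fps_ext)
    fix g
    have "dunkl_step k (Suc g) \<noteq> 0"
      using dunkl_step_pos[OF assms, of "Suc g"] by simp
    then have *: "?E (Suc m) $ g = dunkl_step k (Suc g) * (gauss_moment k (m + Suc g) / dunkl_fact k (Suc g))"
      by simp
    show "?E (Suc m) $ g = (fps_deriv (?E m) + fps_const (2 * k) * odd_quotient (?E m)) $ g"
    proof (rule trans[OF *])
      show "dunkl_step k (Suc g) * (gauss_moment k (m + Suc g) / dunkl_fact k (Suc g)) =
          (fps_deriv (?E m) + fps_const (2 * k) * odd_quotient (?E m)) $ g"
        by (simp add: odd_quotient_def dunkl_step_def distrib_right add_divide_distrib del: dunkl_fact.simps)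
    qed
  qed
  also have "\<dots> = gauss_fps (1/2) * dunkl_hermite k (Suc m)"
    unfolding Suc.IH odd_quotient_gauss_mult by (simp add: gauss_fps_deriv algebra_simps)
  finally show ?case .
qed

text \<open>Coefficients of the hypergeometric series 0F1(; c; X^2/4), a normalized modified Bessel
  function of order c - 1.\<close>

definition kummer_coeff :: "real \<Rightarrow> nat \<Rightarrow> real" where
  "kummer_coeff c i = (if even i then 1 / (4 ^ (i div 2) * fact (i div 2) * pochhammer c (i div 2)) else 0)"

text \<open>Kummer's second formula, exp X * 0F1(; c; X^2/4) = 1F1(c - 1/2; 2c - 1; 2X), read off at
  X^M. The Bessel equation links coefficients two apart; after multiplication by exp X it becomes an
  equation whose coefficient recursion has only one step and can be solved directly.\<close>

lemma kummer_sum: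
  assumes "c > 1/2"
  shows "(\<Sum>i\<le>M. kummer_coeff c i / fact (M - i)) =
    2 ^ M * pochhammer (c - 1/2) M / (fact M * pochhammer (2 * c - 1) M)"
proof -
  define u where "u = Abs_fps (kummer_coeff c)"
  define g where "g = u * fps_exp 1"
  have ode: "fps_X * fps_deriv (fps_deriv u) + fps_const (2*c-1) * fps_deriv u = fps_X * u"
  proof (rule fps_ext)
    fix n
    show "(fps_X * fps_deriv (fps_deriv u) + fps_const (2*c-1) * fps_deriv u) $ n = (fps_X * u) $ n"
    proof (cases n)
      case 0
      then show ?thesis by (simp add: u_def kummer_coeff_def)
    next
      case (Suc m)
      show ?thesis
      proof (cases "even m")
        case True
        then obtain j where m: "m = 2 * j" by (auto elim: evenE)
        have p: "pochhammer c j > 0" using assms by (intro pochhammer_pos) simp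
        have q: "c + real j > 0" using assms by simp
        define P where "P = 4 ^ j * fact j * pochhammer c j"
        have P: "P > 0" using p by (simp add: P_def)
        have "kummer_coeff c (2 * j + 2) = 1 / (P * (4 * (1 + real j) * (c + real j)))"
          by (simp add: kummer_coeff_def pochhammer_rec' P_def mult_ac)
        moreover have "kummer_coeff c (2 * j) = 1 / P"
          by (simp add: kummer_coeff_def P_def)
        moreover have "(2 * real j + 1) * ((2 * real j + 2) / (P * (4 * (1 + real j) * (c + real j)))) +
            (2 * c - 1) * ((2 * real j + 2) / (P * (4 * (1 + real j) * (c + real j)))) = 1 / P"
        proof -
          have *: "u * (v / w) + u' * (v / w) = ((u + u') * v) / w" for u u' v w :: real
            by (simp add: distrib_right add_divide_distrib)
          have "((2 * real j + 1) + (2 * c - 1)) * (2 * real j + 2) = 4 * (1 + real j) * (c + real j)"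
            by (simp add: algebra_simps)
          then have "(2 * real j + 1) * ((2 * real j + 2) / (P * (4 * (1 + real j) * (c + real j)))) +
            (2 * c - 1) * ((2 * real j + 2) / (P * (4 * (1 + real j) * (c + real j)))) =
            (4 * (1 + real j) * (c + real j)) / (P * (4 * (1 + real j) * (c + real j)))"
            unfolding * by simp
          also have "\<dots> = 1 / P" using q by simp
          finally show ?thesis .
        qed
        ultimately show ?thesis using Suc m
          by (simp add: u_def algebra_simps)
      next
        case False
        then show ?thesis using Suc by (simp add: u_def kummer_coeff_def)
      qed
    qed
  qed
  have g1: "fps_deriv g = (fps_deriv u + u) * fps_exp 1"
    by (simp add: g_def algebra_simps)
  have g2: "fps_deriv (fps_deriv g) = (fps_deriv (fps_deriv u) + 2 * fps_deriv u + u) * fps_exp 1"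
    unfolding g1 by (simp add: algebra_simps)
  have "fps_X * fps_deriv (fps_deriv g) + fps_const (2*c-1) * fps_deriv g - 2 * (fps_X * fps_deriv g) - fps_const (2*c-1) * g
     = (fps_X * fps_deriv (fps_deriv u) + fps_const (2*c-1) * fps_deriv u - fps_X * u) * fps_exp 1"
    unfolding g1 g2 by (simp add: g_def algebra_simps)
  also have "\<dots> = 0" unfolding ode by simp
  finally have ode': "fps_X * fps_deriv (fps_deriv g) + fps_const (2*c-1) * fps_deriv g =
      fps_const 2 * (fps_X * fps_deriv g) + fps_const (2*c-1) * g"
    by (simp add: algebra_simps numeral_fps_const)
  have rec: "real (Suc n) * (2*c-1 + real n) * g $ Suc n = (2 * (c - 1/2 + real n)) * g $ n" for n
    using arg_cong[OF ode', of "\<lambda>f. f $ n"] by (cases n) (auto simp: algebra_simps)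
  have "g $ n = 2 ^ n * pochhammer (c - 1/2) n / (fact n * pochhammer (2 * c - 1) n)" for n
  proof (induction n)
    case 0
    then show ?case by (simp add: g_def u_def kummer_coeff_def)
  next
    case (Suc n)
    have pos: "real (Suc n) > 0" "2*c-1 + real n > 0" "pochhammer (2*c-1) n > 0"
      using assms by (auto intro!: pochhammer_pos)
    have "g $ Suc n = (2 * (c - 1/2 + real n)) * g $ n / (real (Suc n) * (2*c-1 + real n))"
      using rec[of n] pos by (metis mult_pos_pos less_irrefl nonzero_mult_div_cancel_left)
    also have "\<dots> = 2 ^ Suc n * ((c - 1/2 + real n) * pochhammer (c - 1/2) n) / ((real (Suc n) * fact n) * ((2*c-1 + real n) * pochhammer (2 * c - 1) n))"
    proof -
      have "(2 * a) * (2 ^ n * p / (f * q)) / (N * b) = 2 ^ Suc n * (a * p) / ((N * f) * (b * q))"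
        for a p f q N b :: real by (simp add: mult_ac)
      then show ?thesis unfolding Suc.IH .
    qed
    finally show ?case by (simp only: pochhammer_rec' fact_Suc of_nat_mult of_nat_fact)
  qed
  moreover have "g $ M = (\<Sum>i\<le>M. kummer_coeff c i / fact (M - i))"
    by (simp add: g_def u_def fps_mult_nth atMost_atLeast0)
  ultimately show ?thesis by simp
qed

text \<open>\<open>A\<close> is a polynomial of degree at most \<open>D\<close>. Its coefficient at
  \<open>D\<close> is recorded because it is the one that survives when the generating function of
  the reproducing sums is evaluated at 1.\<close>

definition poisson_poly :: "real fps \<Rightarrow> real \<Rightarrow> nat \<Rightarrow> real fps \<Rightarrow> bool" where
  "poisson_poly f s D A \<longleftrightarrow> f = A * fps_exp s \<and> (\<forall>i>D. A $ i = 0) \<and> A $ D = s ^ D"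

lemma poisson_poly_step:
  assumes "poisson_poly (Abs_fps f) s D A"
  shows "\<exists>A'. poisson_poly (Abs_fps (\<lambda>q. (real q + c) * f q)) s (Suc D) A'"
proof
  \<comment> \<open>Multiplying the q-th coefficient by q + c is the operator X d/dX + c; applied to
    A exp (sX) and divided by exp (sX) it gives this series, where s X A supplies the new top
    coefficient.\<close>
  let ?A = "fps_X * fps_deriv A + fps_const s * (fps_X * A) + fps_const c * A"
  have "Abs_fps (\<lambda>q. (real q + c) * f q) = fps_X * fps_deriv (Abs_fps f) + fps_const c * Abs_fps f"
  proof (rule fps_ext)
    fix n show "Abs_fps (\<lambda>q. (real q + c) * f q) $ n = (fps_X * fps_deriv (Abs_fps f) + fps_const c * Abs_fps f) $ n"
      by (cases n) (auto simp: algebra_simps)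
  qed
  also have "\<dots> = ?A * fps_exp s"
    using assms by (simp add: poisson_poly_def algebra_simps)
  finally show "poisson_poly (Abs_fps (\<lambda>q. (real q + c) * f q)) s (Suc D) ?A"
    using assms by (auto simp: poisson_poly_def)
qed

lemma poisson_poly_pochhammer:
  assumes "poisson_poly (Abs_fps f) s D A"
  shows "\<exists>A'. poisson_poly (Abs_fps (\<lambda>q. pochhammer (real q + c) k * f q)) s (D + k) A'"
proof (induction k)
  case (Suc k)
  then obtain A' where "poisson_poly (Abs_fps (\<lambda>q. pochhammer (real q + c) k * f q)) s (D + k) A'" by blast
  from poisson_poly_step[OF this, of "c + real k"] show ?case
    by (simp add: pochhammer_rec' algebra_simps)
qed (use assms in auto)

lemma poisson_poly_exists:
  "\<exists>A. poisson_poly (Abs_fps (\<lambda>q. pochhammer (real q + a) k * pochhammer (real q + c) b * (s ^ q / fact q))) s (k + b) A"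
proof -
  have "poisson_poly (Abs_fps (\<lambda>q. s ^ q / fact q)) s 0 1"
    by (simp add: poisson_poly_def fps_eq_iff)
  then obtain A where "poisson_poly (Abs_fps (\<lambda>q. pochhammer (real q + c) b * (s ^ q / fact q))) s (0 + b) A"
    using poisson_poly_pochhammer by blast
  from poisson_poly_pochhammer[OF this, of a k] show ?thesis
    by (simp add: mult.assoc add.commute)
qed

section \<open>Powers of \<open>1 - X\<close> and Laguerre polynomials\<close>

definition one_minus_powr :: "real \<Rightarrow> real fps" where
  "one_minus_powr c = fps_binomial c oo - fps_X"

definition zeta :: "real fps" where
  "zeta = fps_X / (1 - fps_X)"

lemma one_minus_powr_add: "one_minus_powr (a + b) = one_minus_powr a * one_minus_powr b"
  by (simp add: one_minus_powr_def fps_binomial_add_mult fps_compose_mult_distrib)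

lemma one_minus_powr_0 [simp]: "one_minus_powr 0 = 1"
  by (simp add: one_minus_powr_def)

lemma one_minus_powr_1: "one_minus_powr 1 = 1 - fps_X"
  by (simp add: one_minus_powr_def fps_binomial_1 fps_compose_add_distrib)

lemma one_minus_powr_of_nat: "one_minus_powr (real n) = (1 - fps_X) ^ n"
  by (induction n) (simp_all add: one_minus_powr_add one_minus_powr_1 mult.commute)

lemma one_minus_powr_nth: "one_minus_powr c $ n = (-1) ^ n * (c gchoose n)"
  by (simp add: one_minus_powr_def fps_compose_uminus')

lemma zeta_mult: "zeta * (1 - fps_X) = fps_X"
  unfolding zeta_def by (subst fps_divide_unit) (auto simp: mult.assoc inverse_mult_eq_1)

lemma zeta_eq: "zeta = fps_X * one_minus_powr (-1)"
proof -
  have "zeta = zeta * (one_minus_powr 1 * one_minus_powr (-1))"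
    by (simp flip: one_minus_powr_add)
  also have "\<dots> = fps_X * one_minus_powr (-1)"
    by (simp add: one_minus_powr_1 zeta_mult flip: mult.assoc)
  finally show ?thesis .
qed

lemma zeta_nth_0 [simp]: "zeta $ 0 = 0"
  by (simp add: zeta_eq)

lemma zeta_power: "zeta ^ n = fps_X ^ n * one_minus_powr (- real n)"
proof (induction n)
  case (Suc n)
  have "one_minus_powr (- real (Suc n)) = one_minus_powr (- 1) * one_minus_powr (- real n)"
    by (simp flip: one_minus_powr_add)
  then show ?case using Suc by (simp add: zeta_eq mult_ac)
qed simp

lemma zeta_power_mult: "one_minus_powr c * zeta ^ n = fps_X ^ n * one_minus_powr (c - real n)"
  by (simp add: zeta_power mult_ac flip: one_minus_powr_add)

text \<open>Since G^i starts at order i, the composition contributes only i \<le> n. This finite sum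
  is used in both directions, to expand Laguerre polynomials and to recombine the sums that
  arise.\<close>

lemma fps_mult_compose_nth:
  fixes A F G :: "real fps"
  assumes "G $ 0 = 0"
  shows "(A * (F oo G)) $ n = (\<Sum>i\<le>n. F $ i * (A * G ^ i) $ n)"
proof -
  have G0: "(G ^ i) $ m = 0" if "m < i" for i m
    using that assms by (rule_tac startsby_zero_power_prefix[rule_format, where k=i]) auto
  have "(F oo G) $ m = (\<Sum>i\<le>n. F $ i * (G ^ i) $ m)" if "m \<le> n" for m
    unfolding fps_compose_nth using that G0 by (intro sum.mono_neutral_left) auto
  then have "(A * (F oo G)) $ n = (\<Sum>j=0..n. A $ j * (\<Sum>i\<le>n. F $ i * (G ^ i) $ (n - j)))"
    by (simp add: fps_mult_nth)
  also have "\<dots> = (\<Sum>i\<le>n. \<Sum>j=0..n. A $ j * (F $ i * (G ^ i) $ (n - j)))"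
    unfolding sum_distrib_left by (rule sum.swap)
  also have "\<dots> = (\<Sum>i\<le>n. F $ i * (A * G ^ i) $ n)"
    by (simp add: fps_mult_nth sum_distrib_left mult_ac)
  finally show ?thesis .
qed

lemma one_minus_powr_deriv: "(1 - fps_X) * fps_deriv (one_minus_powr c) = - fps_const c * one_minus_powr c"
proof (rule fps_ext)
  fix n
  have "(1 - fps_X) * fps_deriv (one_minus_powr c) = fps_deriv (one_minus_powr c) - fps_X * fps_deriv (one_minus_powr c)"
    by (simp add: algebra_simps)
  moreover have "(fps_X * fps_deriv (one_minus_powr c)) $ n = real n * one_minus_powr c $ n"
    by (cases n) auto
  moreover have "real (Suc n) * (c gchoose Suc n) = (c - real n) * (c gchoose n)"
    by (simp add: gbinomial_absorb_comp gbinomial_absorption')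
  then have "- ((-1) ^ n) * (real (Suc n) * (c gchoose Suc n)) = - ((-1) ^ n) * ((c - real n) * (c gchoose n))"
    by simp
  then have "real (Suc n) * one_minus_powr c $ Suc n = - (c - real n) * one_minus_powr c $ n"
    by (simp only: one_minus_powr_nth power_Suc) (simp only: mult_ac mult_minus_left mult_minus_right mult_1_left)
  ultimately show "((1 - fps_X) * fps_deriv (one_minus_powr c)) $ n = (- fps_const c * one_minus_powr c) $ n"
    by (simp add: algebra_simps)
qed

text \<open>Formally (1 + X/(1 - X))^(-a) = (1 - X)^a. For real exponents this is an identity of
  series: both sides start with 1 and solve (1 - X) f' = -a f, which determines the coefficients
  recursively.\<close>

lemma fps_binomial_compose_zeta: "fps_binomial (- a) oo zeta = one_minus_powr a"
proof -
  let ?f = "fps_binomial (- a) oo zeta"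
  let ?q = "1 - fps_X :: real fps"
  have q: "?q * one_minus_powr (-1) = 1"
    by (simp add: one_minus_powr_1[symmetric] one_minus_powr_add[symmetric] del: one_minus_powr_1)
  have d0: "(1 + fps_X) * fps_deriv (fps_binomial (- a)) = fps_const (- a) * fps_binomial (- a)"
    by (simp add: fps_binomial_deriv)
  have d1: "(1 + zeta) * (fps_deriv (fps_binomial (- a)) oo zeta) = fps_const (- a) * ?f"
    using arg_cong[OF d0, of "\<lambda>f. f oo zeta"]
    by (simp add: fps_compose_mult_distrib fps_compose_add_distrib)
  have z1: "?q * (1 + zeta) = 1"
    using zeta_mult by (simp add: algebra_simps)
  have z2: "fps_deriv zeta * ?q * ?q = 1"
  proof -
    have "fps_deriv (zeta * ?q) = 1" by (simp add: zeta_mult)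
    then have "fps_deriv zeta * ?q - zeta = 1" by (simp add: algebra_simps)
    then have "(fps_deriv zeta * ?q - zeta) * ?q = ?q" by simp
    then have "fps_deriv zeta * ?q * ?q = ?q + zeta * ?q" by (simp only: left_diff_distrib diff_eq_eq)
    then show ?thesis unfolding zeta_mult by simp
  qed
  have "fps_deriv ?f = (fps_deriv (fps_binomial (- a)) oo zeta) * fps_deriv zeta"
    by (rule fps_compose_deriv) simp
  then have "?q * fps_deriv ?f = (?q * (1 + zeta)) * ?q * ((fps_deriv (fps_binomial (- a)) oo zeta) * fps_deriv zeta)"
    by (simp add: z1)
  also have "\<dots> = ((1 + zeta) * (fps_deriv (fps_binomial (- a)) oo zeta)) * (fps_deriv zeta * ?q * ?q)"
    by (simp only: mult_ac)
  finally have ode: "?q * fps_deriv ?f = fps_const (- a) * ?f"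
    by (simp only: d1 z2 mult_1_right)
  have "?f $ n = one_minus_powr a $ n" for n
  proof (induction n)
    case 0
    then show ?case by (simp add: one_minus_powr_nth)
  next
    case (Suc n)
    have rec: "real (Suc n) * g $ Suc n - real n * g $ n = - a * g $ n" if "?q * fps_deriv g = fps_const (- a) * g" for g
    proof -
      have "(fps_X * fps_deriv g) $ n = real n * g $ n" by (cases n) auto
      then show ?thesis using arg_cong[OF that, of "\<lambda>f. f $ n"] by (simp add: left_diff_distrib)
    qed
    have "real (Suc n) * ?f $ Suc n - real n * one_minus_powr a $ n = - a * one_minus_powr a $ n"
      using rec[OF ode] unfolding Suc.IH .
    moreover have "real (Suc n) * one_minus_powr a $ Suc n - real n * one_minus_powr a $ n = - a * one_minus_powr a $ n"
      using one_minus_powr_deriv[of a] by (intro rec) simp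
    ultimately have "real (Suc n) * ?f $ Suc n = real (Suc n) * one_minus_powr a $ Suc n"
      by linarith
    then show ?case by (metis mult_left_cancel of_nat_neq_0)
  qed
  then show ?thesis by (simp add: fps_eq_iff)
qed

lemma laguerre_eq: "laguerre n a t = (one_minus_powr (- a - 1) * (fps_exp (- t) oo zeta)) $ n"
  by (simp add: laguerre_def one_minus_powr_def zeta_def)

text \<open>Only the exponential in t is expanded. The one in s stays intact so that it can cancel
  against the exponential produced by integrating over the first argument.\<close>

lemma laguerre_add:
  "laguerre n a (t + s) =
    (\<Sum>i\<le>n. (- t) ^ i / fact i * (one_minus_powr (- a - 1) * (fps_exp (- s) oo zeta) * zeta ^ i) $ n)"
proof -
  have "fps_exp (- (t + s)) = fps_exp (- s) * fps_exp (- t)"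
    by (simp flip: fps_exp_add_mult)
  then have "laguerre n a (t + s) = ((one_minus_powr (- a - 1) * (fps_exp (- s) oo zeta)) * (fps_exp (- t) oo zeta)) $ n"
    by (simp add: laguerre_eq fps_compose_mult_distrib mult.assoc)
  then show ?thesis by (simp add: fps_mult_compose_nth)
qed

text \<open>The explicit form shows the degree in t and the polynomial dependence on the parameter,
  hence measurability and the limit in \<mu>.\<close>

lemma laguerre_altdef: "laguerre n a t = (\<Sum>i\<le>n. (- t) ^ i / fact i * ((-1) ^ (n - i) * (- a - 1 - real i gchoose (n - i))))"
proof -
  have "laguerre n a t = (\<Sum>i\<le>n. fps_exp (- t) $ i * (one_minus_powr (- a - 1) * zeta ^ i) $ n)"
    unfolding laguerre_eq by (rule fps_mult_compose_nth) simp
  then show ?thesis by (auto simp: zeta_power_mult fps_X_power_mult_nth one_minus_powr_nth intro!: sum.cong)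
qed

text \<open>The series is a polynomial of degree at most \<open>M\<close>, so adding all its
  coefficients evaluates it at 1; for v = 0 the value is 1 because 0 ^ 0 = 1.\<close>

lemma sum_coeff_monom_one_minus:
  assumes "u + v \<le> M"
  shows "(\<Sum>n\<le>M. (fps_X ^ u * (1 - fps_X) ^ v :: real fps) $ n) = 0 ^ v"
proof -
  let ?p = "monom 1 u * [:1, -1:] ^ v :: real poly"
  have "fps_of_poly ?p = fps_X ^ u * (1 - fps_X) ^ v"
    by (simp add: fps_of_poly_mult fps_of_poly_power fps_of_poly_monom fps_of_poly_pCons)
  then have "(fps_X ^ u * (1 - fps_X) ^ v :: real fps) $ n = coeff ?p n" for n
    by (metis fps_of_poly_nth)
  moreover have "degree ?p \<le> M"
    using degree_mult_le[of "monom (1::real) u" "[:1,-1:] ^ v"] degree_monom_le[of "1::real" u] degree_power_le[of "[:1,-1::real:]" v] assms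
    by auto
  then have "(\<Sum>n\<le>M. coeff ?p n) = (\<Sum>n\<le>degree ?p. coeff ?p n)"
    by (intro sum.mono_neutral_right) (auto simp: coeff_eq_0)
  then have "(\<Sum>n\<le>M. coeff ?p n) = poly ?p 1"
    by (simp add: poly_altdef)
  ultimately show ?thesis by (simp add: poly_monom)
qed

text \<open>The difference of two consecutive partial sums that both equal the value at 1.\<close>

lemma coeff_monom_one_minus_zero:
  "u + v < n \<Longrightarrow> (fps_X ^ u * (1 - fps_X) ^ v :: real fps) $ n = 0"
  using sum_coeff_monom_one_minus[of u v "n - 1"] sum_coeff_monom_one_minus[of u v n]
  by (cases n) auto

unbundle no fps_syntax
unbundle vec_syntax

section \<open>Moments of the cone weight\<close>

lemma powr_square: "x \<ge> 0 \<Longrightarrow> (x\<^sup>2) powr c = x powr (2 * c)" for x :: real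
  by (cases "x = 0") (auto simp: powr_powr simp flip: powr_numeral)

lemma cball_measurable [measurable]: "cball (x :: 'a::euclidean_space) r \<in> sets borel"
  by simp

text \<open>The substitution u = t^2 is made on bounded intervals and extended by monotone
  convergence. The right ends are squares so that both sides exhaust their half lines with the same
  index.\<close>

lemma nn_integral_square_subst:
  fixes f :: "real \<Rightarrow> ennreal"
  assumes [measurable]: "f \<in> borel_measurable borel"
  shows "(\<integral>\<^sup>+u. f u * indicator {0..} u \<partial>lborel) =
    (\<integral>\<^sup>+t. f (t\<^sup>2) * ennreal (2 * t) * indicator {0..} t \<partial>lborel)"
proof -
  have sup1: "(SUP n::nat. f u * indicator {0..(real n + 1)\<^sup>2} u) = f u * indicator {0..} u" for u :: real
  proof (cases "u \<ge> 0")
    case True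
    obtain n :: nat where "u \<le> real n" using real_arch_simple by blast
    also have "\<dots> \<le> (real n + 1)\<^sup>2" by (simp add: power2_eq_square algebra_simps)
    finally have n: "u \<in> {0..(real n + 1)\<^sup>2}" using True by simp
    show ?thesis
    proof (rule antisym)
      show "(SUP n::nat. f u * indicator {0..(real n + 1)\<^sup>2} u) \<le> f u * indicator {0..} u"
        by (rule SUP_least) (auto split: split_indicator)
      show "f u * indicator {0..} u \<le> (SUP n::nat. f u * indicator {0..(real n + 1)\<^sup>2} u)"
        using n True by (intro SUP_upper2[of n]) auto
    qed
  qed simp
  have sup2: "(SUP n::nat. f (t\<^sup>2) * ennreal (2 * t) * indicator {0..real n + 1} t) =
      f (t\<^sup>2) * ennreal (2 * t) * indicator {0..} t" for t :: real
  proof (cases "t \<ge> 0")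
    case True
    obtain n :: nat where "t \<le> real n" using real_arch_simple by blast
    then have n: "t \<in> {0..real n + 1}" using True by simp
    show ?thesis
    proof (rule antisym)
      show "(SUP n::nat. f (t\<^sup>2) * ennreal (2 * t) * indicator {0..real n + 1} t) \<le>
          f (t\<^sup>2) * ennreal (2 * t) * indicator {0..} t"
        by (rule SUP_least) (auto split: split_indicator)
      show "f (t\<^sup>2) * ennreal (2 * t) * indicator {0..} t \<le>
          (SUP n::nat. f (t\<^sup>2) * ennreal (2 * t) * indicator {0..real n + 1} t)"
        using n True by (intro SUP_upper2[of n]) auto
    qed
  qed simp
  have "(\<integral>\<^sup>+u. f u * indicator {0..} u \<partial>lborel) =
      (SUP n::nat. \<integral>\<^sup>+u. f u * indicator {0..(real n + 1)\<^sup>2} u \<partial>lborel)"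
    unfolding sup1[symmetric]
  proof (intro nn_integral_monotone_convergence_SUP)
    have "{0..(real m + 1)\<^sup>2} \<subseteq> {0..(real n + 1)\<^sup>2}" if "m \<le> n" for m n
      using that by (auto intro: order_trans[OF _ power_mono])
    then show "incseq (\<lambda>n u. f u * indicator {0..(real n + 1)\<^sup>2} u)"
      by (auto simp: incseq_def le_fun_def subset_iff split: split_indicator)
  qed auto
  also have "\<dots> = (SUP n::nat. \<integral>\<^sup>+t. f (t\<^sup>2) * ennreal (2 * t) * indicator {0..real n + 1} t \<partial>lborel)"
  proof (intro SUP_cong refl)
    fix n :: nat
    have "(\<integral>\<^sup>+x. f x * indicator {0\<^sup>2..(real n + 1)\<^sup>2} x \<partial>lborel) =
        (\<integral>\<^sup>+x. f (x\<^sup>2) * ennreal (2 * x) * indicator {0..real n + 1} x \<partial>lborel)"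
      by (rule nn_integral_substitution_aux) (auto intro!: derivative_eq_intros continuous_intros)
    then show "(\<integral>\<^sup>+u. f u * indicator {0..(real n + 1)\<^sup>2} u \<partial>lborel) =
        (\<integral>\<^sup>+t. f (t\<^sup>2) * ennreal (2 * t) * indicator {0..real n + 1} t \<partial>lborel)" by simp
  qed
  also have "\<dots> = (\<integral>\<^sup>+t. f (t\<^sup>2) * ennreal (2 * t) * indicator {0..} t \<partial>lborel)"
    unfolding sup2[symmetric]
    by (intro nn_integral_monotone_convergence_SUP[symmetric])
       (auto simp: incseq_def le_fun_def split: split_indicator)
  finally show ?thesis .
qed

lemma nn_integral_Gamma:
  assumes "c > 0"
  shows "(\<integral>\<^sup>+t. ennreal (t powr (c - 1) * exp (- t)) * indicator {0..} t \<partial>lborel) = ennreal (Gamma c)"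
  unfolding Gamma_conv_nn_integral_real[OF assms]
  by (intro nn_integral_cong) (auto simp: exp_minus divide_simps split: split_indicator)

lemma nn_integral_even:
  fixes f :: "real \<Rightarrow> ennreal"
  assumes [measurable]: "f \<in> borel_measurable borel" and even: "\<And>x. f (- x) = f x"
  shows "(\<integral>\<^sup>+x. f x \<partial>lborel) = 2 * (\<integral>\<^sup>+x. f x * indicator {0..} x \<partial>lborel)"
proof -
  have "(\<integral>\<^sup>+x. f x \<partial>lborel) = (\<integral>\<^sup>+x. f x * indicator {0..} x + f x * indicator {..0} x \<partial>lborel)"
    by (rule nn_integral_cong_AE, rule AE_mp[OF AE_lborel_singleton[of 0]])
       (auto split: split_indicator)
  also have "\<dots> = (\<integral>\<^sup>+x. f x * indicator {0..} x \<partial>lborel) + (\<integral>\<^sup>+x. f x * indicator {..0} x \<partial>lborel)"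
    by (rule nn_integral_add) auto
  also have "(\<integral>\<^sup>+x. f x * indicator {..0} x \<partial>lborel) = (\<integral>\<^sup>+x. f x * indicator {0..} x \<partial>lborel)"
    by (subst nn_integral_real_affine[where c="-1" and t=0])
       (auto simp: even intro!: nn_integral_cong split: split_indicator)
  finally show ?thesis by (simp add: mult_2)
qed

lemma nn_integral_abs_gauss:
  assumes "b > -1"
  shows "(\<integral>\<^sup>+x. ennreal (\<bar>x\<bar> powr b * exp (- x\<^sup>2)) \<partial>lborel) = ennreal (Gamma ((b + 1) / 2))"
proof -
  let ?g = "\<lambda>x. \<bar>x\<bar> powr b * exp (- x\<^sup>2)"
  have pt: "ennreal ((x\<^sup>2) powr ((b - 1) / 2) * exp (- x\<^sup>2)) * ennreal (2 * x) * indicator {0..} x =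
      2 * (ennreal (?g x) * indicator {0..} x)" for x :: real
  proof (cases "x > 0")
    case True
    have "(x\<^sup>2) powr ((b - 1) / 2) = x powr (b - 1)"
    proof -
      have *: "2 * ((b - 1) / 2) = b - 1" by (simp add: field_simps)
      show ?thesis using powr_square[of x "(b - 1) / 2"] True unfolding * by simp
    qed
    moreover have "x powr (b - 1) * x = x powr b"
      using True by (simp add: powr_diff)
    ultimately have *: "(x\<^sup>2) powr ((b - 1) / 2) * exp (- x\<^sup>2) * (2 * x) = 2 * (?g x)"
      using True by (simp add: algebra_simps)
    have "ennreal ((x\<^sup>2) powr ((b - 1) / 2) * exp (- x\<^sup>2)) * ennreal (2 * x) = ennreal (2 * (?g x))"
      unfolding *[symmetric] using True by (simp add: ennreal_mult)
    also have "\<dots> = 2 * ennreal (?g x)"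
      by (subst ennreal_mult) auto
    finally show ?thesis using True by simp
  qed (auto split: split_indicator)
  have "(\<integral>\<^sup>+x. ennreal (?g x) \<partial>lborel) =
      2 * (\<integral>\<^sup>+x. ennreal (?g x) * indicator {0..} x \<partial>lborel)"
    by (rule nn_integral_even) auto
  also have "\<dots> = (\<integral>\<^sup>+x. ennreal ((x\<^sup>2) powr ((b - 1) / 2) * exp (- x\<^sup>2)) * ennreal (2 * x) * indicator {0..} x \<partial>lborel)"
    unfolding pt by (rule nn_integral_cmult[symmetric]) auto
  also have "\<dots> = (\<integral>\<^sup>+u. ennreal (u powr ((b - 1) / 2) * exp (- u)) * indicator {0..} u \<partial>lborel)"
    by (rule nn_integral_square_subst[symmetric]) auto
  also have "(b - 1) / 2 = (b + 1) / 2 - 1" by (simp add: field_simps)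
  also have "(\<integral>\<^sup>+u. ennreal (u powr ((b + 1) / 2 - 1) * exp (- u)) * indicator {0..} u \<partial>lborel) =
      ennreal (Gamma ((b + 1) / 2))"
    using assms by (intro nn_integral_Gamma) auto
  finally show ?thesis .
qed

text \<open>With v = t^2 - r^2 the Gaussian splits into exp (-r^2) and exp (-v); this is what
  separates the height from the spatial coordinates.\<close>

lemma nn_integral_radial_gauss:
  assumes "\<nu> > 0" "r \<ge> 0"
  shows "(\<integral>\<^sup>+t. ennreal ((t\<^sup>2 - r\<^sup>2) powr (\<nu> - 1) * exp (- t\<^sup>2) * (2 * t)) * indicator {r..} t \<partial>lborel) =
    ennreal (exp (- r\<^sup>2) * Gamma \<nu>)"
proof -
  have "(\<integral>\<^sup>+t. ennreal ((t\<^sup>2 - r\<^sup>2) powr (\<nu> - 1) * exp (- t\<^sup>2) * (2 * t)) * indicator {r..} t \<partial>lborel) =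
     (\<integral>\<^sup>+t. (ennreal ((t\<^sup>2 - r\<^sup>2) powr (\<nu> - 1) * exp (- t\<^sup>2)) * indicator {r\<^sup>2..} (t\<^sup>2)) * ennreal (2 * t) * indicator {0..} t \<partial>lborel)"
    using assms by (intro nn_integral_cong)
      (auto simp: ennreal_mult abs_le_square_iff[symmetric] split: split_indicator)
  also have "\<dots> = (\<integral>\<^sup>+u. ennreal ((u - r\<^sup>2) powr (\<nu> - 1) * exp (- u)) * indicator {r\<^sup>2..} u * indicator {0..} u \<partial>lborel)"
    by (rule nn_integral_square_subst[symmetric]) auto
  also have "\<dots> = (\<integral>\<^sup>+v. ennreal (exp (- r\<^sup>2)) * (ennreal (v powr (\<nu> - 1) * exp (- v)) * indicator {0..} v) \<partial>lborel)"
    by (subst nn_integral_real_affine[where c=1 and t="r\<^sup>2"])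
       (auto simp: mult_exp_exp mult_ac ennreal_mult[symmetric] add_nonneg_nonneg intro!: nn_integral_cong split: split_indicator)
  also have "\<dots> = ennreal (exp (- r\<^sup>2)) * ennreal (Gamma \<nu>)"
    using assms by (subst nn_integral_cmult) (auto simp: nn_integral_Gamma)
  finally show ?thesis using assms by (simp add: ennreal_mult Gamma_real_nonneg)
qed

lemma nn_integral_lborel_vec_prod:
  fixes f :: "'d::finite \<Rightarrow> real \<Rightarrow> ennreal"
  assumes [measurable]: "\<And>i. f i \<in> borel_measurable borel"
  shows "(\<integral>\<^sup>+(x::real^'d). (\<Prod>i\<in>UNIV. f i (x $ i)) \<partial>lborel) = (\<Prod>i\<in>UNIV. \<integral>\<^sup>+u. f i u \<partial>lborel)"
proof -
  \<comment> \<open>The product rule for Lebesgue measure runs over basis vectors;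
    \<open>idx\<close> recovers the coordinate to which a basis vector belongs.\<close>
  define idx :: "real^'d \<Rightarrow> 'd" where "idx = the_inv_into UNIV (\<lambda>i. axis i 1)"
  have inj: "inj (\<lambda>i::'d. axis i (1::real))" by (auto simp: inj_def axis_eq_axis)
  have idx [simp]: "idx (axis i 1) = i" for i unfolding idx_def by (rule the_inv_into_f_f[OF inj UNIV_I])
  have B: "(Basis :: (real^'d) set) = range (\<lambda>i. axis i 1)" by (auto simp: Basis_vec_def)
  have "(\<integral>\<^sup>+(x::real^'d). (\<Prod>b\<in>Basis. f (idx b) (x \<bullet> b)) \<partial>lborel) = (\<Prod>b\<in>(Basis::(real^'d) set). \<integral>\<^sup>+u. f (idx b) u \<partial>lborel)"
    by (rule nn_integral_lborel_prod) auto
  then show ?thesis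
    unfolding B by (simp add: prod.reindex[OF inj] o_def inner_axis)
qed

section \<open>Dirichlet integrals over balls and over the cone\<close>

definition coord_weight :: "('d::finite \<Rightarrow> real) \<Rightarrow> real ^ 'd \<Rightarrow> real" where
  "coord_weight b x = (\<Prod>i\<in>UNIV. \<bar>x $ i\<bar> powr b i)"

lemma coord_weight_nonneg [simp]: "coord_weight b x \<ge> 0"
  by (auto simp: coord_weight_def intro!: prod_nonneg)

lemma coord_weight_measurable [measurable]: "coord_weight b \<in> borel_measurable borel"
  unfolding coord_weight_def by measurable

lemma coord_weight_scale:
  "t > 0 \<Longrightarrow> coord_weight b (t *\<^sub>R x) = t powr (\<Sum>i\<in>UNIV. b i) * coord_weight b x"
  by (simp add: coord_weight_def abs_mult powr_mult prod.distrib powr_sum)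

text \<open>A horizontal slice of the cone at height t. It is kept as a nonnegative integral so that
  the orders of integration can be exchanged before finiteness is known.\<close>

definition ball_section :: "('d::finite \<Rightarrow> real) \<Rightarrow> real \<Rightarrow> real \<Rightarrow> ennreal" where
  "ball_section b \<nu> t = (\<integral>\<^sup>+x. ennreal (coord_weight b x * (t\<^sup>2 - (norm x)\<^sup>2) powr (\<nu> - 1)) * indicator (cball 0 t) x \<partial>lborel)"

text \<open>Dilation by t: the coordinate weights give t to the sum of the b_i, the power of t^2 -
  |x|^2 gives 2\<nu> - 2, and the Jacobian gives the dimension, absorbed as the summands 1.\<close>

lemma ball_section_scale:
  fixes b :: "'d::finite \<Rightarrow> real"
  assumes "t \<ge> 0"
  shows "ball_section b \<nu> t =
    ennreal (t powr ((\<Sum>i\<in>UNIV. b i + 1) + 2 * \<nu> - 2)) * ball_section b \<nu> 1"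
proof (cases "t = 0")
  case True
  \<comment> \<open>At height 0 the slice is the origin, where the integrand is 0 because
    \<open>0 powr a = 0\<close>; the right-hand side vanishes for the same reason.\<close>
  have "ball_section b \<nu> 0 = (\<integral>\<^sup>+(x::real^'d). 0 \<partial>lborel)"
    unfolding ball_section_def by (intro nn_integral_cong) (auto split: split_indicator)
  then show ?thesis using True by simp
next
  case False
  with assms have t: "t > 0" by simp
  have pt: "ennreal (coord_weight b (t *\<^sub>R x) * (t\<^sup>2 - (norm (t *\<^sub>R x))\<^sup>2) powr (\<nu> - 1)) * indicator (cball 0 t) (t *\<^sub>R x)
     = ennreal (t powr ((\<Sum>i\<in>UNIV. b i) + 2 * \<nu> - 2)) *
       (ennreal (coord_weight b x * (1\<^sup>2 - (norm x)\<^sup>2) powr (\<nu> - 1)) * indicator (cball 0 1) x)" for x :: "real^'d"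
  proof (cases "norm x \<le> 1")
    case True
    have "(norm x)\<^sup>2 \<le> 1" using True by (simp add: power_le_one)
    moreover have "t\<^sup>2 - (norm (t *\<^sub>R x))\<^sup>2 = t\<^sup>2 * (1 - (norm x)\<^sup>2)"
      by (simp add: power_mult_distrib algebra_simps)
    moreover have "(t\<^sup>2) powr (\<nu> - 1) = t powr (2 * \<nu> - 2)"
      using t by (simp add: powr_square algebra_simps)
    ultimately have "(t\<^sup>2 - (norm (t *\<^sub>R x))\<^sup>2) powr (\<nu> - 1) = t powr (2 * \<nu> - 2) * (1 - (norm x)\<^sup>2) powr (\<nu> - 1)"
      using t by (simp only: powr_mult)
    then have "coord_weight b (t *\<^sub>R x) * (t\<^sup>2 - (norm (t *\<^sub>R x))\<^sup>2) powr (\<nu> - 1) =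
       t powr ((\<Sum>i\<in>UNIV. b i) + 2 * \<nu> - 2) * (coord_weight b x * (1\<^sup>2 - (norm x)\<^sup>2) powr (\<nu> - 1))"
      using t by (simp add: coord_weight_scale powr_add powr_diff mult_ac)
    then show ?thesis using True t by (simp add: ennreal_mult mult_le_cancel_left1 indicator_def)
  qed (use t in \<open>auto simp: mult_le_cancel_left1 indicator_def\<close>)
  have "ball_section b \<nu> t = (\<integral>\<^sup>+x. ennreal (coord_weight b x * (t\<^sup>2 - (norm x)\<^sup>2) powr (\<nu> - 1)) * indicator (cball 0 t) x
      \<partial>density (distr lborel borel (\<lambda>x::real^'d. 0 + t *\<^sub>R x)) (\<lambda>_. \<bar>t\<bar>^DIM(real^'d)))"
    unfolding ball_section_def using t by (subst lborel_affine[of t 0]) auto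
  also have "\<dots> = ennreal (t ^ CARD('d)) * (\<integral>\<^sup>+(x::real^'d). ennreal (coord_weight b (t *\<^sub>R x) * (t\<^sup>2 - (norm (t *\<^sub>R x))\<^sup>2) powr (\<nu> - 1)) * indicator (cball 0 t) (t *\<^sub>R x) \<partial>lborel)"
    using t by (simp add: nn_integral_density nn_integral_distr nn_integral_cmult)
  also have "\<dots> = ennreal (t ^ CARD('d)) * (ennreal (t powr ((\<Sum>i\<in>UNIV. b i) + 2 * \<nu> - 2)) * ball_section b \<nu> 1)"
    unfolding pt ball_section_def by (subst nn_integral_cmult) auto
  also have "\<dots> = ennreal (t ^ CARD('d) * t powr ((\<Sum>i\<in>UNIV. b i) + 2 * \<nu> - 2)) * ball_section b \<nu> 1"
    using t by (simp add: ennreal_mult mult.assoc)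
  also have "t ^ CARD('d) * t powr ((\<Sum>i\<in>UNIV. b i) + 2 * \<nu> - 2) = t powr ((\<Sum>i\<in>UNIV. b i + 1) + 2 * \<nu> - 2)"
    using t by (simp add: sum.distrib powr_realpow[symmetric] powr_add[symmetric] algebra_simps)
  finally show ?thesis .
qed

text \<open>The Dirichlet integral over the unit ball is found by integrating the ball of radius \<open>t\<close>
  against \<open>2 * t * exp (- t\<^sup>2)\<close>: in the other order of integration the variables separate.\<close>

lemma ball_section_1:
  fixes b :: "'d::finite \<Rightarrow> real"
  assumes b: "\<And>i. b i \<ge> 0" and nu: "\<nu> > 0"
  shows "ball_section b \<nu> 1 = ennreal ((\<Prod>i\<in>UNIV. Gamma ((b i + 1) / 2)) * Gamma \<nu> /
    Gamma ((\<Sum>i\<in>UNIV. (b i + 1) / 2) + \<nu>))"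
proof -
  \<comment> \<open>The homogeneity exponent of the slice. With u = t^2 the integral over t is a
    Gamma integral with argument E/2 + 1.\<close>
  define E where "E = (\<Sum>i\<in>UNIV. b i + 1) + 2 * \<nu> - 2"
  have E: "E / 2 + 1 = (\<Sum>i\<in>UNIV. (b i + 1) / 2) + \<nu>"
    by (simp add: E_def sum_divide_distrib[symmetric] field_simps)
  have pos: "(\<Sum>i\<in>UNIV. (b i + 1) / 2) + \<nu> > 0"
    using b nu by (intro add_nonneg_pos sum_nonneg) auto
  let ?F = "\<lambda>x::real^'d. \<lambda>t. ennreal (coord_weight b x * (t\<^sup>2 - (norm x)\<^sup>2) powr (\<nu> - 1)) * indicator (cball 0 t) x * ennreal (exp (- t\<^sup>2) * (2 * t)) * indicator {0..} t"
  have meas: "case_prod ?F \<in> borel_measurable (lborel \<Otimes>\<^sub>M lborel)"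
  proof -
    \<comment> \<open>The ball has a radius depending on the other variable; as a condition on the
      pair its measurability is visible.\<close>
    have "case_prod ?F = (\<lambda>z. ennreal (coord_weight b (fst z) * ((snd z)\<^sup>2 - (norm (fst z))\<^sup>2) powr (\<nu> - 1)) * (if norm (fst z) \<le> snd z then 1 else 0) * ennreal (exp (- (snd z)\<^sup>2) * (2 * snd z)) * indicator {0..} (snd z))"
      by (auto simp: fun_eq_iff indicator_def)
    then show ?thesis by simp
  qed
  let ?G = "\<Prod>i\<in>UNIV. Gamma ((b i + 1) / 2)"
  let ?e = "(\<Sum>i\<in>UNIV. (b i + 1) / 2) + \<nu>"
  have "(\<integral>\<^sup>+t. \<integral>\<^sup>+x. ?F x t \<partial>lborel \<partial>lborel) = (\<integral>\<^sup>+x. \<integral>\<^sup>+t. ?F x t \<partial>lborel \<partial>lborel)"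
    by (rule lborel_pair.Fubini') (rule meas)
  moreover have "(\<integral>\<^sup>+x. ?F x t \<partial>lborel) = ball_section b \<nu> 1 * (ennreal ((t\<^sup>2) powr (E / 2 + 1 - 1) * exp (- t\<^sup>2)) * ennreal (2 * t) * indicator {0..} t)" for t
  proof (cases "t \<ge> 0")
    case True
    have "(\<integral>\<^sup>+x. ?F x t \<partial>lborel) = ball_section b \<nu> t * (ennreal (exp (- t\<^sup>2) * (2 * t)) * indicator {0..} t)"
      unfolding ball_section_def mult.assoc[of _ "indicator _ _" "ennreal _"] mult.assoc[of _ _ "indicator {0..} _"]
      by (subst nn_integral_multc[symmetric]) (auto simp: mult_ac)
    also have "\<dots> = ennreal (t powr E) * ball_section b \<nu> 1 * (ennreal (exp (- t\<^sup>2) * (2 * t)) * indicator {0..} t)"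
      by (subst ball_section_scale[OF True]) (simp add: E_def)
    also have "t powr E = (t\<^sup>2) powr (E / 2 + 1 - 1)"
      using True by (simp add: powr_square)
    finally show ?thesis using True by (simp add: mult_ac ennreal_mult)
  qed simp
  moreover have "(\<integral>\<^sup>+t. ennreal ((t\<^sup>2) powr (E / 2 + 1 - 1) * exp (- t\<^sup>2)) * ennreal (2 * t) * indicator {0..} t \<partial>lborel) = ennreal (Gamma (E / 2 + 1))"
    using nn_integral_Gamma[of "E / 2 + 1"] pos unfolding E[symmetric]
    by (subst nn_integral_square_subst[symmetric, of "\<lambda>u. ennreal (u powr (E / 2 + 1 - 1) * exp (- u))"]) auto
  moreover have "(\<integral>\<^sup>+t. ?F x t \<partial>lborel) = ennreal (Gamma \<nu>) * (\<Prod>i\<in>UNIV. ennreal (\<bar>x $ i\<bar> powr b i * exp (- (x $ i)\<^sup>2)))" for x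
  proof -
    have "(\<integral>\<^sup>+t. ?F x t \<partial>lborel) = (\<integral>\<^sup>+t. ennreal (coord_weight b x) *
       (ennreal ((t\<^sup>2 - (norm x)\<^sup>2) powr (\<nu> - 1) * exp (- t\<^sup>2) * (2 * t)) * indicator {norm x..} t) \<partial>lborel)"
      by (intro nn_integral_cong)
         (auto simp: ennreal_mult[symmetric] mult_ac split: split_indicator intro: order_trans[OF norm_ge_zero])
    also have "\<dots> = ennreal (coord_weight b x) * ennreal (exp (- (norm x)\<^sup>2) * Gamma \<nu>)"
      using nu by (subst nn_integral_cmult) (auto simp: nn_integral_radial_gauss)
    also have "\<dots> = ennreal (Gamma \<nu>) * ennreal (coord_weight b x * exp (- (norm x)\<^sup>2))"
      using nu by (simp add: ennreal_mult[symmetric] Gamma_real_nonneg mult_ac)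
    also have "coord_weight b x * exp (- (norm x)\<^sup>2) = (\<Prod>i\<in>UNIV. \<bar>x $ i\<bar> powr b i * exp (- (x $ i)\<^sup>2))"
      by (simp add: coord_weight_def prod.distrib norm_vec_def L2_set_def sum_nonneg exp_sum flip: sum_negf)
    finally show ?thesis by (simp add: prod_ennreal)
  qed
  ultimately have "ball_section b \<nu> 1 * ennreal (Gamma (E / 2 + 1)) =
      (\<integral>\<^sup>+(x::real^'d). ennreal (Gamma \<nu>) * (\<Prod>i\<in>UNIV. ennreal (\<bar>x $ i\<bar> powr b i * exp (- (x $ i)\<^sup>2))) \<partial>lborel)"
    by (simp add: nn_integral_cmult)
  also have "\<dots> = ennreal (Gamma \<nu>) * (\<Prod>i\<in>UNIV. \<integral>\<^sup>+u. ennreal (\<bar>u\<bar> powr b i * exp (- u\<^sup>2)) \<partial>lborel)"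
    by (subst nn_integral_cmult)
       (auto simp: nn_integral_lborel_vec_prod[of "\<lambda>i u. ennreal (\<bar>u\<bar> powr b i * exp (- u\<^sup>2))"])
  also have "\<dots> = ennreal (Gamma \<nu> * ?G)"
  proof -
    have "(\<integral>\<^sup>+u. ennreal (\<bar>u\<bar> powr b i * exp (- u\<^sup>2)) \<partial>lborel) = ennreal (Gamma ((b i + 1) / 2))" for i
      using b[of i] by (intro nn_integral_abs_gauss) simp
    moreover have "Gamma ((b i + 1) / 2) \<ge> 0" for i
      using b[of i] by (intro Gamma_real_nonneg) simp
    ultimately show ?thesis using nu
      by (simp only: prod_ennreal) (simp add: ennreal_mult prod_nonneg Gamma_real_nonneg)
  qed
  finally have eq: "ball_section b \<nu> 1 * ennreal (Gamma ?e) =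
    ennreal (Gamma \<nu> * ?G)" unfolding E .
  have G: "Gamma ?e > 0" using pos by (rule Gamma_real_pos)
  then have "ball_section b \<nu> 1 = ball_section b \<nu> 1 * ennreal (Gamma ?e) / ennreal (Gamma ?e)"
    by (simp add: ennreal_mult_divide_eq)
  also have "\<dots> = ennreal (Gamma \<nu> * ?G / Gamma ?e)"
  proof -
    have "Gamma ((b i + 1) / 2) \<ge> 0" for i
      using b[of i] by (intro Gamma_real_nonneg) simp
    then have "?G \<ge> 0" by (intro prod_nonneg) auto
    then show ?thesis unfolding eq using G nu
      by (intro divide_ennreal) (auto intro!: mult_nonneg_nonneg Gamma_real_nonneg)
  qed
  finally show ?thesis by (simp add: mult.commute)
qed

text \<open>Slices at height t scale by a power of t, so the integral factors into the unit ball and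
  a Gamma integral. The bound \<nu> \<ge> 1/2, with dimension at least 1, makes the argument of the
  latter positive.\<close>

lemma cone_nn_integral:
  fixes b :: "'d::finite \<Rightarrow> real"
  assumes b: "\<And>i. b i \<ge> 0" and nu: "\<nu> \<ge> 1/2"
  shows "(\<integral>\<^sup>+z. ennreal (coord_weight b (fst z) * ((snd z)\<^sup>2 - (norm (fst z))\<^sup>2) powr (\<nu> - 1) * snd z ^ l * exp (- snd z)) * indicator solid_cone z \<partial>lborel) =
    ennreal ((\<Prod>i\<in>UNIV. Gamma ((b i + 1) / 2)) * Gamma \<nu> / Gamma ((\<Sum>i\<in>UNIV. (b i + 1) / 2) + \<nu>)
      * Gamma ((\<Sum>i\<in>UNIV. b i + 1) + 2 * \<nu> - 1 + real l))" (is "?L = _")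
proof -
  define E where "E = (\<Sum>i\<in>UNIV. b i + 1) + 2 * \<nu> - 2"
  have "1 \<le> (\<Sum>i\<in>(UNIV::'d set). 1::real)" by simp
  also have "\<dots> \<le> (\<Sum>i\<in>UNIV. b i + 1)" using b by (intro sum_mono) auto
  finally have E: "E + real l + 1 > 0" using nu by (simp add: E_def)
  let ?F = "\<lambda>z::(real^'d)\<times>real. ennreal (coord_weight b (fst z) * ((snd z)\<^sup>2 - (norm (fst z))\<^sup>2) powr (\<nu> - 1) * snd z ^ l * exp (- snd z)) * (if 0 \<le> snd z \<and> norm (fst z) \<le> snd z then 1 else 0)"
  let ?g = "\<lambda>t. ennreal (t powr (E + real l + 1 - 1) * exp (- t)) * indicator {0..} t"
  have "?L = (\<integral>\<^sup>+z. ?F z \<partial>(lborel \<Otimes>\<^sub>M lborel))"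
    unfolding lborel_prod by (intro nn_integral_cong) (auto simp: solid_cone_def split: split_indicator)
  also have "\<dots> = (\<integral>\<^sup>+t. \<integral>\<^sup>+x. ?F (x, t) \<partial>lborel \<partial>lborel)"
    by (subst lborel_pair.nn_integral_snd) auto
  also have "(\<lambda>t. \<integral>\<^sup>+x. ?F (x, t) \<partial>lborel) = (\<lambda>t. ball_section b \<nu> 1 * (?g t))"
  proof
    fix t :: real
    show "(\<integral>\<^sup>+x. ?F (x, t) \<partial>lborel) = ball_section b \<nu> 1 * (?g t)"
    proof (cases "t \<ge> 0")
      case True
      have "(\<integral>\<^sup>+x. ?F (x, t) \<partial>lborel) = (\<integral>\<^sup>+(x::real^'d). (ennreal (coord_weight b x * (t\<^sup>2 - (norm x)\<^sup>2) powr (\<nu> - 1)) * indicator (cball 0 t) x) * ennreal (t ^ l * exp (- t)) \<partial>lborel)"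
        using True by (intro nn_integral_cong) (auto simp: ennreal_mult[symmetric] mult_ac split: split_indicator)
      also have "\<dots> = ball_section b \<nu> t * ennreal (t ^ l * exp (- t))"
        unfolding ball_section_def by (subst nn_integral_multc) auto
      also have "\<dots> = ball_section b \<nu> 1 * (ennreal (t powr E) * ennreal (t ^ l * exp (- t)))"
        by (subst ball_section_scale[OF True]) (simp add: E_def mult_ac)
      also have "ennreal (t powr E) * ennreal (t ^ l * exp (- t)) = ennreal (t powr E * t ^ l * exp (- t))"
        using True by (simp add: ennreal_mult[symmetric] mult.assoc)
      also have "t powr E * t ^ l = t powr (E + real l + 1 - 1)"
        using True by (cases "t = 0") (auto simp: powr_add powr_realpow)
      finally show ?thesis using True by simp
    qed auto
  qed
  also have "(\<integral>\<^sup>+t. ball_section b \<nu> 1 * (?g t) \<partial>lborel) =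
     ball_section b \<nu> 1 * ennreal (Gamma (E + real l + 1))"
    using nn_integral_Gamma[OF E] by (subst nn_integral_cmult) auto
  also have "E + real l + 1 = (\<Sum>i\<in>UNIV. b i + 1) + 2 * \<nu> - 1 + real l" by (simp add: E_def)
  also have "ball_section b \<nu> 1 * ennreal (Gamma ((\<Sum>i\<in>UNIV. b i + 1) + 2 * \<nu> - 1 + real l)) =
    ennreal ((\<Prod>i\<in>UNIV. Gamma ((b i + 1) / 2)) * Gamma \<nu> / Gamma ((\<Sum>i\<in>UNIV. (b i + 1) / 2) + \<nu>)
      * Gamma ((\<Sum>i\<in>UNIV. b i + 1) + 2 * \<nu> - 1 + real l))"
  proof -
    have "Gamma ((b i + 1) / 2) \<ge> 0" for i
      using b[of i] by (intro Gamma_real_nonneg) simp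
    then have "(\<Prod>i\<in>UNIV. Gamma ((b i + 1) / 2)) \<ge> 0" by (intro prod_nonneg) auto
    moreover have "(\<Sum>i\<in>UNIV. (b i + 1) / 2) + \<nu> > 0"
      using b nu by (intro add_nonneg_pos sum_nonneg) (auto intro: add_nonneg_nonneg)
    moreover have "(\<Sum>i\<in>UNIV. b i + 1) + 2 * \<nu> - 1 + real l > 0"
      using E by (simp add: E_def)
    ultimately show ?thesis using nu b
      by (subst ball_section_1, simp, simp, subst ennreal_mult)
        (auto intro!: mult_nonneg_nonneg divide_nonneg_nonneg Gamma_real_nonneg)
  qed
  finally show ?thesis .
qed

section \<open>Reflections and the vanishing of odd moments\<close>

definition reflect :: "'d \<Rightarrow> (real ^ 'd::finite) \<times> real \<Rightarrow> (real ^ 'd) \<times> real" where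
  "reflect i z = ((\<chi> j. if j = i then - fst z $ j else fst z $ j), snd z)"

lemma borel_measurable_fst_snd [measurable]:
  "fst \<in> borel_measurable (borel :: ('a::euclidean_space \<times> 'b::euclidean_space) measure)"
  "snd \<in> borel_measurable (borel :: ('a::euclidean_space \<times> 'b::euclidean_space) measure)"
  by (auto intro!: borel_measurable_continuous_onI continuous_intros)

text \<open>The reflection is a diagonal linear map with entries 1 and -1, whose Jacobian factor is
  1.\<close>

lemma lborel_reflect: "distr lborel borel (reflect (i :: 'd::finite)) = lborel"
proof -
  let ?b0 = "(axis i 1, 0) :: (real^'d) \<times> real"
  define c where "c b = (if b = ?b0 then -1 else 1 :: real)" for b
  have T: "reflect i z = 0 + (\<Sum>j\<in>Basis. (c j * (z \<bullet> j)) *\<^sub>R j)" for z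
  proof (rule euclidean_eqI)
    fix b :: "(real^'d) \<times> real" assume b: "b \<in> Basis"
    have "(0 + (\<Sum>j\<in>Basis. (c j * (z \<bullet> j)) *\<^sub>R j)) \<bullet> b = c b * (z \<bullet> b)"
      using b by (simp add: inner_sum_left_Basis)
    also have "\<dots> = reflect i z \<bullet> b"
      using b by (auto simp: Basis_prod_def Basis_vec_def reflect_def c_def inner_axis axis_eq_axis inner_prod_def split: if_splits)
    finally show "reflect i z \<bullet> b = (0 + (\<Sum>j\<in>Basis. (c j * (z \<bullet> j)) *\<^sub>R j)) \<bullet> b" by simp
  qed
  have "(\<Prod>j\<in>Basis. \<bar>c j\<bar>) = 1" by (rule prod.neutral) (auto simp: c_def)
  moreover have "(lborel :: ((real^'d) \<times> real) measure) = density (distr lborel borel (reflect i)) (\<lambda>_. (\<Prod>j\<in>Basis. \<bar>c j\<bar>))"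
    unfolding T[abs_def] by (rule lborel_affine_euclidean) (auto simp: c_def)
  ultimately show ?thesis by (simp add: density_1)
qed

lemma measurable_reflect [measurable]: "reflect i \<in> borel \<rightarrow>\<^sub>M borel"
proof (rule borel_measurable_continuous_onI)
  have "continuous_on UNIV (\<lambda>z :: (real^'a) \<times> real. if j = i then - fst z $ j else fst z $ j)" for j
    by (cases "j = i") (auto intro!: continuous_intros)
  then show "continuous_on UNIV (reflect i)"
    unfolding reflect_def by (intro continuous_on_Pair continuous_on_vec_lambda continuous_intros)
qed

text \<open>By invariance of Lebesgue measure the integral equals its own negative.\<close>

lemma integral_odd_reflect:
  fixes f :: "(real ^ 'd::finite) \<times> real \<Rightarrow> real"
  assumes f: "f \<in> borel_measurable borel" and odd: "\<And>z. f (reflect i z) = - f z"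
  shows "(LINT z|lborel. f z) = 0"
proof -
  have "(LINT z|lborel. f z) = (LINT z|distr lborel borel (reflect i). f z)"
    by (simp add: lborel_reflect)
  also have "\<dots> = (LINT z|lborel. f (reflect i z))"
    by (rule integral_distr) (use f in auto)
  also have "\<dots> = - (LINT z|lborel. f z)" by (simp add: odd)
  finally show ?thesis by simp
qed

text \<open>The last factor adds no new polynomials, but it is the square of the extra coordinate
  completing x to a vector of length t; keeping it separate gives every moment a product
  form.\<close>

definition cone_monom :: "('d::finite \<Rightarrow> nat) \<Rightarrow> nat \<Rightarrow> nat \<Rightarrow> (real ^ 'd) \<times> real \<Rightarrow> real" where
  "cone_monom \<beta> l c z = (\<Prod>i\<in>UNIV. fst z $ i ^ \<beta> i) * snd z ^ l * ((snd z)\<^sup>2 - (norm (fst z))\<^sup>2) ^ c"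

text \<open>Ratio of two normalized radial moments: degree j + l against t^(2\<alpha>) exp (-t),
  over degree j against r^(2\<alpha> + 1) exp (-r^2/2). It matters only for even j, the Gaussian
  moments being 0 otherwise.\<close>

definition shell_factor :: "real \<Rightarrow> nat \<Rightarrow> nat \<Rightarrow> real" where
  "shell_factor \<alpha> j l = pochhammer (2 * \<alpha> + 1) (j + l) / (2 ^ (j div 2) * pochhammer (\<alpha> + 1) (j div 2))"

lemma gauss_moment_even: "gauss_moment k (2 * a) = 2 ^ a * pochhammer (k + 1/2) a"
  by (induction a) (auto simp: pochhammer_rec' dunkl_step_def algebra_simps)

lemma alpha_index_nonneg:
  fixes \<kappa> :: "real ^ 'd::finite"
  assumes "\<And>i. 0 \<le> \<kappa> $ i" and "0 \<le> \<mu>"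
  shows "alpha_index \<kappa> \<mu> \<ge> 0"
proof -
  have "CARD('d) \<ge> 1" by (simp add: Suc_leI)
  then have "real CARD('d) \<ge> 1" by linarith
  with assms show ?thesis by (auto simp: alpha_index_def intro!: add_nonneg_nonneg sum_nonneg)
qed

lemma cone_weight_measurable [measurable]:
  "cone_weight \<kappa> \<mu> \<in> borel_measurable borel"
  unfolding cone_weight_def h_weight_def case_prod_beta by measurable

lemma solid_cone_measurable [measurable]: "(solid_cone :: ((real ^ 'd::finite) \<times> real) set) \<in> sets borel"
proof -
  have "(solid_cone :: ((real ^ 'd) \<times> real) set) = {z. 0 \<le> snd z \<and> norm (fst z) \<le> snd z}" by (auto simp: solid_cone_def)
  moreover have "closed {z :: (real^'d) \<times> real. 0 \<le> snd z \<and> norm (fst z) \<le> snd z}"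
    by (intro closed_Collect_conj closed_Collect_le continuous_intros)
  ultimately show ?thesis by simp
qed

lemma cone_monom_measurable [measurable]: "cone_monom \<beta> l c \<in> borel_measurable borel"
  unfolding cone_monom_def by (intro borel_measurable_continuous_onI continuous_intros)

lemma abs_pow_mult_powr: "\<bar>u\<bar> ^ b * (\<bar>u\<bar> powr k)\<^sup>2 = \<bar>u\<bar> powr (2 * k + real b)" for u k :: real
proof (cases "u = 0")
  case False
  then have "(\<bar>u\<bar> powr k)\<^sup>2 = \<bar>u\<bar> powr (2 * k)"
    by (simp add: powr_powr mult.commute flip: powr_numeral)
  then show ?thesis using False by (simp add: powr_add powr_realpow)
qed simp

lemma abs_cone_monom_weight:
  fixes \<kappa> :: "real ^ 'd::finite"
  assumes "z \<in> solid_cone"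
  shows "\<bar>cone_monom \<beta> l c z\<bar> * cone_weight \<kappa> \<mu> z =
    coord_weight (\<lambda>i. 2 * \<kappa> $ i + real (\<beta> i)) (fst z) *
      ((snd z)\<^sup>2 - (norm (fst z))\<^sup>2) powr ((\<mu> + 1/2 + real c) - 1) * snd z ^ l * exp (- snd z)"
proof -
  define q where "q = (snd z)\<^sup>2 - (norm (fst z))\<^sup>2"
  have t: "snd z \<ge> 0" and q: "q \<ge> 0"
    using assms by (auto simp: solid_cone_def q_def power_mono)
  have q': "q ^ c * q powr (\<mu> - 1/2) = q powr ((\<mu> + 1/2 + real c) - 1)"
    using q by (cases "q = 0") (auto simp: powr_realpow[symmetric] powr_add[symmetric] algebra_simps)
  have x: "(\<Prod>i\<in>UNIV. \<bar>fst z $ i\<bar> ^ \<beta> i) * (h_weight \<kappa> (fst z))\<^sup>2 =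
      coord_weight (\<lambda>i. 2 * \<kappa> $ i + real (\<beta> i)) (fst z)"
    by (simp add: h_weight_def coord_weight_def prod_power_distrib abs_pow_mult_powr flip: prod.distrib)
  have "\<bar>cone_monom \<beta> l c z\<bar> * cone_weight \<kappa> \<mu> z =
     (\<Prod>i\<in>UNIV. \<bar>fst z $ i\<bar> ^ \<beta> i) * (h_weight \<kappa> (fst z))\<^sup>2 * (q ^ c * q powr (\<mu> - 1/2)) * snd z ^ l * exp (- snd z)"
    using t q by (simp add: cone_monom_def cone_weight_def case_prod_beta abs_mult abs_prod power_abs q_def[symmetric])
  then show ?thesis unfolding x q' by (simp only: q_def)
qed

text \<open>The nonnegative integral computed above is that of the absolute value; its finiteness
  gives integrability. With even exponents the monomial is nonnegative on the cone and agrees with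
  its absolute value there.\<close>

lemma
  fixes \<kappa> :: "real ^ 'd::finite"
  assumes \<kappa>: "\<And>i. 0 \<le> \<kappa> $ i" and \<mu>: "0 \<le> \<mu>"
  defines "b \<equiv> \<lambda>\<beta> i. 2 * \<kappa> $ i + real (\<beta> i)" and "\<nu> \<equiv> \<lambda>c. \<mu> + 1/2 + real c"
  shows cone_monom_integrable: "set_integrable lborel solid_cone (\<lambda>z. cone_monom \<beta> l c z * cone_weight \<kappa> \<mu> z)"
    and cone_monom_integral_even: "(\<And>i. even (\<beta> i)) \<Longrightarrow>
      (LINT z:solid_cone|lborel. cone_monom \<beta> l c z * cone_weight \<kappa> \<mu> z) =
        (\<Prod>i\<in>UNIV. Gamma ((b \<beta> i + 1) / 2)) * Gamma (\<nu> c) / Gamma ((\<Sum>i\<in>UNIV. (b \<beta> i + 1) / 2) + \<nu> c)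
      * Gamma ((\<Sum>i\<in>UNIV. b \<beta> i + 1) + 2 * \<nu> c - 1 + real l)"
proof -
  let ?V = "(\<Prod>i\<in>UNIV. Gamma ((b \<beta> i + 1) / 2)) * Gamma (\<nu> c) / Gamma ((\<Sum>i\<in>UNIV. (b \<beta> i + 1) / 2) + \<nu> c)
      * Gamma ((\<Sum>i\<in>UNIV. b \<beta> i + 1) + 2 * \<nu> c - 1 + real l)"
  have b: "b \<beta> i \<ge> 0" for i using \<kappa>[of i] by (simp add: b_def)
  have nu: "\<nu> c \<ge> 1/2" using \<mu> by (simp add: \<nu>_def)
  let ?g = "\<lambda>z. indicator solid_cone z * (\<bar>cone_monom \<beta> l c z\<bar> * cone_weight \<kappa> \<mu> z)"
  have nonneg: "?g z \<ge> 0" for z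
    by (auto simp: cone_weight_def case_prod_beta indicator_def)
  have "1 \<le> (\<Sum>i\<in>(UNIV::'d set). 1::real)" by simp
  also have "\<dots> \<le> (\<Sum>i\<in>UNIV. b \<beta> i + 1)" using b by (intro sum_mono) auto
  finally have s: "1 \<le> (\<Sum>i\<in>UNIV. b \<beta> i + 1)" .
  have "(\<Sum>i\<in>UNIV. (b \<beta> i + 1) / 2) \<ge> 0"
    using b by (intro sum_nonneg) (auto intro: add_nonneg_nonneg)
  moreover have Gb: "Gamma ((b \<beta> i + 1) / 2) \<ge> 0" for i
      using b[of i] by (intro Gamma_real_nonneg) simp
  moreover from Gb have "(\<Prod>i\<in>UNIV. Gamma ((b \<beta> i + 1) / 2)) \<ge> 0" by (intro prod_nonneg) auto
  ultimately have V: "?V \<ge> 0" using s nu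
    by (intro mult_nonneg_nonneg divide_nonneg_nonneg Gamma_real_nonneg) auto
  have "(\<integral>\<^sup>+z. ennreal (?g z) \<partial>lborel) = ennreal ?V"
    unfolding cone_nn_integral[OF b nu, symmetric]
    by (intro nn_integral_cong) (auto simp: abs_cone_monom_weight b_def \<nu>_def split: split_indicator)
  then have *: "has_bochner_integral lborel ?g ?V"
    using nonneg V by (intro has_bochner_integral_nn_integral) auto
  show "set_integrable lborel solid_cone (\<lambda>z. cone_monom \<beta> l c z * cone_weight \<kappa> \<mu> z)"
    unfolding set_integrable_def
    by (rule Bochner_Integration.integrable_bound[OF conjunct1[OF *[unfolded has_bochner_integral_iff]]])
       (auto simp: abs_mult)
  assume "\<And>i. even (\<beta> i)"
  then have "(\<Prod>i\<in>UNIV. fst z $ i ^ \<beta> i) \<ge> 0" for z :: "(real^'d) \<times> real"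
    by (intro prod_nonneg zero_le_even_power) auto
  then have "cone_monom \<beta> l c z * cone_weight \<kappa> \<mu> z = \<bar>cone_monom \<beta> l c z\<bar> * cone_weight \<kappa> \<mu> z"
    if "z \<in> solid_cone" for z
    using that by (subst abs_of_nonneg)
      (auto simp: cone_monom_def solid_cone_def power_mono intro!: mult_nonneg_nonneg zero_le_power)
  then have "(LINT z:solid_cone|lborel. cone_monom \<beta> l c z * cone_weight \<kappa> \<mu> z) = (LINT z|lborel. ?g z)"
    unfolding set_lebesgue_integral_def
    by (intro Bochner_Integration.integral_cong) (auto simp: indicator_def)
  also have "\<dots> = ?V" using * by (rule has_bochner_integral_integral_eq)
  finally show "(LINT z:solid_cone|lborel. cone_monom \<beta> l c z * cone_weight \<kappa> \<mu> z) = ?V" .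
qed

text \<open>An odd exponent makes both sides 0, the left one by reflection. For even exponents,
  division by the total mass turns the Gamma values into rising factorials, and the powers of 2 in
  the Gaussian moments cancel that in \<open>shell_factor\<close>.\<close>

lemma cone_moment:
  fixes \<kappa> :: "real ^ 'd::finite"
  assumes \<kappa>: "\<And>i. 0 \<le> \<kappa> $ i" and \<mu>: "0 \<le> \<mu>"
  shows "cone_normalization \<kappa> \<mu> * (LINT z:solid_cone|lborel. cone_monom \<beta> l c z * cone_weight \<kappa> \<mu> z) =
    (\<Prod>i\<in>UNIV. gauss_moment (\<kappa> $ i) (\<beta> i)) * gauss_moment \<mu> (2 * c) *
      shell_factor (alpha_index \<kappa> \<mu>) (sum \<beta> UNIV + 2 * c) l"
proof (cases "\<forall>i. even (\<beta> i)")
  case False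
  then obtain i where i: "odd (\<beta> i)" by auto
  have "(LINT z|lborel. indicator solid_cone z *\<^sub>R (cone_monom \<beta> l c z * cone_weight \<kappa> \<mu> z)) = 0"
  proof (rule integral_odd_reflect)
    fix z :: "(real^'d) \<times> real"
    have n: "norm (fst (reflect i z)) = norm (fst z)"
      by (auto simp: reflect_def norm_vec_def L2_set_def intro!: sum.cong)
    have h: "h_weight \<kappa> (fst (reflect i z)) = h_weight \<kappa> (fst z)"
      by (auto simp: reflect_def h_weight_def intro!: prod.cong)
    have "(\<Prod>j\<in>UNIV. fst (reflect i z) $ j ^ \<beta> j) =
       (- (fst z $ i)) ^ \<beta> i * (\<Prod>j\<in>UNIV - {i}. fst (reflect i z) $ j ^ \<beta> j)"
      by (subst prod.remove[of _ i]) (auto simp: reflect_def)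
    also have "(\<Prod>j\<in>UNIV - {i}. fst (reflect i z) $ j ^ \<beta> j) = (\<Prod>j\<in>UNIV - {i}. fst z $ j ^ \<beta> j)"
      by (rule prod.cong) (auto simp: reflect_def)
    also have "(- (fst z $ i)) ^ \<beta> i * \<dots> = - (\<Prod>j\<in>UNIV. fst z $ j ^ \<beta> j)"
      using i by (subst (2) prod.remove[of _ i]) auto
    finally have p: "(\<Prod>j\<in>UNIV. fst (reflect i z) $ j ^ \<beta> j) = - (\<Prod>j\<in>UNIV. fst z $ j ^ \<beta> j)" .
    have s: "snd (reflect i z) = snd z" by (simp add: reflect_def)
    have "indicator solid_cone (reflect i z) = (indicator solid_cone z :: real)"
      by (auto simp: solid_cone_def n s indicator_def case_prod_beta)
    moreover have "cone_weight \<kappa> \<mu> (reflect i z) = cone_weight \<kappa> \<mu> z"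
      by (simp add: cone_weight_def case_prod_beta n s h)
    moreover have "cone_monom \<beta> l c (reflect i z) = - cone_monom \<beta> l c z"
      unfolding cone_monom_def p n s by simp
    ultimately show "indicator solid_cone (reflect i z) *\<^sub>R (cone_monom \<beta> l c (reflect i z) * cone_weight \<kappa> \<mu> (reflect i z)) =
      - (indicator solid_cone z *\<^sub>R (cone_monom \<beta> l c z * cone_weight \<kappa> \<mu> z))"
      by simp
  qed auto
  moreover have "(\<Prod>i\<in>UNIV. gauss_moment (\<kappa> $ i) (\<beta> i)) = 0"
    using i by (intro prod_zero bexI[of _ i]) (auto simp: gauss_moment_odd)
  ultimately show ?thesis by (simp add: set_lebesgue_integral_def)
next
  case True
  define \<alpha> where "\<alpha> = alpha_index \<kappa> \<mu>"
  define a where "a i = \<beta> i div 2" for i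
  have \<beta>: "\<beta> i = 2 * a i" for i using True by (simp add: a_def)
  define p where "p = sum a UNIV + c"
  have sb: "sum \<beta> UNIV + 2 * c = 2 * p" by (simp add: p_def \<beta> sum_distrib_left)
  have \<alpha>: "\<alpha> \<ge> 0" unfolding \<alpha>_def using assms by (rule alpha_index_nonneg)
  have half: "(2 * \<kappa> $ i + real (\<gamma> i) + 1) / 2 = \<kappa> $ i + 1/2 + real (\<gamma> i) / 2" for i and \<gamma> :: "'d \<Rightarrow> nat"
    by (simp add: field_simps)
  have sum_half: "(\<Sum>i\<in>UNIV. (2 * \<kappa> $ i + real (\<gamma> i) + 1) / 2) + (\<mu> + 1/2 + real e) = \<alpha> + 1 + real (sum \<gamma> UNIV) / 2 + real e"
    for \<gamma> :: "'d \<Rightarrow> nat" and e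
    unfolding sum_divide_distrib[symmetric]
    by (simp add: \<alpha>_def alpha_index_def sum.distrib sum_distrib_left[symmetric] sum_distrib_right[symmetric] field_simps)
  have sum_full: "(\<Sum>i\<in>UNIV. 2 * \<kappa> $ i + real (\<gamma> i) + 1) + 2 * (\<mu> + 1/2 + real e) - 1 + real l' = 2 * \<alpha> + 1 + real (sum \<gamma> UNIV) + 2 * real e + real l'"
    for \<gamma> :: "'d \<Rightarrow> nat" and e l'
    by (simp add: \<alpha>_def alpha_index_def sum.distrib sum_distrib_left[symmetric] sum_distrib_right[symmetric] field_simps)
  have I: "(LINT z:solid_cone|lborel. cone_monom \<gamma> l' e z * cone_weight \<kappa> \<mu> z) =
     (\<Prod>i\<in>UNIV. Gamma (\<kappa> $ i + 1/2 + real (\<gamma> i) / 2)) * Gamma (\<mu> + 1/2 + real e) / Gamma (\<alpha> + 1 + real (sum \<gamma> UNIV) / 2 + real e)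
      * Gamma (2 * \<alpha> + 1 + real (sum \<gamma> UNIV) + 2 * real e + real l')" if "\<And>i. even (\<gamma> i)" for \<gamma> :: "'d \<Rightarrow> nat" and e l'
    using cone_monom_integral_even[where \<kappa>=\<kappa> and \<mu>=\<mu> and \<beta>=\<gamma> and l=l' and c=e, OF assms that] unfolding sum_half sum_full unfolding half .
  have I0: "(LINT z:solid_cone|lborel. cone_weight \<kappa> \<mu> z) =
     (\<Prod>i\<in>UNIV. Gamma (\<kappa> $ i + 1/2)) * Gamma (\<mu> + 1/2) / Gamma (\<alpha> + 1) * Gamma (2 * \<alpha> + 1)"
    using I[of "\<lambda>_. 0" 0 0] by (simp add: cone_monom_def)
  have I1: "(LINT z:solid_cone|lborel. cone_monom \<beta> l c z * cone_weight \<kappa> \<mu> z) =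
     (\<Prod>i\<in>UNIV. Gamma (\<kappa> $ i + 1/2 + real (a i))) * Gamma (\<mu> + 1/2 + real c) / Gamma (\<alpha> + 1 + real p)
      * Gamma (2 * \<alpha> + 1 + real (2 * p + l))"
  proof -
    have e1: "\<alpha> + 1 + real (sum \<beta> UNIV) / 2 + real c = \<alpha> + 1 + real p"
      and e2: "2 * \<alpha> + 1 + real (sum \<beta> UNIV) + 2 * real c + real l = 2 * \<alpha> + 1 + real (2 * p + l)"
      by (simp_all add: p_def \<beta> flip: sum_distrib_left)
    have e3: "real (\<beta> i) / 2 = real (a i)" for i by (simp add: \<beta>)
    have "\<And>i. even (\<beta> i)" using True by blast
    from I[where \<gamma>=\<beta> and l'=l and e=c, OF this] show ?thesis unfolding e1 e2 e3 .
  qed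
  have G: "Gamma x > 0 \<and> Gamma (x + real n) = pochhammer x n * Gamma x" if "x > 0" for x n
  proof -
    have "x \<notin> \<int>\<^sub>\<le>\<^sub>0" using that by (auto elim!: nonpos_Ints_cases)
    moreover have "Gamma x > 0" using that by (rule Gamma_real_pos)
    ultimately show ?thesis by (simp add: pochhammer_Gamma)
  qed
  have k: "\<kappa> $ i + 1/2 > 0" for i using \<kappa>[of i] by linarith
  have kG: "Gamma (\<kappa> $ i + 1/2 + real n) = pochhammer (\<kappa> $ i + 1/2) n * Gamma (\<kappa> $ i + 1/2)" for i n
    using G[OF k] by blast
  have kp: "(\<Prod>i\<in>UNIV. Gamma (\<kappa> $ i + 1/2)) > 0"
    using G[OF k] by (intro prod_pos) auto
  have pp: "pochhammer (\<alpha> + 1) p > 0" using \<alpha> by (intro pochhammer_pos) simp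
  have "cone_normalization \<kappa> \<mu> * (LINT z:solid_cone|lborel. cone_monom \<beta> l c z * cone_weight \<kappa> \<mu> z)
     = (\<Prod>i\<in>UNIV. pochhammer (\<kappa> $ i + 1/2) (a i)) * pochhammer (\<mu> + 1/2) c / pochhammer (\<alpha> + 1) p * pochhammer (2 * \<alpha> + 1) (2 * p + l)"
  proof -
    have N: "cone_normalization \<kappa> \<mu> = 1 / ((\<Prod>i\<in>UNIV. Gamma (\<kappa> $ i + 1/2)) * Gamma (\<mu> + 1/2) / Gamma (\<alpha> + 1) * Gamma (2 * \<alpha> + 1))"
      unfolding cone_normalization_def I0 ..
    have M: "Gamma (\<mu> + 1/2 + real c) = pochhammer (\<mu> + 1/2) c * Gamma (\<mu> + 1/2)" "Gamma (\<mu> + 1/2) > 0"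
      using G[of "\<mu> + 1/2"] \<mu> by auto
    have B: "Gamma (\<alpha> + 1 + real p) = pochhammer (\<alpha> + 1) p * Gamma (\<alpha> + 1)" "Gamma (\<alpha> + 1) > 0"
      using G[of "\<alpha> + 1"] \<alpha> by auto
    have C: "Gamma (2 * \<alpha> + 1 + real (2 * p + l)) = pochhammer (2 * \<alpha> + 1) (2 * p + l) * Gamma (2 * \<alpha> + 1)" "Gamma (2 * \<alpha> + 1) > 0"
      using G[of "2 * \<alpha> + 1" "2 * p + l"] \<alpha> by auto
    have "1 / (A * M / B * C) * (P * A * (m * M) / (q * B) * (r * C)) = P * m / q * r"
      if "A > 0" "M > 0" "B > 0" "C > 0" "q > 0" for A M B C P m q r :: real
      using that by (simp add: field_simps)
    then show ?thesis
      unfolding I1 kG prod.distrib N M(1) B(1) C(1) using kp pp M(2) B(2) C(2) by blast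
  qed
  also have "\<dots> = (\<Prod>i\<in>UNIV. gauss_moment (\<kappa> $ i) (\<beta> i)) * gauss_moment \<mu> (2 * c) *
      shell_factor (alpha_index \<kappa> \<mu>) (sum \<beta> UNIV + 2 * c) l"
  proof -
    have "(2::real) ^ p = (\<Prod>i\<in>UNIV. 2 ^ a i) * 2 ^ c" by (simp add: p_def power_add power_sum)
    then show ?thesis
      unfolding shell_factor_def sb \<beta> gauss_moment_even prod.distrib
      by (simp add: \<alpha>_def)
  qed
  finally show ?thesis .
qed

section \<open>The reproducing property\<close>

text \<open>Fixing the values off \<open>I\<close> makes the set finite and lets each distribution
  of the degree be counted once.\<close>

definition compositions :: "'i set \<Rightarrow> nat \<Rightarrow> ('i \<Rightarrow> nat) set" where
  "compositions I n = {\<gamma> \<in> extensional I. sum \<gamma> I = n}"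

lemma fps_prod_nth:
  fixes A :: "'i \<Rightarrow> 'a::comm_ring_1 fps"
  assumes "finite I"
  shows "fps_nth (\<Prod>i\<in>I. A i) n = (\<Sum>\<gamma>\<in>compositions I n. \<Prod>i\<in>I. fps_nth (A i) (\<gamma> i))"
    and "finite (compositions I n)"
proof -
  have "finite (compositions I n) \<and> fps_nth (\<Prod>i\<in>I. A i) n = (\<Sum>\<gamma>\<in>compositions I n. \<Prod>i\<in>I. fps_nth (A i) (\<gamma> i))"
    using assms
  proof (induction I arbitrary: n rule: finite_induct)
    case empty
    have "compositions {} n = (if n = 0 then {\<lambda>_. undefined} else ({} :: ('i \<Rightarrow> nat) set))"
      by (auto simp: compositions_def)
    then show ?case by simp
  next
    case (insert a I)
    let ?S = "SIGMA k:{0..n}. compositions I (n - k)"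
    have sum_upd: "sum (\<gamma>(a := u)) I = sum \<gamma> I" for \<gamma> :: "'i \<Rightarrow> nat" and u
      using insert.hyps by (intro sum.cong) auto
    have fin: "finite ?S" using insert.IH by auto
    \<comment> \<open>A composition over the larger set is its value k at \<open>a\<close> together
      with a composition of n - k over \<open>I\<close>; this matches the Cauchy product with the
      factor of \<open>a\<close>.\<close>
    have im: "compositions (insert a I) n = (\<lambda>(k, \<gamma>). \<gamma>(a := k)) ` ?S"
    proof (intro equalityI subsetI)
      fix \<gamma> assume "\<gamma> \<in> compositions (insert a I) n"
      then have "(\<gamma> a, \<gamma>(a := undefined)) \<in> ?S"
        using insert.hyps sum_upd[of \<gamma> undefined] by (auto simp: compositions_def extensional_def fun_upd_def)
      then show "\<gamma> \<in> (\<lambda>(k, \<gamma>). \<gamma>(a := k)) ` ?S" by (rule image_eqI[rotated]) simp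
    next
      fix \<gamma> assume "\<gamma> \<in> (\<lambda>(k, \<gamma>). \<gamma>(a := k)) ` ?S"
      then obtain k \<gamma>' where *: "\<gamma> = \<gamma>'(a := k)" "k \<le> n" "\<gamma>' \<in> compositions I (n - k)" by auto
      then have "sum \<gamma> I = n - k" by (simp only: sum_upd) (simp add: compositions_def)
      with * show "\<gamma> \<in> compositions (insert a I) n"
        using insert.hyps by (auto simp: compositions_def extensional_def)
    qed
    have inj: "inj_on (\<lambda>(k, \<gamma>). \<gamma>(a := k)) ?S"
    proof (rule inj_onI, clarify)
      fix k \<gamma> k' \<gamma>' assume *: "\<gamma> \<in> compositions I (n - k)" "\<gamma>' \<in> compositions I (n - k')"
        "\<gamma>(a := k) = \<gamma>'(a := k')"
      have "\<gamma> i = \<gamma>' i" for i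
      proof (cases "i = a")
        case True
        then show ?thesis using * insert.hyps by (auto simp: compositions_def extensional_def)
      next
        case False
        then show ?thesis using fun_cong[OF *(3), of i] by simp
      qed
      moreover have "k = k'" using fun_cong[OF *(3), of a] by simp
      ultimately show "k = k' \<and> \<gamma> = \<gamma>'" by auto
    qed
    have "fps_nth (\<Prod>i\<in>insert a I. A i) n = (\<Sum>(k, \<gamma>)\<in>?S. fps_nth (A a) k * (\<Prod>i\<in>I. fps_nth (A i) (\<gamma> i)))"
      using insert by (simp add: fps_mult_nth sum_distrib_left sum.Sigma)
    also have "\<dots> = (\<Sum>x\<in>?S. ((\<lambda>\<gamma>. \<Prod>i\<in>insert a I. fps_nth (A i) (\<gamma> i)) \<circ> (\<lambda>(k, \<gamma>). \<gamma>(a := k))) x)"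
    proof (intro sum.cong refl, clarify)
      fix k \<gamma>
      have "(\<Prod>i\<in>I. fps_nth (A i) ((\<gamma>(a := k)) i)) = (\<Prod>i\<in>I. fps_nth (A i) (\<gamma> i))"
        using insert.hyps by (intro prod.cong) auto
      then show "fps_nth (A a) k * (\<Prod>i\<in>I. fps_nth (A i) (\<gamma> i)) =
          ((\<lambda>\<gamma>. \<Prod>i\<in>insert a I. fps_nth (A i) (\<gamma> i)) \<circ> (\<lambda>(k, \<gamma>). \<gamma>(a := k))) (k, \<gamma>)"
        using insert.hyps by simp
    qed
    also have "\<dots> = (\<Sum>\<gamma>\<in>compositions (insert a I) n. \<Prod>i\<in>insert a I. fps_nth (A i) (\<gamma> i))"
      unfolding im by (rule sum.reindex[OF inj, symmetric])
    finally show ?case using fin im by simp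
  qed
  then show "fps_nth (\<Prod>i\<in>I. A i) n = (\<Sum>\<gamma>\<in>compositions I n. \<Prod>i\<in>I. fps_nth (A i) (\<gamma> i))"
    and "finite (compositions I n)" by auto
qed

section \<open>The candidate kernel and means over the cone\<close>

definition dunkl_exp :: "real \<Rightarrow> real fps" where
  "dunkl_exp k = Abs_fps (\<lambda>n. 1 / dunkl_fact k n)"

text \<open>The even part of the Dunkl exponential at sqrt Q times X. Only even powers occur, so the
  square root disappears and the coefficients are polynomial in Q.\<close>

definition dunkl_exp_even :: "real \<Rightarrow> real \<Rightarrow> real fps" where
  "dunkl_exp_even k Q = Abs_fps (\<lambda>n. if even n then Q ^ (n div 2) / dunkl_fact k n else 0)"

definition cone_quad :: "(real ^ 'd::finite) \<times> real \<Rightarrow> real" where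
  "cone_quad z = (snd z)\<^sup>2 - (norm (fst z))\<^sup>2"

definition dunkl_pairing ::
  "real ^ 'd::finite \<Rightarrow> real \<Rightarrow> (real ^ 'd) \<times> real \<Rightarrow> (real ^ 'd) \<times> real \<Rightarrow> real fps" where
  "dunkl_pairing \<kappa> \<mu> z w =
     (\<Prod>i\<in>UNIV. fps_scale (fst z $ i * fst w $ i) (dunkl_exp (\<kappa> $ i))) * dunkl_exp_even \<mu> (cone_quad z * cone_quad w)"

text \<open>The power 2^n comes from the factor 1/2 under the root of \<rho>, and the rising
  factorial from the integral over \<theta>; the same divisor cancels in the moment
  computation.\<close>

definition cone_pairing ::
  "real ^ 'd::finite \<Rightarrow> real \<Rightarrow> nat \<Rightarrow> (real ^ 'd) \<times> real \<Rightarrow> (real ^ 'd) \<times> real \<Rightarrow> real" where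
  "cone_pairing \<kappa> \<mu> n z w = fps_nth (fps_exp (snd z * snd w) * dunkl_pairing \<kappa> \<mu> z w) n
     / (2 ^ n * pochhammer (alpha_index \<kappa> \<mu> + 1/2) n)"

definition cone_reproducing ::
  "real ^ 'd::finite \<Rightarrow> real \<Rightarrow> nat \<Rightarrow> (real ^ 'd) \<times> real \<Rightarrow> (real ^ 'd) \<times> real \<Rightarrow> real" where
  "cone_reproducing \<kappa> \<mu> N z w = (\<Sum>n\<le>N. cone_pairing \<kappa> \<mu> n z w *
     laguerre (N - n) (2 * alpha_index \<kappa> \<mu> + 2 * real n) (snd z + snd w))"

text \<open>Integrability and value are carried together, so that finite linear combinations can be
  integrated by rules alone.\<close>

definition cone_mean ::
  "real ^ 'd::finite \<Rightarrow> real \<Rightarrow> ((real ^ 'd) \<times> real \<Rightarrow> real) \<Rightarrow> real \<Rightarrow> bool" where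
  "cone_mean \<kappa> \<mu> f v \<longleftrightarrow> set_integrable lborel solid_cone (\<lambda>z. f z * cone_weight \<kappa> \<mu> z) \<and>
     cone_normalization \<kappa> \<mu> * (LINT z:solid_cone|lborel. f z * cone_weight \<kappa> \<mu> z) = v"

lemma cone_mean_0: "cone_mean \<kappa> \<mu> (\<lambda>_. 0) 0"
  by (simp add: cone_mean_def set_integrable_def set_lebesgue_integral_def)

lemma cone_mean_add:
  assumes "cone_mean \<kappa> \<mu> f u" "cone_mean \<kappa> \<mu> g v"
  shows "cone_mean \<kappa> \<mu> (\<lambda>z. f z + g z) (u + v)"
  using assms unfolding cone_mean_def
  by (simp add: distrib_right set_integral_add) (simp add: distrib_left)

lemma cone_mean_cmult:
  assumes "cone_mean \<kappa> \<mu> f u"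
  shows "cone_mean \<kappa> \<mu> (\<lambda>z. c * f z) (c * u)"
  using assms unfolding cone_mean_def by (auto simp: mult.assoc)

lemma cone_mean_sum:
  assumes "\<And>i. i \<in> I \<Longrightarrow> cone_mean \<kappa> \<mu> (f i) (u i)"
  shows "cone_mean \<kappa> \<mu> (\<lambda>z. \<Sum>i\<in>I. f i z) (\<Sum>i\<in>I. u i)"
  using assms by (induction I rule: infinite_finite_induct) (auto simp: cone_mean_0 cone_mean_add)

lemma cone_mean_cong: "cone_mean \<kappa> \<mu> f u \<Longrightarrow> (\<And>z. g z = f z) \<Longrightarrow> v = u \<Longrightarrow> cone_mean \<kappa> \<mu> g v"
  by (simp add: cone_mean_def)

lemma cone_mean_monom:
  fixes \<kappa> :: "real ^ 'd::finite"
  assumes "\<And>i. 0 \<le> \<kappa> $ i" and "0 \<le> \<mu>"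
  shows "cone_mean \<kappa> \<mu> (cone_monom \<beta> l c) ((\<Prod>i\<in>UNIV. gauss_moment (\<kappa> $ i) (\<beta> i)) * gauss_moment \<mu> (2 * c) *
      shell_factor (alpha_index \<kappa> \<mu>) (sum \<beta> UNIV + 2 * c) l)"
  unfolding cone_mean_def using cone_monom_integrable[of \<kappa> \<mu> \<beta> l c] cone_moment[of \<kappa> \<mu> \<beta> l c] assms by auto

definition hermite_prod :: "real ^ 'd::finite \<Rightarrow> ('d \<Rightarrow> nat) \<Rightarrow> real ^ 'd \<Rightarrow> real fps" where
  "hermite_prod \<kappa> \<beta> y = (\<Prod>i\<in>UNIV. fps_scale (y $ i) (dunkl_hermite (\<kappa> $ i) (\<beta> i)))"

text \<open>Only the powers m, m - 2, m - 4, ... occur. The property is multiplicative and thus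
  passes from the one-variable Hermite polynomials to their product.\<close>

definition parity_lead :: "real fps \<Rightarrow> nat \<Rightarrow> real \<Rightarrow> bool" where
  "parity_lead f m c \<longleftrightarrow> (\<forall>i. m < i \<or> odd (m + i) \<longrightarrow> fps_nth f i = 0) \<and> fps_nth f m = c"

lemma parity_lead_mult:
  assumes "parity_lead f m c" "parity_lead g n d"
  shows "parity_lead (f * g) (m + n) (c * d)"
proof -
  have "fps_nth f j * fps_nth g (i - j) = 0" if "m + n < i \<or> odd (m + n + i)" "j \<le> i" for i j
  proof (rule ccontr)
    assume "fps_nth f j * fps_nth g (i - j) \<noteq> 0"
    then have nz: "fps_nth f j \<noteq> 0" "fps_nth g (i - j) \<noteq> 0" by auto
    have "\<not> (m < j \<or> odd (m + j))" using assms(1) nz(1) unfolding parity_lead_def by blast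
    moreover have "\<not> (n < i - j \<or> odd (n + (i - j)))" using assms(2) nz(2) unfolding parity_lead_def by blast
    ultimately have "j \<le> m" "i - j \<le> n" "even ((m + j) + (n + (i - j)))" by simp_all
    moreover have "(m + j) + (n + (i - j)) = m + n + i" using that(2) by simp
    ultimately have "i \<le> m + n" "even (m + n + i)" by (linarith, metis)
    then show False using that(1) by simp
  qed
  moreover have "fps_nth f j * fps_nth g (m + n - j) = (if j = m then c * d else 0)" if "j \<le> m + n" for j
  proof (cases j m rule: linorder_cases)
    case less
    then have "n < m + n - j" using that by simp
    then have "fps_nth g (m + n - j) = 0" using assms(2) unfolding parity_lead_def by blast
    then show ?thesis using less by simp
  next
    case equal
    then show ?thesis using assms by (simp add: parity_lead_def)
  next
    case greater
    then have "fps_nth f j = 0" using assms(1) unfolding parity_lead_def by blast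
    then show ?thesis using greater by simp
  qed
  ultimately show ?thesis unfolding parity_lead_def fps_mult_nth
    by (intro conjI allI impI sum.neutral) simp_all
qed

lemma parity_lead_hermite_prod:
  "parity_lead (hermite_prod \<kappa> \<beta> y) (sum \<beta> UNIV) (\<Prod>i\<in>UNIV. y $ i ^ \<beta> i)"
proof -
  have "parity_lead (\<Prod>i\<in>I. fps_scale (y $ i) (dunkl_hermite (\<kappa> $ i) (\<beta> i))) (sum \<beta> I) (\<Prod>i\<in>I. y $ i ^ \<beta> i)"
    if "finite I" for I
    using that
  proof (induction I rule: finite_induct)
    case empty
    then show ?case by (auto simp: parity_lead_def)
  next
    case (insert a I)
    have "parity_lead (fps_scale (y $ a) (dunkl_hermite (\<kappa> $ a) (\<beta> a))) (\<beta> a) (y $ a ^ \<beta> a)"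
      by (auto simp: parity_lead_def dunkl_hermite_zero)
    from parity_lead_mult[OF this insert.IH] show ?case using insert.hyps by simp
  qed
  then show ?thesis by (simp add: hermite_prod_def)
qed

lemma hermite_prod_decomp:
  "hermite_prod \<kappa> \<beta> y = (\<Sum>b\<le>sum \<beta> UNIV div 2.
    fps_const (fps_nth (hermite_prod \<kappa> \<beta> y) (sum \<beta> UNIV - 2 * b)) * fps_X ^ (sum \<beta> UNIV - 2 * b))"
proof (rule fps_ext)
  fix i
  let ?m = "sum \<beta> UNIV" and ?h = "hermite_prod \<kappa> \<beta> y"
  have *: "fps_nth ?h i = 0" if "?m < i \<or> odd (?m + i)"
    using parity_lead_hermite_prod[of \<kappa> \<beta> y] that by (auto simp: parity_lead_def)
  have "fps_nth (\<Sum>b\<le>?m div 2. fps_const (fps_nth ?h (?m - 2 * b)) * fps_X ^ (?m - 2 * b)) i =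
      (\<Sum>b\<le>?m div 2. if ?m - 2 * b = i then fps_nth ?h i else 0)"
    by (simp add: fps_sum_nth if_distrib cong: if_cong) (rule sum.cong, auto)
  also have "\<dots> = fps_nth ?h i"
  proof (cases "?m < i \<or> odd (?m + i)")
    case True
    then show ?thesis using * by (simp add: sum.neutral)
  next
    case False
    have "(M - 2 * b = i) = (b = (M - i) div 2)" if "\<not> (M < i \<or> odd (M + i))" "b \<le> M div 2" for M b
      using that by presburger
    with False have "(?m - 2 * b = i) = (b = (?m - i) div 2)" if "b \<le> ?m div 2" for b
      using that by blast
    then have "(\<Sum>b\<le>?m div 2. if ?m - 2 * b = i then fps_nth ?h i else 0) =
        (\<Sum>b\<le>?m div 2. if b = (?m - i) div 2 then fps_nth ?h i else 0)"
      by (intro sum.cong) auto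
    also have "(?m - i) div 2 \<le> ?m div 2" by (simp add: div_le_mono)
    then have "(\<Sum>b\<le>?m div 2. if b = (?m - i) div 2 then fps_nth ?h i else 0) = fps_nth ?h i" by simp
    finally show ?thesis .
  qed
  finally show "fps_nth ?h i = fps_nth (\<Sum>b\<le>?m div 2. fps_const (fps_nth ?h (?m - 2 * b)) * fps_X ^ (?m - 2 * b)) i" ..
qed

lemma gauss_moment_ratio:
  assumes "k \<ge> 0"
  shows "gauss_moment k n / dunkl_fact k n = fps_nth (gauss_fps (1/2)) n"
  using arg_cong[OF dunkl_gauss_transform[OF assms, of 0], of "\<lambda>f. fps_nth f n"] by simp

text \<open>All terms of the coefficient at X^j have the same degree, so the radial factor comes out
  and pure Gaussian moments remain. These factor over the coordinates, each giving a Gaussian times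
  a Hermite polynomial.\<close>

lemma cone_mean_monom_pairing:
  fixes \<kappa> :: "real ^ 'd::finite"
  assumes \<kappa>: "\<And>i. 0 \<le> \<kappa> $ i" and \<mu>: "0 \<le> \<mu>"
  shows "cone_mean \<kappa> \<mu> (\<lambda>z. cone_monom \<beta> l 0 z * fps_nth (dunkl_pairing \<kappa> \<mu> z w) j)
    (shell_factor (alpha_index \<kappa> \<mu>) (sum \<beta> UNIV + j) l *
      fps_nth (gauss_fps ((snd w)\<^sup>2 / 2) * hermite_prod \<kappa> \<beta> (fst w)) j)"
proof -
  let ?q = "cone_quad w"
  define E where "E = (\<lambda>i. fps_scale (fst w $ i) (Abs_fps (\<lambda>g. gauss_moment (\<kappa> $ i) (\<beta> i + g) / dunkl_fact (\<kappa> $ i) g)))"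
  define F where "F = Abs_fps (\<lambda>n. if even n then ?q ^ (n div 2) * (gauss_moment \<mu> n / dunkl_fact \<mu> n) else 0)"
  have F: "F = gauss_fps (?q / 2)"
    by (rule fps_ext) (simp add: F_def gauss_moment_ratio[OF \<mu>] gauss_fps_nth power_divide)
  have "(\<Prod>i\<in>UNIV. E i) = (\<Prod>i\<in>UNIV. gauss_fps ((fst w $ i)\<^sup>2 / 2)) * hermite_prod \<kappa> \<beta> (fst w)"
    by (simp add: E_def dunkl_gauss_transform[OF \<kappa>] fps_scale_mult fps_scale_gauss hermite_prod_def prod.distrib)
  also have "(\<Prod>i\<in>UNIV. gauss_fps ((fst w $ i)\<^sup>2 / 2)) = gauss_fps ((norm (fst w))\<^sup>2 / 2)"
    by (simp add: gauss_fps_sum[symmetric] norm_vec_def L2_set_def sum_nonneg sum_divide_distrib)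
  \<comment> \<open>The exponents |y|^2 / 2 from the coordinates and (s^2 - |y|^2) / 2 from the even
    factor add up to s^2 / 2: of the Gaussian only s remains.\<close>
  finally have EF: "(\<Prod>i\<in>UNIV. E i) * F = gauss_fps ((snd w)\<^sup>2 / 2) * hermite_prod \<kappa> \<beta> (fst w)"
    unfolding F by (simp add: cone_quad_def diff_divide_distrib mult_ac flip: gauss_fps_add)
  let ?C = "\<lambda>c \<gamma>. if even (j - c) then (\<Prod>i\<in>UNIV. fst w $ i ^ \<gamma> i / dunkl_fact (\<kappa> $ i) (\<gamma> i)) * (?q ^ ((j - c) div 2) / dunkl_fact \<mu> (j - c)) else 0"
  let ?M = "\<lambda>c \<gamma>. (\<Prod>i\<in>UNIV. gauss_moment (\<kappa> $ i) (\<beta> i + \<gamma> i)) * gauss_moment \<mu> (2 * ((j - c) div 2)) * shell_factor (alpha_index \<kappa> \<mu>) (sum (\<lambda>i. \<beta> i + \<gamma> i) UNIV + 2 * ((j - c) div 2)) l"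
  have "cone_mean \<kappa> \<mu> (\<lambda>z. \<Sum>c=0..j. \<Sum>\<gamma>\<in>compositions UNIV c.
      (?C c \<gamma>)
       * cone_monom (\<lambda>i. \<beta> i + \<gamma> i) l ((j - c) div 2) z)
     (\<Sum>c=0..j. \<Sum>\<gamma>\<in>compositions UNIV c.
      (?C c \<gamma>)
       * (?M c \<gamma>))"
    by (intro cone_mean_sum cone_mean_cmult cone_mean_monom \<kappa> \<mu>)
  then show ?thesis
  proof (rule cone_mean_cong)
    fix z
    show "cone_monom \<beta> l 0 z * fps_nth (dunkl_pairing \<kappa> \<mu> z w) j = (\<Sum>c=0..j. \<Sum>\<gamma>\<in>compositions UNIV c.
      (?C c \<gamma>)
       * cone_monom (\<lambda>i. \<beta> i + \<gamma> i) l ((j - c) div 2) z)"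
      unfolding dunkl_pairing_def fps_mult_nth fps_prod_nth(1)[OF finite_class.finite_UNIV] sum_distrib_left sum_distrib_right
      by (intro sum.cong refl)
         (auto simp: dunkl_exp_def dunkl_exp_even_def cone_monom_def cone_quad_def power_add prod.distrib power_mult_distrib prod_dividef mult_ac)
  next
    have "fps_nth ((\<Prod>i\<in>UNIV. E i) * F) j = (\<Sum>c=0..j. \<Sum>\<gamma>\<in>compositions UNIV c. (\<Prod>i\<in>UNIV. fps_nth (E i) (\<gamma> i)) * fps_nth F (j - c))"
      unfolding fps_mult_nth fps_prod_nth(1)[OF finite_class.finite_UNIV] sum_distrib_right ..
    then show "shell_factor (alpha_index \<kappa> \<mu>) (sum \<beta> UNIV + j) l *
      fps_nth (gauss_fps ((snd w)\<^sup>2 / 2) * hermite_prod \<kappa> \<beta> (fst w)) j =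
     (\<Sum>c=0..j. \<Sum>\<gamma>\<in>compositions UNIV c.
      (?C c \<gamma>)
       * (?M c \<gamma>))"
      unfolding EF[symmetric] by (simp only: sum_distrib_left)
         (intro sum.cong refl,
          auto simp: E_def F_def compositions_def sum.distrib prod.distrib prod_dividef add.assoc mult_ac)
  qed
qed

text \<open>The duplication formula splits (2\<alpha> + 1)_(2e) into rising factorials of \<alpha> +
  1/2 and \<alpha> + 1, and n + b = e + M lets the former be cut at n instead of e. What remains has
  no denominator but M!, the form needed for summation over n.\<close>

lemma hermite_kummer_coeff:
  fixes \<alpha> :: real
  assumes "\<alpha> \<ge> 0" "n + b = e + M"
  shows "pochhammer (2 * \<alpha> + 1) (2 * e + M + k) / (2 ^ n * pochhammer (\<alpha> + 1/2) n) / (2 ^ e * pochhammer (\<alpha> + 1) e) *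
      (2 ^ M * pochhammer (\<alpha> + 1/2 + real e) M / (fact M * pochhammer (2 * \<alpha> + 1 + 2 * real e) M)) =
    2 ^ b * pochhammer (2 * \<alpha> + 1 + real (2 * e + M)) k * pochhammer (\<alpha> + 1/2 + real n) b / fact M"
proof -
  have pos: "pochhammer (\<alpha> + 1/2) n > 0" "pochhammer (\<alpha> + 1) e > 0" "pochhammer (2 * \<alpha> + 1 + 2 * real e) M > 0"
    using assms by (auto intro!: pochhammer_pos)
  have 1: "pochhammer (2 * \<alpha> + 1) (2 * e + M + k) = 2 ^ (2 * e) * pochhammer (\<alpha> + 1/2) e * pochhammer (\<alpha> + 1) e *
      pochhammer (2 * \<alpha> + 1 + 2 * real e) M * pochhammer (2 * \<alpha> + 1 + real (2 * e + M)) k"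
  proof -
    have "2 * e + M + k = 2 * e + (M + k)" by simp
    moreover have "pochhammer (2 * \<alpha> + 1) (2 * e) = 2 ^ (2 * e) * pochhammer (\<alpha> + 1/2) e * pochhammer (\<alpha> + 1) e"
      using pochhammer_double[of "\<alpha> + 1/2" e] by (simp add: algebra_simps)
    ultimately show ?thesis by (simp only: pochhammer_product'[of _ "2 * e"] pochhammer_product'[of _ M]) (simp add: add.assoc)
  qed
  have 2: "pochhammer (\<alpha> + 1/2) e * pochhammer (\<alpha> + 1/2 + real e) M = pochhammer (\<alpha> + 1/2) n * pochhammer (\<alpha> + 1/2 + real n) b"
    unfolding pochhammer_product'[symmetric] assms(2) ..
  have 3: "(2::real) ^ (2 * e) * 2 ^ M = 2 ^ n * 2 ^ e * 2 ^ b"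
    using assms(2) by (simp flip: power_add add: algebra_simps)
  have "p2e * a * c * d * f / (tn * g) / (te * c) * (tM * h / (F * d)) = (p2e * tM) * (a * h) * f / (tn * te * g * F)"
    if "c > 0" "d > 0" for p2e a c d f tn g te tM h F :: real
    using that by (simp add: field_simps)
  note * = this[OF pos(2,3)]
  show ?thesis
    unfolding 1 * 2 3 using pos(1) by simp
qed

text \<open>The factor exp (ts) contributes t^i s^i / i!, the Dunkl factor the remaining degree n -
  i. For each Hermite term b the sum over i is a Kummer sum times a power of s; the condition on m
  excludes a negative power.\<close>

lemma cone_mean_monom_cone_pairing:
  fixes \<kappa> :: "real ^ 'd::finite" and \<beta> :: "'d \<Rightarrow> nat" and w :: "(real ^ 'd) \<times> real"
  assumes \<kappa>: "\<And>i. 0 \<le> \<kappa> $ i" and \<mu>: "0 \<le> \<mu>"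
  defines "\<alpha> \<equiv> alpha_index \<kappa> \<mu>"
  defines "m \<equiv> sum \<beta> UNIV"
  defines "h \<equiv> \<lambda>b. fps_nth (hermite_prod \<kappa> \<beta> (fst w)) (m - 2 * b)"
  shows "cone_mean \<kappa> \<mu> (\<lambda>z. cone_monom \<beta> k 0 z * cone_pairing \<kappa> \<mu> n z w)
    (\<Sum>b\<le>m div 2. if m \<le> n + 2 * b then 2 ^ b * h b * pochhammer (2 * \<alpha> + 1 + real (n + m)) k *
       pochhammer (\<alpha> + 1/2 + real n) b * (snd w ^ (n + 2 * b - m) / fact (n + 2 * b - m)) else 0)"
proof -
  define s where "s = snd w"
  define c where "c = 2 ^ n * pochhammer (\<alpha> + 1/2) n"
  have \<alpha>: "\<alpha> \<ge> 0" unfolding \<alpha>_def using \<kappa> \<mu> by (rule alpha_index_nonneg)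
  define D where "D = gauss_fps (s\<^sup>2 / 2) * hermite_prod \<kappa> \<beta> (fst w)"
  have Dn: "fps_nth D j = (\<Sum>b\<le>m div 2. h b * (if j < m - 2 * b then 0 else fps_nth (gauss_fps (s\<^sup>2 / 2)) (j - (m - 2 * b))))" for j
  proof -
    have "D = (\<Sum>b\<le>m div 2. fps_const (h b) * (gauss_fps (s\<^sup>2 / 2) * fps_X ^ (m - 2 * b)))"
      by (simp only: D_def, subst hermite_prod_decomp)
        (simp only: sum_distrib_left h_def m_def mult_ac)
    then show ?thesis by (simp add: fps_sum_nth fps_X_power_mult_right_nth)
  qed
  let ?W = "\<lambda>b i. shell_factor \<alpha> (m + (n - i)) (k + i) * (if n - i < m - 2 * b then 0 else fps_nth (gauss_fps (s\<^sup>2 / 2)) (n - i - (m - 2 * b)))"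
  have "cone_mean \<kappa> \<mu> (\<lambda>z. (1 / c) * (\<Sum>i=0..n. (s ^ i / fact i) * (cone_monom \<beta> (k + i) 0 z * fps_nth (dunkl_pairing \<kappa> \<mu> z w) (n - i))))
     ((1 / c) * (\<Sum>i=0..n. (s ^ i / fact i) * (shell_factor \<alpha> (m + (n - i)) (k + i) * fps_nth D (n - i))))"
    unfolding \<alpha>_def m_def D_def s_def
    by (intro cone_mean_cmult cone_mean_sum cone_mean_monom_pairing \<kappa> \<mu>)
  then show ?thesis
  proof (rule cone_mean_cong)
    show "cone_monom \<beta> k 0 z * cone_pairing \<kappa> \<mu> n z w = (1 / c) * (\<Sum>i=0..n. (s ^ i / fact i) * (cone_monom \<beta> (k + i) 0 z * fps_nth (dunkl_pairing \<kappa> \<mu> z w) (n - i)))" for z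
      unfolding cone_pairing_def fps_mult_nth
      by (simp add: sum_distrib_left sum_divide_distrib c_def \<alpha>_def s_def
          cone_monom_def power_add power_mult_distrib mult_ac)
  next
    have term_b: "(1 / c) * (\<Sum>i=0..n. (s ^ i / fact i) * (?W b i)) =
        (if m \<le> n + 2 * b then 2 ^ b * pochhammer (2 * \<alpha> + 1 + real (n + m)) k *
       pochhammer (\<alpha> + 1/2 + real n) b * (s ^ (n + 2 * b - m) / fact (n + 2 * b - m)) else 0)"
      if b: "b \<le> m div 2" for b
    proof (cases "m \<le> n + 2 * b")
      case False
      have "(\<Sum>i=0..n. (s ^ i / fact i) * (?W b i)) = 0"
        using False by (intro sum.neutral) auto
      then show ?thesis using False by simp
    next
      case True
      \<comment> \<open>\<open>M\<close> is the resulting power of s. The choice of \<open>e\<close>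
        makes m + n = 2e + M, so each nonzero term has even spatial degree 2(e + a) with M - i =
        2a.\<close>
      define M where "M = n + 2 * b - m"
      define e where "e = m - b"
      have idx: "n + b = e + M" "m + n = 2 * e + M" "M \<le> n" "m - 2 * b + M = n"
        using b True by (auto simp: M_def e_def)
      have c1: "\<alpha> + 1 + real e > 1/2" using \<alpha> by simp
      have pt: "(s ^ i / fact i) * (?W b i) =
          pochhammer (2 * \<alpha> + 1) (2 * e + M + k) / (2 ^ e * pochhammer (\<alpha> + 1) e) * s ^ M *
            (kummer_coeff (\<alpha> + 1 + real e) (M - i) / fact i)" if i: "i \<le> M" for i
      proof -
        have *: "\<not> n - i < m - 2 * b" "n - i - (m - 2 * b) = M - i" using idx i by auto
        show ?thesis
        proof (cases "even (M - i)")
          case False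
          then show ?thesis using * by (simp add: kummer_coeff_def gauss_fps_nth)
        next
          case True
          then obtain a where a: "M - i = 2 * a" by (rule evenE)
          have j: "m + (n - i) = 2 * (e + a)" and t: "2 * (e + a) + (k + i) = 2 * e + M + k" and M: "M = i + 2 * a"
            using a idx i by auto
          have "shell_factor \<alpha> (m + (n - i)) (k + i) =
              pochhammer (2 * \<alpha> + 1) (2 * e + M + k) / (2 ^ e * 2 ^ a * (pochhammer (\<alpha> + 1) e * pochhammer (\<alpha> + 1 + real e) a))"
            unfolding shell_factor_def j t by (simp add: pochhammer_product' power_add)
          moreover have "fps_nth (gauss_fps (s\<^sup>2 / 2)) (M - i) = s ^ (2 * a) / (2 ^ a * fact a)"
            unfolding a by (simp add: gauss_fps_nth power_divide flip: power_mult)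
          moreover have "kummer_coeff (\<alpha> + 1 + real e) (M - i) = 1 / (2 ^ a * 2 ^ a * fact a * pochhammer (\<alpha> + 1 + real e) a)"
            unfolding a by (simp add: kummer_coeff_def flip: power_mult_distrib)
          ultimately show ?thesis using * by (simp only: if_False) (simp add: M power_add mult_ac)
        qed
      qed
      have "(\<Sum>i=0..n. (s ^ i / fact i) * (?W b i)) =
         (\<Sum>i\<le>M. (s ^ i / fact i) * (?W b i))"
        using idx by (intro sum.mono_neutral_right) auto
      also have "\<dots> = (\<Sum>i\<le>M. pochhammer (2 * \<alpha> + 1) (2 * e + M + k) / (2 ^ e * pochhammer (\<alpha> + 1) e) * s ^ M *
            (kummer_coeff (\<alpha> + 1 + real e) (M - i) / fact i))"
        by (intro sum.cong refl pt) simp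
      \<comment> \<open>The order of summation is reversed, i to M - i, to reach the form of
        \<open>kummer_sum\<close>.\<close>
      also have "\<dots> = pochhammer (2 * \<alpha> + 1) (2 * e + M + k) / (2 ^ e * pochhammer (\<alpha> + 1) e) * s ^ M *
          (\<Sum>i\<le>M. kummer_coeff (\<alpha> + 1 + real e) i / fact (M - i))"
        unfolding sum_distrib_left[symmetric]
        by (subst sum.nat_diff_reindex[symmetric, of _ "Suc M", unfolded lessThan_Suc_atMost])
          simp
      also have "(\<Sum>i\<le>M. kummer_coeff (\<alpha> + 1 + real e) i / fact (M - i)) =
          2 ^ M * pochhammer (\<alpha> + 1/2 + real e) M / (fact M * pochhammer (2 * \<alpha> + 1 + 2 * real e) M)"
        unfolding kummer_sum[OF c1] by (simp add: algebra_simps)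
      finally have S: "(\<Sum>i=0..n. (s ^ i / fact i) * (?W b i)) =
          pochhammer (2 * \<alpha> + 1) (2 * e + M + k) / (2 ^ e * pochhammer (\<alpha> + 1) e) * s ^ M *
          (2 ^ M * pochhammer (\<alpha> + 1/2 + real e) M / (fact M * pochhammer (2 * \<alpha> + 1 + 2 * real e) M))" .
      have "(1 / c) * \<dots> = s ^ M * (pochhammer (2 * \<alpha> + 1) (2 * e + M + k) / (2 ^ n * pochhammer (\<alpha> + 1/2) n) / (2 ^ e * pochhammer (\<alpha> + 1) e) *
      (2 ^ M * pochhammer (\<alpha> + 1/2 + real e) M / (fact M * pochhammer (2 * \<alpha> + 1 + 2 * real e) M)))"
        by (simp add: c_def mult_ac)
      also have "\<dots> = s ^ M * (2 ^ b * pochhammer (2 * \<alpha> + 1 + real (2 * e + M)) k * pochhammer (\<alpha> + 1/2 + real n) b / fact M)"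
        unfolding hermite_kummer_coeff[OF \<alpha> idx(1)] ..
      finally show ?thesis unfolding S using True idx(2) by (simp add: M_def add.commute)
    qed
    have "(1 / c) * (\<Sum>i=0..n. (s ^ i / fact i) * (shell_factor \<alpha> (m + (n - i)) (k + i) * fps_nth D (n - i))) =
        (\<Sum>b\<le>m div 2. h b * ((1 / c) * (\<Sum>i=0..n. (s ^ i / fact i) * (?W b i))))"
      unfolding Dn sum_distrib_left by (subst sum.swap) (intro sum.cong refl, simp only: mult_ac)
    also have "\<dots> = (\<Sum>b\<le>m div 2. h b * (if m \<le> n + 2 * b then 2 ^ b * pochhammer (2 * \<alpha> + 1 + real (n + m)) k *
       pochhammer (\<alpha> + 1/2 + real n) b * (s ^ (n + 2 * b - m) / fact (n + 2 * b - m)) else 0))"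
      using term_b by (intro sum.cong) auto
    finally show "(\<Sum>b\<le>m div 2. if m \<le> n + 2 * b then 2 ^ b * h b * pochhammer (2 * \<alpha> + 1 + real (n + m)) k *
       pochhammer (\<alpha> + 1/2 + real n) b * (snd w ^ (n + 2 * b - m) / fact (n + 2 * b - m)) else 0) =
      (1 / c) * (\<Sum>i=0..n. (s ^ i / fact i) * (shell_factor \<alpha> (m + (n - i)) (k + i) * fps_nth D (n - i)))"
      by (simp add: s_def if_distrib mult_ac cong: if_cong)
  qed
qed

text \<open>As (1 - X)^(-q) X^q is the q-th power of X / (1 - X), the sum over n is one coefficient
  of a composition with \<open>f\<close>. Since \<open>f\<close> is a polynomial times exp (sX), the
  exponentials cancel, and the factor (1 - X)^(k + 2b) clears the denominators of the polynomial in
  X / (1 - X).\<close>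

lemma poisson_shift_sum:
  fixes d N k b :: nat
  assumes A: "poisson_poly (Abs_fps f) s (k + b) A"
  shows "(\<Sum>n\<le>N. if d \<le> n then f (n - d) * fps_nth (one_minus_powr (real d + real k + 2 * real b - real n) * (fps_exp (- s) oo zeta)) (N - n) else 0) =
    (\<Sum>i\<le>k + b. fps_nth A i * fps_nth (fps_X ^ (d + i) * (1 - fps_X) ^ (k + 2 * b - i)) N)"
proof (cases "d \<le> N")
  case False
  then have "(\<Sum>n\<le>N. if d \<le> n then f (n - d) * fps_nth (one_minus_powr (real d + real k + 2 * real b - real n) * (fps_exp (- s) oo zeta)) (N - n) else 0) = 0"
    by (intro sum.neutral) auto
  moreover have "fps_nth (fps_X ^ (d + i) * (1 - fps_X) ^ (k + 2 * b - i) :: real fps) N = 0" for i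
    using False by (simp add: fps_X_power_mult_nth)
  ultimately show ?thesis by simp
next
  case True
  define N' where "N' = N - d"
  let ?ex = "fps_exp (- s) oo zeta"
  define P where "P = one_minus_powr (real (k + 2 * b))"
  let ?v = "\<lambda>n. one_minus_powr (real d + real k + 2 * real b - real n) * ?ex"
  let ?p = "\<lambda>i. fps_X ^ (d + i) * (1 - fps_X) ^ (k + 2 * b - i)"
  have "(\<Sum>n\<le>N. if d \<le> n then f (n - d) * fps_nth (?v n) (N - n) else 0) =
      (\<Sum>n\<in>{d..N}. f (n - d) * fps_nth (?v n) (N - n))"
    by (rule sum.mono_neutral_cong_right) auto
  also have "\<dots> = (\<Sum>q\<le>N'. f q * fps_nth (P * ?ex * zeta ^ q) N')"
  proof (rule sum.reindex_bij_witness[of _ "\<lambda>q. q + d" "\<lambda>n. n - d"])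
    fix n assume n: "n \<in> {d..N}"
    have eq: "P * ?ex * zeta ^ (n - d) = fps_X ^ (n - d) * (?v n)"
      using zeta_power_mult[of "real (k + 2 * b)" "n - d"] n
      by (simp add: P_def of_nat_diff mult_ac algebra_simps)
    have "N' - (n - d) = N - n" "n - d \<le> N'" using n by (auto simp: N'_def)
    then show "f (n - d) * fps_nth (P * ?ex * zeta ^ (n - d)) N' =
        f (n - d) * fps_nth (?v n) (N - n)"
      unfolding eq by (simp add: fps_X_power_mult_nth)
  qed (use True in \<open>auto simp: N'_def\<close>)
  also have "\<dots> = fps_nth (P * ?ex * (Abs_fps f oo zeta)) N'"
    by (simp add: fps_mult_compose_nth)
  also have "Abs_fps f oo zeta = (A oo zeta) * (fps_exp s oo zeta)"
    using A by (simp add: poisson_poly_def fps_compose_mult_distrib)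
  also have "P * ?ex * ((A oo zeta) * (fps_exp s oo zeta)) = P * (A oo zeta) * ((fps_exp (- s) * fps_exp s) oo zeta)"
    by (simp add: fps_compose_mult_distrib mult_ac)
  \<comment> \<open>Here the exponential from the second argument of the kernel meets the one
    created by integration.\<close>
  also have "(fps_exp (- s) * fps_exp s) oo zeta = 1"
    by (simp flip: fps_exp_add_mult)
  also have "fps_nth (P * (A oo zeta) * 1) N' = (\<Sum>i\<le>N'. fps_nth A i * fps_nth (P * zeta ^ i) N')"
    by (simp add: fps_mult_compose_nth)
  also have "\<dots> = (\<Sum>i\<le>N' + (k + b). fps_nth A i * fps_nth (P * zeta ^ i) N')"
    by (rule sum.mono_neutral_left) (auto simp: P_def zeta_power_mult fps_X_power_mult_nth)
  also have "\<dots> = (\<Sum>i\<le>k + b. fps_nth A i * fps_nth (P * zeta ^ i) N')"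
    using A by (intro sum.mono_neutral_right) (auto simp: poisson_poly_def)
  also have "\<dots> = (\<Sum>i\<le>k + b. fps_nth A i * fps_nth (?p i) N)"
  proof (intro sum.cong refl)
    fix i assume "i \<in> {..k + b}"
    then have i: "i \<le> k + 2 * b" by simp
    have "P * zeta ^ i = fps_X ^ i * (1 - fps_X) ^ (k + 2 * b - i)"
      unfolding P_def zeta_power_mult one_minus_powr_of_nat[symmetric] using i by (simp add: of_nat_diff)
    moreover have "fps_nth (fps_X ^ (d + i) * (1 - fps_X) ^ (k + 2 * b - i) :: real fps) N =
        fps_nth (fps_X ^ i * (1 - fps_X) ^ (k + 2 * b - i)) N'"
      using True unfolding power_add mult.assoc by (subst fps_X_power_mult_nth) (simp add: N'_def)
    ultimately show "fps_nth A i * fps_nth (P * zeta ^ i) N' = fps_nth A i * fps_nth (?p i) N"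
      by simp
  qed
  finally show ?thesis .
qed

text \<open>\<open>R N\<close> is the coefficient at X^N of a polynomial of degree at most m + k.
  Vanishing beyond that degree is orthogonality; the sum of all coefficients, the value at 1, is the
  reproducing property.\<close>

lemma cone_mean_monom_reproducing:
  fixes \<kappa> :: "real ^ 'd::finite" and \<beta> :: "'d \<Rightarrow> nat" and w :: "(real ^ 'd) \<times> real"
  assumes \<kappa>: "\<And>i. 0 \<le> \<kappa> $ i" and \<mu>: "0 \<le> \<mu>"
  defines "m \<equiv> sum \<beta> UNIV"
  obtains R where "\<And>N. cone_mean \<kappa> \<mu> (\<lambda>z. cone_monom \<beta> k 0 z * cone_reproducing \<kappa> \<mu> N z w) (R N)"
    and "\<And>N. m + k < N \<Longrightarrow> R N = 0"
    and "\<And>M. m + k \<le> M \<Longrightarrow> (\<Sum>N\<le>M. R N) = cone_monom \<beta> k 0 w"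
proof -
  define s where "s = snd w"
  define \<alpha> where "\<alpha> = alpha_index \<kappa> \<mu>"
  define h where "h b = fps_nth (hermite_prod \<kappa> \<beta> (fst w)) (m - 2 * b)" for b
  \<comment> \<open>The term of \<open>V\<close> in the variable q = n + 2b - m, the power of s; the
    rising factorials become shifts of q as in \<open>poisson_poly_exists\<close>.\<close>
  define f where "f b q = pochhammer (real q + (2 * \<alpha> + 1 + 2 * real m - 2 * real b)) k *
    pochhammer (real q + (\<alpha> + 1/2 + real m - 2 * real b)) b * (s ^ q / fact q)" for b q
  have "\<forall>b. \<exists>A. poisson_poly (Abs_fps (f b)) s (k + b) A"
    unfolding f_def by (intro allI poisson_poly_exists)
  then obtain A where A: "\<And>b. poisson_poly (Abs_fps (f b)) s (k + b) (A b)" by metis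
  define R where "R N = (\<Sum>b\<le>m div 2. 2 ^ b * h b * (\<Sum>i\<le>k + b. fps_nth (A b) i *
      fps_nth (fps_X ^ (m - 2 * b + i) * (1 - fps_X) ^ (k + 2 * b - i)) N))" for N
  let ?ex = "fps_exp (- s) oo zeta"
  define U where "U n = one_minus_powr (- (2 * \<alpha> + 2 * real n) - 1) * ?ex" for n
  define V where "V n l = (\<Sum>b\<le>m div 2. if m \<le> n + 2 * b then 2 ^ b * h b * pochhammer (2 * \<alpha> + 1 + real (n + m)) l *
       pochhammer (\<alpha> + 1/2 + real n) b * (s ^ (n + 2 * b - m) / fact (n + 2 * b - m)) else 0)" for n l
  have V: "cone_mean \<kappa> \<mu> (\<lambda>z. cone_monom \<beta> l 0 z * cone_pairing \<kappa> \<mu> n z w) (V n l)" for n l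
    unfolding V_def h_def m_def \<alpha>_def s_def by (rule cone_mean_monom_cone_pairing[OF \<kappa> \<mu>])
  let ?u = "\<lambda>N n i. (-1) ^ i / fact i * fps_nth (U n * zeta ^ i) (N - n)"
  let ?B = "\<lambda>N n b. if m - 2 * b \<le> n then f b (n - (m - 2 * b)) * fps_nth (one_minus_powr (real (m - 2 * b) + real k + 2 * real b - real n) * ?ex) (N - n) else 0"
  have inner: "(\<Sum>i\<le>N - n. (?u N n i) * V n (k + i)) =
      (\<Sum>b\<le>m div 2. 2 ^ b * h b * (?B N n b))" for n N
  proof -
    \<comment> \<open>The part of the rising factorial of length k + i beyond k starts at
      \<open>a\<close>. The sum over i is then the binomial series of (1 + X/(1 - X))^(-a) = (1 -
      X)^a, which performs the t-integration of the Laguerre factor.\<close>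
    define a where "a = 2 * \<alpha> + 1 + real (n + m) + real k"
    have "(\<Sum>i\<le>N - n. (?u N n i) * V n (k + i)) =
      (\<Sum>b\<le>m div 2. \<Sum>i\<le>N - n. (?u N n i) * (if m \<le> n + 2 * b then 2 ^ b * h b * pochhammer (2 * \<alpha> + 1 + real (n + m)) (k + i) *
       pochhammer (\<alpha> + 1/2 + real n) b * (s ^ (n + 2 * b - m) / fact (n + 2 * b - m)) else 0))"
      unfolding V_def sum_distrib_left by (rule sum.swap)
    also have "\<dots> = (\<Sum>b\<le>m div 2. 2 ^ b * h b * (?B N n b))"
    proof (intro sum.cong refl)
      fix b assume b: "b \<in> {..m div 2}"
      show "(\<Sum>i\<le>N - n. (?u N n i) * (if m \<le> n + 2 * b then 2 ^ b * h b * pochhammer (2 * \<alpha> + 1 + real (n + m)) (k + i) *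
       pochhammer (\<alpha> + 1/2 + real n) b * (s ^ (n + 2 * b - m) / fact (n + 2 * b - m)) else 0)) =
       2 ^ b * h b * (?B N n b)"
      proof (cases "m \<le> n + 2 * b")
        case False
        then show ?thesis by simp
      next
        case True
        have q: "n - (m - 2 * b) = n + 2 * b - m" using b True by auto
        have rq: "real (n + 2 * b - m) = real n + 2 * real b - real m" using True by (simp add: of_nat_diff)
        have rd: "real (m - 2 * b) = real m - 2 * real b" using b by (subst of_nat_diff) auto
        have fb: "f b (n - (m - 2 * b)) = pochhammer (2 * \<alpha> + 1 + real (n + m)) k *
             pochhammer (\<alpha> + 1/2 + real n) b * (s ^ (n + 2 * b - m) / fact (n + 2 * b - m))"
          unfolding f_def q rq by (simp add: algebra_simps)
        have bin: "(-1) ^ i / fact i * pochhammer a i = fps_nth (fps_binomial (- a)) i" for i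
          by (simp add: gbinomial_pochhammer)
        have "(\<Sum>i\<le>N - n. (?u N n i) * (2 ^ b * h b * pochhammer (2 * \<alpha> + 1 + real (n + m)) (k + i) *
            pochhammer (\<alpha> + 1/2 + real n) b * (s ^ (n + 2 * b - m) / fact (n + 2 * b - m)))) =
          2 ^ b * h b * f b (n - (m - 2 * b)) * (\<Sum>i\<le>N - n. ((-1) ^ i / fact i * pochhammer a i) * fps_nth (U n * zeta ^ i) (N - n))"
          unfolding fb sum_distrib_left a_def pochhammer_product'
          by (intro sum.cong refl) (simp only: mult_ac)
        also have "\<dots> = 2 ^ b * h b * f b (n - (m - 2 * b)) * fps_nth (U n * one_minus_powr a) (N - n)"
          unfolding bin by (simp only: fps_mult_compose_nth[symmetric] zeta_nth_0 fps_binomial_compose_zeta)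
        also have "U n * one_minus_powr a = (one_minus_powr (- (2 * \<alpha> + 2 * real n) - 1) * one_minus_powr a) * ?ex"
          by (simp add: U_def mult_ac)
        \<comment> \<open>In the sum of the exponents \<alpha> cancels and m + k - n remains,
          written with m - 2b as in \<open>poisson_shift_sum\<close>.\<close>
        also have "one_minus_powr (- (2 * \<alpha> + 2 * real n) - 1) * one_minus_powr a =
            one_minus_powr (real (m - 2 * b) + real k + 2 * real b - real n)"
          unfolding one_minus_powr_add[symmetric] rd a_def by (simp add: algebra_simps)
        finally show ?thesis using True b by (simp add: mult_ac)
      qed
    qed
    finally show ?thesis .
  qed
  have "cone_mean \<kappa> \<mu> (\<lambda>z. cone_monom \<beta> k 0 z * cone_reproducing \<kappa> \<mu> N z w) (R N)" for N
  proof -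
    have "cone_mean \<kappa> \<mu> (\<lambda>z. \<Sum>n\<le>N. \<Sum>i\<le>N - n. (?u N n i) *
        (cone_monom \<beta> (k + i) 0 z * cone_pairing \<kappa> \<mu> n z w))
      (\<Sum>n\<le>N. \<Sum>i\<le>N - n. (?u N n i) * V n (k + i))"
      by (intro cone_mean_sum cone_mean_cmult V)
    then show ?thesis
    proof (rule cone_mean_cong)
      fix z
      show "cone_monom \<beta> k 0 z * cone_reproducing \<kappa> \<mu> N z w = (\<Sum>n\<le>N. \<Sum>i\<le>N - n. (?u N n i) *
        (cone_monom \<beta> (k + i) 0 z * cone_pairing \<kappa> \<mu> n z w))"
        unfolding cone_reproducing_def laguerre_add sum_distrib_left
        by (intro sum.cong refl)
          (simp add: U_def s_def \<alpha>_def cone_monom_def power_add power_minus[of "snd z"] mult_ac)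
    next
      have "(\<Sum>n\<le>N. \<Sum>i\<le>N - n. (?u N n i) * V n (k + i)) =
        (\<Sum>b\<le>m div 2. 2 ^ b * h b * (\<Sum>n\<le>N. if m - 2 * b \<le> n then f b (n - (m - 2 * b)) *
         fps_nth (one_minus_powr (real (m - 2 * b) + real k + 2 * real b - real n) * ?ex) (N - n) else 0))"
        unfolding inner sum_distrib_left by (rule sum.swap)
      then show "R N = (\<Sum>n\<le>N. \<Sum>i\<le>N - n. (?u N n i) * V n (k + i))"
        unfolding R_def poisson_shift_sum[OF A] by simp
    qed
  qed
  moreover have "R N = 0" if "m + k < N" for N
  proof -
    \<comment> \<open>The exponents m - 2b + i and k + 2b - i add up to m + k, whatever b and i
      are.\<close>
    have "fps_nth (fps_X ^ (m - 2 * b + i) * (1 - fps_X) ^ (k + 2 * b - i) :: real fps) N = 0" if "b \<le> m div 2" "i \<le> k + b" for b i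
      using that \<open>m + k < N\<close> by (intro coeff_monom_one_minus_zero) auto
    then show ?thesis unfolding R_def by (intro sum.neutral ballI) simp
  qed
  moreover have "(\<Sum>N\<le>M. R N) = cone_monom \<beta> k 0 w" if M: "m + k \<le> M" for M
  proof -
    have "(\<Sum>N\<le>M. R N) = (\<Sum>b\<le>m div 2. 2 ^ b * h b * (\<Sum>i\<le>k + b. fps_nth (A b) i *
      (\<Sum>N\<le>M. fps_nth (fps_X ^ (m - 2 * b + i) * (1 - fps_X) ^ (k + 2 * b - i)) N)))"
      unfolding R_def by (simp only: sum_distrib_left) (subst sum.swap, rule sum.cong[OF refl], rule sum.swap)
    also have "\<dots> = (\<Sum>b\<le>m div 2. 2 ^ b * h b * (\<Sum>i\<le>k + b. fps_nth (A b) i * 0 ^ (k + 2 * b - i)))"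
    proof (intro sum.cong refl arg_cong2[where f="(*)"])
      fix b i assume "b \<in> {..m div 2}" "i \<in> {..k + b}"
      then show "(\<Sum>N\<le>M. fps_nth (fps_X ^ (m - 2 * b + i) * (1 - fps_X) ^ (k + 2 * b - i) :: real fps) N) = 0 ^ (k + 2 * b - i)"
        using M by (intro sum_coeff_monom_one_minus) auto
    qed
    also have "\<dots> = (\<Sum>b\<le>m div 2. if b = 0 then h 0 * s ^ k else 0)"
    proof (intro sum.cong refl)
      fix b
      \<comment> \<open>A nonzero term needs i = k + 2b, while i \<le> k + b; this forces b = 0 and
        i = k, the top coefficient s^k.\<close>
      have "(\<Sum>i\<le>k + b. fps_nth (A b) i * 0 ^ (k + 2 * b - i)) = (\<Sum>i\<le>k + b. if b = 0 \<and> i = k then fps_nth (A 0) k else 0)"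
        by (intro sum.cong refl) (auto simp: power_0_left)
      also have "\<dots> = (if b = 0 then s ^ k else 0)"
        using A[of 0] by (auto simp: poisson_poly_def)
      finally show "2 ^ b * h b * (\<Sum>i\<le>k + b. fps_nth (A b) i * 0 ^ (k + 2 * b - i)) = (if b = 0 then h 0 * s ^ k else 0)"
        by simp
    qed
    also have "\<dots> = h 0 * s ^ k" by simp
    also have "h 0 = (\<Prod>i\<in>UNIV. fst w $ i ^ \<beta> i)"
      using parity_lead_hermite_prod[of \<kappa> \<beta> "fst w"] by (simp add: h_def m_def parity_lead_def)
    finally show ?thesis by (simp add: cone_monom_def s_def)
  qed
  ultimately show ?thesis using that by blast
qed

section \<open>The integral over the angle\<close>

text \<open>By evenness the integral is twice that over [0, 1], and v = u^2 turns it into the Beta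
  integral.\<close>

lemma Beta_interval:
  fixes i :: nat
  assumes "c > 0"
  shows "(\<integral>\<^sup>+u. ennreal (\<bar>u\<bar> ^ i * (1 - u\<^sup>2) powr (c - 1)) * indicator {-1..1} u \<partial>lborel) =
    ennreal (Beta ((real i + 1) / 2) c)"
proof -
  let ?g = "\<lambda>v. ennreal (indicator {0..1} v * (v powr ((real i + 1) / 2 - 1) * (1 - v) powr (c - 1)))"
  have pt: "2 * (ennreal (\<bar>x\<bar> ^ i * (1 - x\<^sup>2) powr (c - 1)) * indicator {-1..1} x * indicator {0..} x) =
      ?g (x\<^sup>2) * ennreal (2 * x) * indicator {0..} x" if "x \<noteq> 0" for x :: real
  proof (cases "0 < x \<and> x \<le> 1")
    case True
    then have x2: "x\<^sup>2 \<le> 1" by (simp add: power_le_one)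
    have e: "2 * ((real i + 1) / 2 - 1) = real i - 1" by (simp add: field_simps)
    have "(x\<^sup>2) powr ((real i + 1) / 2 - 1) = x powr (real i - 1)"
      using powr_square[of x "(real i + 1) / 2 - 1"] True unfolding e by simp
    moreover have "x powr (real i - 1) * x = x ^ i"
      using True by (simp add: powr_diff powr_realpow)
    ultimately have "(x\<^sup>2) powr ((real i + 1) / 2 - 1) * (1 - x\<^sup>2) powr (c - 1) * (2 * x) = 2 * (\<bar>x\<bar> ^ i * (1 - x\<^sup>2) powr (c - 1))"
      using True by (simp add: algebra_simps)
    then have "?g (x\<^sup>2) * ennreal (2 * x) = ennreal (2 * (\<bar>x\<bar> ^ i * (1 - x\<^sup>2) powr (c - 1)))"
      using True x2 by (simp add: ennreal_mult[symmetric])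
    also have "\<dots> = 2 * ennreal (\<bar>x\<bar> ^ i * (1 - x\<^sup>2) powr (c - 1))"
      by (subst ennreal_mult) auto
    finally show ?thesis using True by simp
  next
    case False
    then have "x < 0 \<or> x > 1" using that by auto
    then show ?thesis
    proof
      assume "x > 1"
      then have "x\<^sup>2 > 1" by (simp add: one_less_power)
      then have "x\<^sup>2 \<notin> {0..1}" by (metis atLeastAtMost_iff not_le)
      with \<open>x > 1\<close> show ?thesis by simp
    qed simp
  qed
  have "(\<integral>\<^sup>+u. ennreal (\<bar>u\<bar> ^ i * (1 - u\<^sup>2) powr (c - 1)) * indicator {-1..1} u \<partial>lborel) =
      2 * (\<integral>\<^sup>+u. ennreal (\<bar>u\<bar> ^ i * (1 - u\<^sup>2) powr (c - 1)) * indicator {-1..1} u * indicator {0..} u \<partial>lborel)"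
    by (rule nn_integral_even) (auto split: split_indicator)
  also have "\<dots> = (\<integral>\<^sup>+u. 2 * (ennreal (\<bar>u\<bar> ^ i * (1 - u\<^sup>2) powr (c - 1)) * indicator {-1..1} u * indicator {0..} u) \<partial>lborel)"
    by (rule nn_integral_cmult[symmetric]) auto
  also have "\<dots> = (\<integral>\<^sup>+x. ?g (x\<^sup>2) * ennreal (2 * x) * indicator {0..} x \<partial>lborel)"
    by (rule nn_integral_cong_AE, rule AE_mp[OF AE_lborel_singleton[of 0]]) (use pt in auto)
  also have "\<dots> = (\<integral>\<^sup>+v. ?g v * indicator {0..} v \<partial>lborel)"
    by (rule nn_integral_square_subst[symmetric]) auto
  also have "\<dots> = (\<integral>\<^sup>+v. ?g v \<partial>lborel)"
    by (intro nn_integral_cong) (auto split: split_indicator)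
  also have "\<dots> = ennreal (Beta ((real i + 1) / 2) c)"
    using assms by (intro nn_integral_has_integral_lebesgue has_integral_Beta_real) auto
  finally show ?thesis .
qed

lemma Beta_real_nonneg: "a > 0 \<Longrightarrow> b > 0 \<Longrightarrow> Beta a b \<ge> (0::real)"
  by (simp add: Beta_def Gamma_real_nonneg)

lemma even_weight_integral:
  fixes i :: nat
  assumes "c > 0"
  shows "integrable lborel (\<lambda>u. indicator {-1..1} u * (u ^ i * (1 - u\<^sup>2) powr (c - 1)))"
    and "(LINT u|lborel. indicator {-1..1} u * (u ^ i * (1 - u\<^sup>2) powr (c - 1))) =
      (if even i then Beta ((real i + 1) / 2) c else 0)"
proof -
  let ?f = "\<lambda>u. indicator {-1..1} u * (u ^ i * (1 - u\<^sup>2) powr (c - 1)) :: real"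
  let ?g = "\<lambda>u. indicator {-1..1} u * (\<bar>u\<bar> ^ i * (1 - u\<^sup>2) powr (c - 1)) :: real"
  have "(\<integral>\<^sup>+u. ennreal (?g u) \<partial>lborel) = ennreal (Beta ((real i + 1) / 2) c)"
    unfolding Beta_interval[OF assms, symmetric]
    by (intro nn_integral_cong) (auto split: split_indicator)
  then have g: "has_bochner_integral lborel ?g (Beta ((real i + 1) / 2) c)"
    using assms by (intro has_bochner_integral_nn_integral) (auto intro!: Beta_real_nonneg)
  show int: "integrable lborel ?f"
    by (rule Bochner_Integration.integrable_bound[OF conjunct1[OF g[unfolded has_bochner_integral_iff]]])
       (auto simp: abs_mult power_abs)
  show "(LINT u|lborel. ?f u) = (if even i then Beta ((real i + 1) / 2) c else 0)"
  proof (cases "even i")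
    case True
    then have "\<bar>u\<bar> ^ i = u ^ i" for u :: real by (rule power_even_abs)
    then show ?thesis using True g[unfolded has_bochner_integral_iff] by simp
  next
    case False
    have "(LINT u|lborel. ?f u) = (LINT u|lborel. ?f (0 + (-1) * u))"
      by (subst lborel_integral_real_affine[where c="-1" and t=0]) auto
    also have "\<dots> = (LINT u|lborel. - ?f u)"
      using False by (intro Bochner_Integration.integral_cong) (auto split: split_indicator)
    finally show ?thesis using False by simp
  qed
qed

lemma sin_weight_integral:
  fixes i :: nat
  assumes "c > 0"
  shows "integrable lborel (\<lambda>\<theta>. indicator {0..pi} \<theta> * (cos \<theta> ^ i * sin \<theta> powr (2 * c - 1)))"
    and "(LINT \<theta>|lborel. indicator {0..pi} \<theta> * (cos \<theta> ^ i * sin \<theta> powr (2 * c - 1))) =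
      (if even i then Beta ((real i + 1) / 2) c else 0)"
proof -
  let ?f = "\<lambda>\<theta>. indicator {0..pi} \<theta> * (cos \<theta> ^ i * sin \<theta> powr (2 * c - 1)) :: real"
  let ?g = "\<lambda>\<theta>. indicator {0..pi} \<theta> * (\<bar>cos \<theta>\<bar> ^ i * sin \<theta> powr (2 * c - 1)) :: real"
  let ?k = "\<lambda>u. ennreal (\<bar>u\<bar> ^ i * (1 - u\<^sup>2) powr (c - 1))"
  \<comment> \<open>The substitution is u = - cos \<theta>, which is increasing on [0, pi] with
    derivative sin \<theta>.\<close>
  have "(\<integral>\<^sup>+\<theta>. ennreal (?g \<theta>) \<partial>lborel) = (\<integral>\<^sup>+\<theta>. ?k (- cos \<theta>) * ennreal (sin \<theta>) * indicator {0..pi} \<theta> \<partial>lborel)"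
  proof (intro nn_integral_cong)
    fix \<theta> :: real
    show "ennreal (?g \<theta>) = ?k (- cos \<theta>) * ennreal (sin \<theta>) * indicator {0..pi} \<theta>"
    proof (cases "\<theta> \<in> {0..pi}")
      case True
      then have s: "sin \<theta> \<ge> 0" by (simp add: sin_ge_zero)
      have "1 - (- cos \<theta>)\<^sup>2 = (sin \<theta>)\<^sup>2" by (simp add: sin_squared_eq)
      then have "(1 - (- cos \<theta>)\<^sup>2) powr (c - 1) * sin \<theta> = sin \<theta> powr (2 * (c - 1)) * sin \<theta>"
        using s by (simp only: powr_square)
      also have "\<dots> = sin \<theta> powr (2 * c - 1)"
        using s powr_add[of "sin \<theta>" "2 * (c - 1)" 1] by (cases "sin \<theta> = 0") (auto simp: algebra_simps)
      finally show ?thesis using True s by (simp add: ennreal_mult[symmetric] mult.assoc)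
    qed simp
  qed
  also have "\<dots> = (\<integral>\<^sup>+u. ?k u * indicator {- cos 0..- cos pi} u \<partial>lborel)"
    by (rule nn_integral_substitution_aux[symmetric])
       (auto intro!: derivative_eq_intros continuous_intros sin_ge_zero)
  also have "\<dots> = ennreal (Beta ((real i + 1) / 2) c)"
    using Beta_interval[OF assms, of i] by simp
  finally have g: "has_bochner_integral lborel ?g (Beta ((real i + 1) / 2) c)"
    using assms by (intro has_bochner_integral_nn_integral) (auto intro!: Beta_real_nonneg)
  show int: "integrable lborel ?f"
    by (rule Bochner_Integration.integrable_bound[OF conjunct1[OF g[unfolded has_bochner_integral_iff]]])
       (auto simp: abs_mult power_abs)
  show "(LINT \<theta>|lborel. ?f \<theta>) = (if even i then Beta ((real i + 1) / 2) c else 0)"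
  proof (cases "even i")
    case True
    then have "\<bar>u\<bar> ^ i = u ^ i" for u :: real by (rule power_even_abs)
    then show ?thesis using True g[unfolded has_bochner_integral_iff] by simp
  next
    case False
    \<comment> \<open>Reflection about pi/2 changes the sign of the cosine and fixes the
      sine.\<close>
    have "(LINT u|lborel. ?f u) = (LINT u|lborel. ?f (pi + (-1) * u))"
      by (subst lborel_integral_real_affine[where c="-1" and t=pi]) auto
    also have "\<dots> = (LINT u|lborel. - ?f u)"
      using False by (intro Bochner_Integration.integral_cong) (auto simp: cos_diff sin_diff indicator_def)
    finally show ?thesis using False by simp
  qed
qed

section \<open>The power series of the Bessel factor\<close>

definition bessel_coeff :: "real \<Rightarrow> nat \<Rightarrow> real" where
  "bessel_coeff \<alpha> m = 2 powr (1 - \<alpha>) / Gamma \<alpha> * ((-1) ^ m / (fact m * pochhammer \<alpha> m * 4 ^ m))"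

lemma summable_bessel_coeff:
  assumes "\<alpha> > 0"
  shows "summable (\<lambda>m. \<bar>bessel_coeff \<alpha> m * y ^ m\<bar>)"
proof -
  define C where "C = \<bar>2 powr (1 - \<alpha>) / Gamma \<alpha>\<bar>"
  \<comment> \<open>All factors of the rising factorial after the first exceed 1, so it is bounded
    below and the series is dominated by an exponential one.\<close>
  have p: "pochhammer \<alpha> m \<ge> min 1 \<alpha>" for m
  proof (cases m)
    case (Suc j)
    have "1 \<le> pochhammer (\<alpha> + 1) j"
    proof (induction j)
      case (Suc j)
      have "1 * 1 \<le> (\<alpha> + 1 + real j) * pochhammer (\<alpha> + 1) j"
        using Suc assms by (intro mult_mono) auto
      then show ?case by (simp add: pochhammer_rec')
    qed simp
    then have "\<alpha> * 1 \<le> \<alpha> * pochhammer (\<alpha> + 1) j" using assms by (intro mult_left_mono) auto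
    then show ?thesis using Suc by (simp add: pochhammer_rec)
  qed simp
  have "summable (\<lambda>m. C / min 1 \<alpha> * (\<bar>y / 4\<bar> ^ m /\<^sub>R fact m))"
    by (intro summable_mult summable_exp_generic)
  moreover have "norm \<bar>bessel_coeff \<alpha> m * y ^ m\<bar> \<le> C / min 1 \<alpha> * (\<bar>y / 4\<bar> ^ m /\<^sub>R fact m)" for m
  proof -
    have "norm \<bar>bessel_coeff \<alpha> m * y ^ m\<bar> = (C * (\<bar>y / 4\<bar> ^ m / fact m)) / \<bar>pochhammer \<alpha> m\<bar>"
      by (simp add: bessel_coeff_def C_def abs_mult power_abs power_divide)
    also have "\<dots> \<le> (C * (\<bar>y / 4\<bar> ^ m / fact m)) / min 1 \<alpha>"
      using p[of m] assms by (intro divide_left_mono) (auto simp: C_def)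
    also have "\<bar>y / 4\<bar> ^ m / fact m = \<bar>y / 4\<bar> ^ m /\<^sub>R fact m"
      by (simp only: real_scaleR_def divide_inverse mult.commute)
    also have "(C * (\<bar>y / 4\<bar> ^ m /\<^sub>R fact m)) / min 1 \<alpha> = C / min 1 \<alpha> * (\<bar>y / 4\<bar> ^ m /\<^sub>R fact m)"
      by simp
    finally show ?thesis .
  qed
  ultimately show ?thesis by (rule summable_comparison_test'[where N=0])
qed

lemma bessel_j_sums:
  assumes "\<alpha> > 0" "z \<ge> 0"
  shows "(\<lambda>m. bessel_coeff \<alpha> m * z ^ (2 * m)) sums bessel_j (\<alpha> - 1) z"
proof -
  define G where "G y = (\<Sum>m. bessel_coeff \<alpha> m * y ^ m)" for y
  have G: "(\<lambda>m. bessel_coeff \<alpha> m * y ^ m) sums G y" for y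
    unfolding G_def using summable_rabs_cancel[OF summable_bessel_coeff[OF assms(1), of y]] by (rule summable_sums)
  have pos: "w powr (- (\<alpha> - 1)) * bessel_J (\<alpha> - 1) w = G (w\<^sup>2)" if w: "w > 0" for w
  proof -
    have t: "w powr (- (\<alpha> - 1)) * ((-1) ^ m / fact m * rGamma (real m + (\<alpha> - 1) + 1) * (w / 2) powr (2 * real m + (\<alpha> - 1))) =
        bessel_coeff \<alpha> m * (w\<^sup>2) ^ m" for m
    proof -
      have a: "\<alpha> \<notin> \<int>\<^sub>\<le>\<^sub>0" using assms by (auto elim!: nonpos_Ints_cases)
      have "Gamma (\<alpha> + real m) = pochhammer \<alpha> m * Gamma \<alpha>"
        using pochhammer_Gamma[OF a, of m] Gamma_real_pos[OF assms(1)] by simp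
      then have g: "rGamma (real m + (\<alpha> - 1) + 1) = 1 / (pochhammer \<alpha> m * Gamma \<alpha>)"
        by (simp add: rGamma_inverse_Gamma add.commute divide_inverse)
      have "(w / 2) powr (2 * real m + (\<alpha> - 1)) = (w / 2) powr (real (2 * m)) * (w / 2) powr (\<alpha> - 1)"
        by (simp add: powr_add[symmetric])
      also have "(w / 2) powr (real (2 * m)) = (w / 2) ^ (2 * m)"
        using w by (subst powr_realpow) auto
      also have "(w / 2) powr (\<alpha> - 1) = w powr (\<alpha> - 1) * 2 powr (1 - \<alpha>)"
      proof -
        have "2 powr (1 - \<alpha>) = 1 / 2 powr (\<alpha> - 1)" using powr_minus_divide[of 2 "\<alpha> - 1"] by simp
        then show ?thesis using w by (simp add: powr_divide)
      qed
      finally have h: "(w / 2) powr (2 * real m + (\<alpha> - 1)) = (w / 2) ^ (2 * m) * (w powr (\<alpha> - 1) * 2 powr (1 - \<alpha>))" .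
      have "w powr (- (\<alpha> - 1)) * w powr (\<alpha> - 1) = 1"
        using w by (simp add: powr_add[symmetric])
      then have "w powr (- (\<alpha> - 1)) * ((-1) ^ m / fact m * (1 / (pochhammer \<alpha> m * Gamma \<alpha>)) * ((w / 2) ^ (2 * m) * (w powr (\<alpha> - 1) * 2 powr (1 - \<alpha>)))) =
          (-1) ^ m / fact m * (1 / (pochhammer \<alpha> m * Gamma \<alpha>)) * ((w / 2) ^ (2 * m) * 2 powr (1 - \<alpha>))"
        by (simp only: mult_ac) (simp add: mult.assoc[symmetric])
      also have "\<dots> = bessel_coeff \<alpha> m * (w\<^sup>2) ^ m"
      proof -
        have "(w / 2) ^ (2 * m) = (w\<^sup>2) ^ m / 4 ^ m"
          unfolding power_mult by (simp add: power_divide)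
        then show ?thesis by (simp add: bessel_coeff_def mult_ac)
      qed
      finally show ?thesis unfolding g h .
    qed
    have "(\<lambda>m. (-1) ^ m / fact m * rGamma (real m + (\<alpha> - 1) + 1) * (w / 2) powr (2 * real m + (\<alpha> - 1))) sums (w powr (\<alpha> - 1) * G (w\<^sup>2))"
    proof -
      have *: "w powr (\<alpha> - 1) * (w powr (- (\<alpha> - 1)) * x) = x" for x
        using w by (simp add: powr_add[symmetric] mult.assoc[symmetric])
      show ?thesis
        using sums_mult[OF G[of "w\<^sup>2"], of "w powr (\<alpha> - 1)"] unfolding t[symmetric] * .
    qed
    then have "bessel_J (\<alpha> - 1) w = w powr (\<alpha> - 1) * G (w\<^sup>2)"
      unfolding bessel_J_def by (simp add: sums_iff)
    then show ?thesis using w by (simp add: powr_add[symmetric] mult.assoc[symmetric])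
  qed
  have "bessel_j (\<alpha> - 1) z = G (z\<^sup>2)"
  proof (cases "z = 0")
    case False
    then show ?thesis using assms pos[of z] by (simp add: bessel_j_def)
  next
    case True
    \<comment> \<open>At 0 the Bessel factor is defined as a limit from the right; continuity of the
      power series identifies this limit with the constant term.\<close>
    have "isCont G 0"
      unfolding G_def using summable_rabs_cancel[OF summable_bessel_coeff[OF assms(1), of 1]]
      by (intro isCont_powser[where K=1]) auto
    moreover have "((\<lambda>w::real. w\<^sup>2) \<longlongrightarrow> 0) (at_right 0)"
      by (rule tendsto_eq_intros refl)+ simp
    ultimately have "((\<lambda>w. G (w\<^sup>2)) \<longlongrightarrow> G 0) (at_right 0)"
      by (rule isCont_tendsto_compose)
    then have "((\<lambda>w. w powr (- (\<alpha> - 1)) * bessel_J (\<alpha> - 1) w) \<longlongrightarrow> G 0) (at_right 0)"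
      by (rule Lim_transform_eventually)
         (use pos in \<open>auto simp: eventually_at_right_field intro!: exI[of _ 1]\<close>)
    then have "Lim (at_right 0) (\<lambda>w. w powr (- (\<alpha> - 1)) * bessel_J (\<alpha> - 1) w) = G 0"
      by (intro tendsto_Lim) auto
    then show ?thesis using True by (simp add: bessel_j_def)
  qed
  then show ?thesis using G[of "z\<^sup>2"] by (simp add: power_mult)
qed

text \<open>The coefficient of X^i in ((1 + 2X)^2 - 1)^k, once by the binomial theorem and once from
  the factorization 4X(1 + X) of the base.\<close>

lemma shifted_square_coeff:
  "(\<Sum>p\<le>k. real (k choose p) * (-1) ^ (k - p) * (real (2 * p choose i) * 2 ^ i)) / 4 ^ k =
    (if k \<le> i then real (k choose (i - k)) else 0)"
proof -
  have lin: "fps_nth ((1 + fps_const c * fps_X) ^ n) i = real (n choose i) * c ^ i" for c :: real and n i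
  proof -
    have "fps_nth ((1 + fps_const c * fps_X) ^ n) i = (\<Sum>j\<le>n. real (n choose j) * fps_nth ((fps_const c * fps_X) ^ (j)) i)"
      unfolding add.commute[of 1] binomial_ring
      by (simp add: fps_sum_nth fps_mult_of_nat_nth mult.commute)
    also have "\<dots> = (\<Sum>j\<le>n. if j = i then real (n choose i) * c ^ i else 0)"
      by (intro sum.cong refl) (auto simp: power_mult_distrib fps_const_power)
    also have "\<dots> = real (n choose i) * c ^ i" by (simp add: binomial_eq_0)
    finally show ?thesis .
  qed
  define Y where "Y = 1 + fps_const 2 * (fps_X :: real fps)"
  have "Y ^ 2 - 1 = fps_const 4 * (fps_X * (1 + fps_const 1 * fps_X))"
    by (simp add: Y_def power2_eq_square algebra_simps numeral_fps_const)
  then have Y1: "(Y ^ 2 - 1) ^ k = fps_const (4 ^ k) * (fps_X ^ k * (1 + fps_const 1 * fps_X) ^ k)"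
    by (simp only: power_mult_distrib fps_const_power)
  have "fps_nth ((Y ^ 2 - 1) ^ k) i = 4 ^ k * (if k \<le> i then real (k choose (i - k)) else 0)"
    unfolding Y1 fps_mult_left_const_nth fps_X_power_mult_nth lin by auto
  moreover have Y2: "(Y ^ 2 - 1) ^ k = (\<Sum>p\<le>k. of_nat (k choose p) * (Y ^ 2) ^ p * (-1) ^ (k - p))"
    using binomial_ring[of "Y ^ 2" "-1" k] by simp
  have "of_nat (k choose p) * (Y ^ 2) ^ p * (-1) ^ (k - p) = fps_const (real (k choose p) * (-1) ^ (k - p)) * Y ^ (2 * p)" for p
  proof -
    have "(-1 :: real fps) ^ (k - p) = fps_const ((-1) ^ (k - p))"
      by (cases "even (k - p)") (simp_all add: fps_const_neg[symmetric])
    then show ?thesis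
      unfolding power_mult[of Y 2 p] by (simp only: fps_const_mult[symmetric] fps_of_nat mult_ac)
  qed
  then have "fps_nth ((Y ^ 2 - 1) ^ k) i = (\<Sum>p\<le>k. real (k choose p) * (-1) ^ (k - p) * (real (2 * p choose i) * 2 ^ i))"
    unfolding Y2 by (simp only: fps_sum_nth fps_mult_left_const_nth) (simp only: Y_def lin)
  ultimately show ?thesis by simp
qed

text \<open>Indexed by all powers instead of even ones, so that the Cauchy product with the
  exponential series sorts by powers of \<rho>.\<close>

definition bessel_coeff_full :: "real \<Rightarrow> nat \<Rightarrow> real" where
  "bessel_coeff_full \<alpha> j = (if even j then bessel_coeff \<alpha> (j div 2) else 0)"

lemma bessel_coeff_full_sums:
  assumes "\<alpha> > 0" "z \<ge> 0"
  shows "(\<lambda>j. bessel_coeff_full \<alpha> j * z ^ j) sums bessel_j (\<alpha> - 1) z"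
    and "summable (\<lambda>j. \<bar>bessel_coeff_full \<alpha> j * z ^ j\<bar>)"
proof -
  have sm: "strict_mono (\<lambda>m::nat. 2 * m)" by (simp add: strict_mono_def)
  have z: "bessel_coeff_full \<alpha> n * z ^ n = 0" if "n \<notin> range (\<lambda>m. 2 * m)" for n
    using that by (auto simp: bessel_coeff_full_def elim!: evenE)
  show "(\<lambda>j. bessel_coeff_full \<alpha> j * z ^ j) sums bessel_j (\<alpha> - 1) z"
    using sums_mono_reindex[OF sm, of "\<lambda>j. bessel_coeff_full \<alpha> j * z ^ j"] z bessel_j_sums[OF assms]
    by (simp add: bessel_coeff_full_def)
  have "summable (\<lambda>m. \<bar>bessel_coeff_full \<alpha> (2 * m) * z ^ (2 * m)\<bar>)"
    using summable_bessel_coeff[OF assms(1), of "z\<^sup>2"] by (simp add: bessel_coeff_full_def power_mult)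
  then show "summable (\<lambda>j. \<bar>bessel_coeff_full \<alpha> j * z ^ j\<bar>)"
    using summable_mono_reindex[OF sm, of "\<lambda>j. \<bar>bessel_coeff_full \<alpha> j * z ^ j\<bar>"] z by simp
qed

text \<open>The part of the integrand of degree \<open>K\<close> in \<rho>, from the product of the
  exponential and the Bessel series.\<close>

definition theta_term :: "real \<Rightarrow> real \<Rightarrow> nat \<Rightarrow> nat \<Rightarrow> real \<Rightarrow> real" where
  "theta_term \<alpha> \<rho> i K \<theta> = indicator {0..pi} \<theta> * (cos \<theta> ^ i * sin \<theta> powr (2 * \<alpha> - 1)) *
     (\<Sum>j\<le>K. (- \<rho> * cos \<theta>) ^ j / fact j * (bessel_coeff_full \<alpha> (K - j) * (\<rho> * sin \<theta>) ^ (K - j)))"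

definition theta_coeff :: "real \<Rightarrow> real \<Rightarrow> nat \<Rightarrow> nat \<Rightarrow> real" where
  "theta_coeff \<alpha> \<rho> i K = (\<Sum>j\<le>K. (- \<rho>) ^ j / fact j * (bessel_coeff_full \<alpha> (K - j) * \<rho> ^ (K - j)) *
     (if even (i + j) then Beta ((real (i + j) + 1) / 2) (\<alpha> + real ((K - j) div 2)) else 0))"

lemma theta_term_integral:
  assumes "\<alpha> > 0"
  shows "has_bochner_integral lborel (theta_term \<alpha> \<rho> i K) (theta_coeff \<alpha> \<rho> i K)"
proof -
  let ?f = "\<lambda>j \<theta>. indicator {0..pi} \<theta> * (cos \<theta> ^ (i + j) * sin \<theta> powr (2 * (\<alpha> + real ((K - j) div 2)) - 1))"
  let ?c = "\<lambda>j. (- \<rho>) ^ j / fact j * (bessel_coeff_full \<alpha> (K - j) * \<rho> ^ (K - j))"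
  have pt: "theta_term \<alpha> \<rho> i K = (\<lambda>\<theta>. \<Sum>j\<le>K. (?c j) *
     (?f j \<theta>))"
  proof
    fix \<theta>
    show "theta_term \<alpha> \<rho> i K \<theta> = (\<Sum>j\<le>K. (?c j) *
     (?f j \<theta>))"
      unfolding theta_term_def sum_distrib_left
    proof (intro sum.cong refl)
      fix j assume "j \<in> {..K}"
      show "indicator {0..pi} \<theta> * (cos \<theta> ^ i * sin \<theta> powr (2 * \<alpha> - 1)) *
          ((- \<rho> * cos \<theta>) ^ j / fact j * (bessel_coeff_full \<alpha> (K - j) * (\<rho> * sin \<theta>) ^ (K - j))) =
        (?c j) *
        (?f j \<theta>)"
      proof (cases "\<theta> \<in> {0..pi} \<and> even (K - j)")
        case True
        then have s: "sin \<theta> \<ge> 0" by (simp add: sin_ge_zero)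
        define q where "q = (K - j) div 2"
        have q: "K - j = 2 * q" using True by (simp add: q_def)
        have "sin \<theta> powr (2 * \<alpha> - 1) * sin \<theta> ^ (2 * q) = sin \<theta> powr (2 * (\<alpha> + real q) - 1)"
        proof (cases "sin \<theta> = 0")
          case False
          then have "sin \<theta> > 0" using s by simp
          then have "sin \<theta> ^ (2 * q) = sin \<theta> powr real (2 * q)" by (simp only: powr_realpow)
          then show ?thesis by (simp add: powr_add[symmetric] algebra_simps)
        qed simp
        then have e: "sin \<theta> powr (2 * (\<alpha> + real ((K - j) div 2)) - 1) = sin \<theta> powr (2 * \<alpha> - 1) * sin \<theta> ^ (K - j)"
          unfolding q by simp
        have f: "(- \<rho> * cos \<theta>) ^ j = (- \<rho>) ^ j * cos \<theta> ^ j" by (rule power_mult_distrib)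
        show ?thesis unfolding e f by (simp add: power_add power_mult_distrib)
      qed (auto simp: bessel_coeff_full_def)
    qed
  qed
  have "has_bochner_integral lborel (\<lambda>\<theta>. (?c j) *
     (?f j \<theta>))
     ((- \<rho>) ^ j / fact j * (bessel_coeff_full \<alpha> (K - j) * \<rho> ^ (K - j)) *
     (if even (i + j) then Beta ((real (i + j) + 1) / 2) (\<alpha> + real ((K - j) div 2)) else 0))" for j
    using sin_weight_integral[of "\<alpha> + real ((K - j) div 2)" "i + j"] assms
    by (intro has_bochner_integral_mult_right) (simp add: has_bochner_integral_iff)
  then show ?thesis unfolding pt theta_coeff_def
    by (intro has_bochner_integral_sum) auto
qed

text \<open>Termwise integration is justified by a majorant: bounding |cos| and |sin| by 1 leaves
  the Cauchy product of two absolutely convergent series, free of \<theta>, times one integrable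
  weight.\<close>

lemma theta_integral_sums:
  fixes i :: nat
  assumes "\<alpha> > 0" "\<rho> \<ge> 0"
  defines "g \<equiv> \<lambda>\<theta>. indicator {0..pi} \<theta> * (cos \<theta> ^ i * sin \<theta> powr (2 * \<alpha> - 1)) * (exp (- \<rho> * cos \<theta>) * bessel_j (\<alpha> - 1) (\<rho> * sin \<theta>))"
  shows "integrable lborel g" and "theta_coeff \<alpha> \<rho> i sums (LINT \<theta>|lborel. g \<theta>)"
proof -
  define w where "w \<theta> = indicator {0..pi} \<theta> * (cos \<theta> ^ 0 * sin \<theta> powr (2 * \<alpha> - 1))" for \<theta> :: real
  define D where "D K = (\<Sum>j\<le>K. (\<rho> ^ j / fact j) * \<bar>bessel_coeff_full \<alpha> (K - j) * \<rho> ^ (K - j)\<bar>)" for K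
  have D: "summable D" unfolding D_def
  proof (rule summable_Cauchy_product)
    show "summable (\<lambda>k. norm (\<rho> ^ k / fact k))"
      using summable_norm_exp[of \<rho>] by (simp add: divide_inverse mult.commute)
    show "summable (\<lambda>k. norm \<bar>bessel_coeff_full \<alpha> k * \<rho> ^ k\<bar>)"
      using bessel_coeff_full_sums(2)[OF assms(1,2)] by simp
  qed
  have D0: "D K \<ge> 0" for K unfolding D_def using assms by (intro sum_nonneg) auto
  have w: "integrable lborel w" unfolding w_def by (rule sin_weight_integral(1)[OF assms(1)])
  have w0: "w \<theta> \<ge> 0" for \<theta> by (simp add: w_def)
  have bound: "norm (theta_term \<alpha> \<rho> i K \<theta>) \<le> D K * w \<theta>" for K \<theta>
  proof (cases "\<theta> \<in> {0..pi}")
    case True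
    have "\<bar>\<Sum>j\<le>K. (- \<rho> * cos \<theta>) ^ j / fact j * (bessel_coeff_full \<alpha> (K - j) * (\<rho> * sin \<theta>) ^ (K - j))\<bar> \<le> D K"
      unfolding D_def
    proof (rule order_trans[OF sum_abs], rule sum_mono)
      fix j
      have "\<bar>(- \<rho> * cos \<theta>) ^ j / fact j\<bar> \<le> \<rho> ^ j / fact j"
        using assms by (simp add: power_abs abs_mult power_mult_distrib divide_right_mono mult_left_le power_le_one)
      moreover have "\<bar>bessel_coeff_full \<alpha> (K - j) * (\<rho> * sin \<theta>) ^ (K - j)\<bar> \<le> \<bar>bessel_coeff_full \<alpha> (K - j) * \<rho> ^ (K - j)\<bar>"
        using assms by (simp add: power_abs abs_mult power_mult_distrib mult_left_mono mult_left_le power_le_one)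
      ultimately show "\<bar>(- \<rho> * cos \<theta>) ^ j / fact j * (bessel_coeff_full \<alpha> (K - j) * (\<rho> * sin \<theta>) ^ (K - j))\<bar> \<le>
          \<rho> ^ j / fact j * \<bar>bessel_coeff_full \<alpha> (K - j) * \<rho> ^ (K - j)\<bar>"
        unfolding abs_mult[of "(- \<rho> * cos \<theta>) ^ j / fact j"] using assms by (intro mult_mono) auto
    qed
    moreover have "\<bar>cos \<theta> ^ i * sin \<theta> powr (2 * \<alpha> - 1)\<bar> \<le> w \<theta>"
      using True by (simp add: w_def abs_mult power_abs mult_left_le_one_le power_le_one)
    ultimately show ?thesis
      using True w0 D0 unfolding theta_term_def real_norm_def abs_mult[of _ "sum _ _"]
      by (subst mult.commute) (intro mult_mono, auto)
  qed (simp add: theta_term_def w_def)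
  have term_sums: "(\<lambda>K. theta_term \<alpha> \<rho> i K \<theta>) sums g \<theta>" for \<theta>
  proof (cases "\<theta> \<in> {0..pi}")
    case True
    then have z: "\<rho> * sin \<theta> \<ge> 0" using assms by (simp add: sin_ge_zero)
    have e: "(\<lambda>j. (- \<rho> * cos \<theta>) ^ j / fact j) sums exp (- \<rho> * cos \<theta>)"
      using exp_converges[of "- \<rho> * cos \<theta>"] by (simp add: divide_inverse mult.commute)
    have "(\<lambda>K. \<Sum>j\<le>K. (- \<rho> * cos \<theta>) ^ j / fact j * (bessel_coeff_full \<alpha> (K - j) * (\<rho> * sin \<theta>) ^ (K - j))) sums
       ((\<Sum>j. (- \<rho> * cos \<theta>) ^ j / fact j) * (\<Sum>j. bessel_coeff_full \<alpha> j * (\<rho> * sin \<theta>) ^ j))"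
    proof (rule Cauchy_product_sums)
      show "summable (\<lambda>k. norm ((- \<rho> * cos \<theta>) ^ k / fact k))"
        using summable_norm_exp[of "- \<rho> * cos \<theta>"] by (simp add: divide_inverse mult.commute)
      show "summable (\<lambda>k. norm (bessel_coeff_full \<alpha> k * (\<rho> * sin \<theta>) ^ k))"
        using bessel_coeff_full_sums(2)[OF assms(1) z] by simp
    qed
    also have "(\<Sum>j. (- \<rho> * cos \<theta>) ^ j / fact j) = exp (- \<rho> * cos \<theta>)"
      using e by (rule sums_unique[symmetric])
    also have "(\<Sum>j. bessel_coeff_full \<alpha> j * (\<rho> * sin \<theta>) ^ j) = bessel_j (\<alpha> - 1) (\<rho> * sin \<theta>)"
      using bessel_coeff_full_sums(1)[OF assms(1) z] by (rule sums_unique[symmetric])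
    finally show ?thesis unfolding theta_term_def g_def by (rule sums_mult)
  qed (simp add: theta_term_def g_def)
  have int: "integrable lborel (theta_term \<alpha> \<rho> i K)" for K
    using theta_term_integral[OF assms(1)] by (auto simp: has_bochner_integral_iff)
  have g: "g \<theta> = (\<Sum>K. theta_term \<alpha> \<rho> i K \<theta>)" for \<theta>
    using term_sums by (rule sums_unique)
  have 1: "AE \<theta> in lborel. summable (\<lambda>K. norm (theta_term \<alpha> \<rho> i K \<theta>))"
  proof (rule AE_I2)
    fix \<theta>
    show "summable (\<lambda>K. norm (theta_term \<alpha> \<rho> i K \<theta>))"
      by (rule summable_comparison_test'[OF summable_mult2[OF D, of "w \<theta>"], where N=0]) (use bound in auto)
  qed
  have 2: "summable (\<lambda>K. \<integral>\<theta>. norm (theta_term \<alpha> \<rho> i K \<theta>) \<partial>lborel)"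
  proof (rule summable_comparison_test'[OF summable_mult2[OF D, of "\<integral>\<theta>. w \<theta> \<partial>lborel"], where N=0])
    fix K
    have "(\<integral>\<theta>. norm (theta_term \<alpha> \<rho> i K \<theta>) \<partial>lborel) \<le> (\<integral>\<theta>. D K * w \<theta> \<partial>lborel)"
      using int w bound by (intro integral_mono) auto
    then show "norm (\<integral>\<theta>. norm (theta_term \<alpha> \<rho> i K \<theta>) \<partial>lborel) \<le> D K * (\<integral>\<theta>. w \<theta> \<partial>lborel)" by simp
  qed
  show "integrable lborel g"
    unfolding g[abs_def] by (rule integrable_suminf[OF int 1 2])
  have "(\<integral>\<theta>. theta_term \<alpha> \<rho> i K \<theta> \<partial>lborel) = theta_coeff \<alpha> \<rho> i K" for K
    using theta_term_integral[OF assms(1)] by (auto simp: has_bochner_integral_iff)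
  then show "theta_coeff \<alpha> \<rho> i sums (LINT \<theta>|lborel. g \<theta>)"
    using sums_integral[OF int 1 2] unfolding g by simp
qed

lemma pochhammer_half: "pochhammer (1/2) p = fact (2 * p) / (4 ^ p * fact p :: real)"
  unfolding fact_double by (simp add: power_mult)

text \<open>After the Beta values are inserted, the Gamma values at \<alpha> and the rising
  factorials of \<alpha> cancel, and the sum over j = 2p - i becomes that of
  \<open>shifted_square_coeff\<close> with k = (i + K) / 2. Its vanishing for k > i means that no
  degree K > i contributes.\<close>

lemma theta_coeff_eq:
  fixes i k K :: nat
  assumes \<alpha>: "\<alpha> > 0"
  shows "2 powr (\<alpha> - 1) * Gamma (\<alpha> + 1/2) / sqrt pi * ((-2 * \<rho>) ^ i / fact i * theta_coeff \<alpha> \<rho> i K) =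
    (if even (i + K) \<and> K \<le> i then \<rho> ^ (i + K) / (fact ((i + K) div 2) * pochhammer (\<alpha> + 1/2) ((i + K) div 2)) *
      real ((i + K) div 2 choose ((i - K) div 2)) else 0)"
proof -
  define c0 where "c0 = 2 powr (\<alpha> - 1) * Gamma (\<alpha> + 1/2) / sqrt pi"
  define T where "T j = c0 * ((-2 * \<rho>) ^ i / fact i * ((- \<rho>) ^ j / fact j * (bessel_coeff_full \<alpha> (K - j) * \<rho> ^ (K - j)) *
     (if even (i + j) then Beta ((real (i + j) + 1) / 2) (\<alpha> + real ((K - j) div 2)) else 0)))" for j
  have sum: "c0 * ((-2 * \<rho>) ^ i / fact i * theta_coeff \<alpha> \<rho> i K) = (\<Sum>j\<le>K. T j)"
    by (simp add: theta_coeff_def T_def sum_distrib_left)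
  show ?thesis
  proof (cases "even (i + K)")
    case False
    have "T j = 0" if "j \<le> K" for j
    proof (cases "even (K - j)")
      case True
      then have "odd (i + j)" using False that by auto
      then show ?thesis by (simp add: T_def)
    qed (simp add: T_def bessel_coeff_full_def)
    then show ?thesis using False sum by (simp add: c0_def)
  next
    case True
    define k where "k = (i + K) div 2"
    have k: "i + K = 2 * k" using True by (simp add: k_def)
    have pos: "pochhammer (\<alpha> + 1/2) k > 0" using \<alpha> by (intro pochhammer_pos) simp
    have T: "T (2 * p - i) = \<rho> ^ (2 * k) / (fact k * pochhammer (\<alpha> + 1/2) k) *
        ((real (k choose p) * (-1) ^ (k - p) * (real (2 * p choose i) * 2 ^ i)) / 4 ^ k)"
      if p: "i \<le> 2 * p" "p \<le> k" for p
    proof -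
      define q where "q = k - p"
      have pq: "k = p + q" using p by (simp add: q_def)
      have j: "K - (2 * p - i) = 2 * q" "i + (2 * p - i) = 2 * p" using k p pq by auto
      have a: "\<alpha> \<notin> \<int>\<^sub>\<le>\<^sub>0" "\<alpha> + 1/2 \<notin> \<int>\<^sub>\<le>\<^sub>0" "(1/2::real) \<notin> \<int>\<^sub>\<le>\<^sub>0" using \<alpha> by (auto elim!: nonpos_Ints_cases)
      have G1: "Gamma (\<alpha> + real q) = pochhammer \<alpha> q * Gamma \<alpha>"
        using pochhammer_Gamma[OF a(1), of q] Gamma_real_pos[OF \<alpha>] by simp
      have G2: "Gamma (\<alpha> + 1/2 + real k) = pochhammer (\<alpha> + 1/2) k * Gamma (\<alpha> + 1/2)"
      proof -
        have "Gamma (\<alpha> + 1/2) > 0" using \<alpha> by (intro Gamma_real_pos) simp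
        then show ?thesis using pochhammer_Gamma[OF a(2), of k] by simp
      qed
      have G3: "Gamma (1/2 + real p) = fact (2 * p) / (4 ^ p * fact p) * sqrt pi"
        using pochhammer_Gamma[OF a(3), of p] unfolding pochhammer_half Gamma_one_half_real by (simp add: field_simps)
      have p1: "pochhammer \<alpha> q > 0" "Gamma \<alpha> > 0" "Gamma (\<alpha> + 1/2) > 0" using \<alpha> by (auto intro!: pochhammer_pos Gamma_real_pos)
      have B: "Beta ((real (2 * p) + 1) / 2) (\<alpha> + real q) = fact (2 * p) / (4 ^ p * fact p) * sqrt pi * (pochhammer \<alpha> q * Gamma \<alpha>) / (pochhammer (\<alpha> + 1/2) k * Gamma (\<alpha> + 1/2))"
      proof -
        have h1: "(real (2 * p) + 1) / 2 = 1/2 + real p" by (simp add: field_simps)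
        have h2: "1/2 + real p + (\<alpha> + real q) = \<alpha> + 1/2 + real k" by (simp add: pq)
        show ?thesis unfolding h1 Beta_def h2 G1 G2 G3 ..
      qed
      have bc: "bessel_coeff_full \<alpha> (2 * q) = 2 powr (1 - \<alpha>) / Gamma \<alpha> * ((-1) ^ q / (fact q * pochhammer \<alpha> q * 4 ^ q))"
        by (simp add: bessel_coeff_full_def bessel_coeff_def)
      have two: "2 powr (\<alpha> - 1) * 2 powr (1 - \<alpha>) = 1" by (simp add: powr_add[symmetric])
      have ch1: "real (2 * p choose i) = fact (2 * p) / (fact i * fact (2 * p - i))"
        using p by (simp add: binomial_fact)
      have ch2: "real (k choose p) = fact k / (fact p * fact q)"
        using p by (simp add: binomial_fact q_def)
      have sgn: "(-2 * \<rho>) ^ i * (- \<rho>) ^ (2 * p - i) * \<rho> ^ (2 * q) = 2 ^ i * \<rho> ^ (2 * k)"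
      proof -
        have "(-2 * \<rho>) ^ i * (- \<rho>) ^ (2 * p - i) = 2 ^ i * ((- \<rho>) ^ i * (- \<rho>) ^ (2 * p - i))"
          unfolding mult.assoc[symmetric] power_mult_distrib[symmetric] by simp
        also have "\<dots> = 2 ^ i * \<rho> ^ (2 * p)" unfolding power_add[symmetric] j(2) by simp
        finally show ?thesis by (simp add: pq power_add[symmetric] algebra_simps)
      qed
      have gen: "(x * g / sp) * (r1 / f1 * (r2 / f2 * ((y / ga * (s / (fq * pa * qq))) * r3) * (h / (pp * fp) * sp * (pa * ga) / (pk * g)))) =
          (x * y) * (r1 * r2 * r3) * s * h / (f1 * f2 * fq * fp * (pp * qq) * pk)"
        if "g > 0" "sp > 0" "ga > 0" "pa > 0" for x g sp r1 f1 r2 f2 y ga s fq pa qq r3 h pp fp pk :: real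
        using that by (simp add: mult_ac)
      have "T (2 * p - i) = (2 powr (\<alpha> - 1) * Gamma (\<alpha> + 1/2) / sqrt pi) * ((-2 * \<rho>) ^ i / fact i * ((- \<rho>) ^ (2 * p - i) / fact (2 * p - i) *
         ((2 powr (1 - \<alpha>) / Gamma \<alpha> * ((-1) ^ q / (fact q * pochhammer \<alpha> q * 4 ^ q))) * \<rho> ^ (2 * q)) *
         (fact (2 * p) / (4 ^ p * fact p) * sqrt pi * (pochhammer \<alpha> q * Gamma \<alpha>) / (pochhammer (\<alpha> + 1/2) k * Gamma (\<alpha> + 1/2)))))"
      proof -
        have d: "2 * q div 2 = q" by simp
        show ?thesis by (simp only: T_def c0_def j bc d B dvd_triv_left if_True)
      qed
      also have "\<dots> = 2 ^ i * \<rho> ^ (2 * k) * (-1) ^ q * fact (2 * p) / (fact i * fact (2 * p - i) * fact q * fact p * (4 ^ p * 4 ^ q) * pochhammer (\<alpha> + 1/2) k)"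
        by (subst gen) (use p1 in \<open>simp_all only: two sgn mult_1_left real_sqrt_gt_zero pi_gt_zero\<close>)
      also have "\<dots> = \<rho> ^ (2 * k) / (fact k * pochhammer (\<alpha> + 1/2) k) *
        ((real (k choose p) * (-1) ^ (k - p) * (real (2 * p choose i) * 2 ^ i)) / 4 ^ k)"
        unfolding ch1 ch2 q_def[symmetric] using pos by (simp add: pq power_add mult_ac)
      finally show ?thesis .
    qed
    have "(\<Sum>j\<le>K. T j) = (\<Sum>j\<in>{j. j \<le> K \<and> even (i + j)}. T j)"
      by (rule sum.mono_neutral_right) (auto simp: T_def)
    also have "\<dots> = (\<Sum>p\<in>{p. i \<le> 2 * p \<and> p \<le> k}. \<rho> ^ (2 * k) / (fact k * pochhammer (\<alpha> + 1/2) k) *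
        ((real (k choose p) * (-1) ^ (k - p) * (real (2 * p choose i) * 2 ^ i)) / 4 ^ k))"
    proof (rule sum.reindex_bij_witness[of _ "\<lambda>p. 2 * p - i" "\<lambda>j. (i + j) div 2"])
      fix j assume j: "j \<in> {j. j \<le> K \<and> even (i + j)}"
      then have e: "2 * ((i + j) div 2) = i + j" by auto
      then show "2 * ((i + j) div 2) - i = j" by simp
      show m: "(i + j) div 2 \<in> {p. i \<le> 2 * p \<and> p \<le> k}" using e j k by auto
      show "\<rho> ^ (2 * k) / (fact k * pochhammer (\<alpha> + 1/2) k) *
        ((real (k choose ((i + j) div 2)) * (-1) ^ (k - (i + j) div 2) * (real (2 * ((i + j) div 2) choose i) * 2 ^ i)) / 4 ^ k) = T j"
        using T[of "(i + j) div 2"] m e by simp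
    qed (use k in auto)
    also have "\<dots> = (\<Sum>p\<le>k. \<rho> ^ (2 * k) / (fact k * pochhammer (\<alpha> + 1/2) k) *
        ((real (k choose p) * (-1) ^ (k - p) * (real (2 * p choose i) * 2 ^ i)) / 4 ^ k))"
      by (rule sum.mono_neutral_left) (auto simp: not_le)
    also have "\<dots> = \<rho> ^ (2 * k) / (fact k * pochhammer (\<alpha> + 1/2) k) * (if k \<le> i then real (k choose (i - k)) else 0)"
      unfolding sum_distrib_left[symmetric] sum_divide_distrib[symmetric] shifted_square_coeff ..
    finally have "c0 * ((-2 * \<rho>) ^ i / fact i * theta_coeff \<alpha> \<rho> i K) = \<dots>" using sum by simp
    moreover have "k \<le> i \<longleftrightarrow> K \<le> i" "i - k = (i - K) div 2" using k by auto
    ultimately show ?thesis using True by (simp add: c0_def k)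
  qed
qed

text \<open>The series in \<open>K\<close> ends at i by \<open>theta_coeff_eq\<close>; its terms of
  the right parity are relabelled by k = (i + K) / 2, half the total power of \<rho>.\<close>

lemma theta_moment:
  assumes "\<alpha> > 0" "\<rho> \<ge> 0"
  shows "2 powr (\<alpha> - 1) * Gamma (\<alpha> + 1/2) / sqrt pi * ((-2 * \<rho>) ^ i / fact i *
      (LINT \<theta>|lborel. indicator {0..pi} \<theta> * (cos \<theta> ^ i * sin \<theta> powr (2 * \<alpha> - 1)) * (exp (- \<rho> * cos \<theta>) * bessel_j (\<alpha> - 1) (\<rho> * sin \<theta>)))) =
    (\<Sum>k\<le>i. \<rho> ^ (2 * k) / (fact k * pochhammer (\<alpha> + 1/2) k) * real (k choose (i - k)))"
proof -
  define C where "C = 2 powr (\<alpha> - 1) * Gamma (\<alpha> + 1/2) / sqrt pi"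
  let ?I = "LINT \<theta>|lborel. indicator {0..pi} \<theta> * (cos \<theta> ^ i * sin \<theta> powr (2 * \<alpha> - 1)) * (exp (- \<rho> * cos \<theta>) * bessel_j (\<alpha> - 1) (\<rho> * sin \<theta>))"
  have "(\<lambda>K. C * ((-2 * \<rho>) ^ i / fact i * theta_coeff \<alpha> \<rho> i K)) sums (C * ((-2 * \<rho>) ^ i / fact i * ?I))"
    by (intro sums_mult theta_integral_sums(2) assms)
  moreover have "(\<lambda>K. C * ((-2 * \<rho>) ^ i / fact i * theta_coeff \<alpha> \<rho> i K)) sums
      (\<Sum>K\<le>i. C * ((-2 * \<rho>) ^ i / fact i * theta_coeff \<alpha> \<rho> i K))"
  proof (rule sums_finite)
    fix K assume "K \<notin> {..i}"
    then show "C * ((-2 * \<rho>) ^ i / fact i * theta_coeff \<alpha> \<rho> i K) = 0"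
      unfolding C_def theta_coeff_eq[OF assms(1)] by simp
  qed simp
  ultimately have "C * ((-2 * \<rho>) ^ i / fact i * ?I) = (\<Sum>K\<le>i. C * ((-2 * \<rho>) ^ i / fact i * theta_coeff \<alpha> \<rho> i K))"
    by (rule sums_unique2)
  also have "\<dots> = (\<Sum>K\<in>{K. K \<le> i \<and> even (i + K)}. \<rho> ^ (i + K) / (fact ((i + K) div 2) * pochhammer (\<alpha> + 1/2) ((i + K) div 2)) *
      real ((i + K) div 2 choose ((i - K) div 2)))"
    unfolding C_def theta_coeff_eq[OF assms(1)] by (rule sum.mono_neutral_cong_right) auto
  also have "\<dots> = (\<Sum>k\<in>{k. k \<le> i \<and> i \<le> 2 * k}. \<rho> ^ (2 * k) / (fact k * pochhammer (\<alpha> + 1/2) k) * real (k choose (i - k)))"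
  proof (rule sum.reindex_bij_witness[of _ "\<lambda>k. 2 * k - i" "\<lambda>K. (i + K) div 2"])
    fix K assume K: "K \<in> {K. K \<le> i \<and> even (i + K)}"
    then have e: "2 * ((i + K) div 2) = i + K" by auto
    then show "2 * ((i + K) div 2) - i = K" by simp
    show "(i + K) div 2 \<in> {k. k \<le> i \<and> i \<le> 2 * k}" using e K by auto
    have "K \<le> i" "even (i + K)" using K by auto
    then have "i - (i + K) div 2 = (i - K) div 2" by presburger
    then show "\<rho> ^ (2 * ((i + K) div 2)) / (fact ((i + K) div 2) * pochhammer (\<alpha> + 1/2) ((i + K) div 2)) * real ((i + K) div 2 choose (i - (i + K) div 2)) =
      \<rho> ^ (i + K) / (fact ((i + K) div 2) * pochhammer (\<alpha> + 1/2) ((i + K) div 2)) *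
      real ((i + K) div 2 choose ((i - K) div 2))" unfolding e by simp
  qed auto
  also have "\<dots> = (\<Sum>k\<le>i. \<rho> ^ (2 * k) / (fact k * pochhammer (\<alpha> + 1/2) k) * real (k choose (i - k)))"
    by (rule sum.mono_neutral_left) (auto simp: not_le)
  finally show ?thesis by (simp add: C_def)
qed

text \<open>With v = X / (1 - X), the binomials left by \<open>theta_moment\<close> sum to v^k (1 +
  v)^k = X^k (1 - X)^(-2k). In the Laguerre generating function this factor lowers the degree by k
  and raises the parameter by 2k.\<close>

lemma laguerre_bessel_integral:
  assumes "\<alpha> > 0" "\<rho> \<ge> 0"
  shows "2 powr (\<alpha> - 1) * Gamma (\<alpha> + 1/2) / sqrt pi * (LINT \<theta>:{0..pi}|lborel.
      laguerre n (2 * \<alpha>) (a + 2 * \<rho> * cos \<theta>) * exp (- \<rho> * cos \<theta>) * bessel_j (\<alpha> - 1) (\<rho> * sin \<theta>) * sin \<theta> powr (2 * \<alpha> - 1)) =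
    (\<Sum>k\<le>n. \<rho> ^ (2 * k) / (fact k * pochhammer (\<alpha> + 1/2) k) * laguerre (n - k) (2 * \<alpha> + 2 * real k) a)"
proof -
  define C where "C = 2 powr (\<alpha> - 1) * Gamma (\<alpha> + 1/2) / sqrt pi"
  define U where "U = one_minus_powr (- (2 * \<alpha>) - 1) * (fps_exp (- a) oo zeta)"
  define g where "g i \<theta> = indicator {0..pi} \<theta> * (cos \<theta> ^ i * sin \<theta> powr (2 * \<alpha> - 1)) * (exp (- \<rho> * cos \<theta>) * bessel_j (\<alpha> - 1) (\<rho> * sin \<theta>))" for i \<theta>
  let ?I = "(LINT \<theta>:{0..pi}|lborel. laguerre n (2 * \<alpha>) (a + 2 * \<rho> * cos \<theta>) * exp (- \<rho> * cos \<theta>) * bessel_j (\<alpha> - 1) (\<rho> * sin \<theta>) * sin \<theta> powr (2 * \<alpha> - 1))"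
  let ?c = "\<lambda>k. \<rho> ^ (2 * k) / (fact k * pochhammer (\<alpha> + 1/2) k)"
  have "?I =
    (LINT \<theta>|lborel. (\<Sum>i\<le>n. ((-2 * \<rho>) ^ i / fact i * fps_nth (U * zeta ^ i) n) * g i \<theta>))"
    unfolding set_lebesgue_integral_def
  proof (intro Bochner_Integration.integral_cong refl)
    fix \<theta>
    have "(- (2 * \<rho> * cos \<theta>)) ^ i = (-2 * \<rho>) ^ i * cos \<theta> ^ i" for i
      unfolding power_mult_distrib[symmetric] by simp
    then have "laguerre n (2 * \<alpha>) (a + 2 * \<rho> * cos \<theta>) = (\<Sum>i\<le>n. (-2 * \<rho>) ^ i * cos \<theta> ^ i / fact i * fps_nth (U * zeta ^ i) n)"
      unfolding add.commute[of a] laguerre_add U_def by simp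
    then show "indicator {0..pi} \<theta> *\<^sub>R (laguerre n (2 * \<alpha>) (a + 2 * \<rho> * cos \<theta>) * exp (- \<rho> * cos \<theta>) * bessel_j (\<alpha> - 1) (\<rho> * sin \<theta>) * sin \<theta> powr (2 * \<alpha> - 1)) =
      (\<Sum>i\<le>n. ((-2 * \<rho>) ^ i / fact i * fps_nth (U * zeta ^ i) n) * g i \<theta>)"
      by (simp add: g_def sum_distrib_left sum_distrib_right) (rule sum.cong[OF refl], simp)
  qed
  also have "\<dots> = (\<Sum>i\<le>n. ((-2 * \<rho>) ^ i / fact i * fps_nth (U * zeta ^ i) n) * (LINT \<theta>|lborel. g i \<theta>))"
  proof -
    have "integrable lborel (g i)" for i
      using theta_integral_sums(1)[OF assms, of i] unfolding g_def .
    then show ?thesis by (subst Bochner_Integration.integral_sum) auto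
  qed
  finally have "C * ?I =
      (\<Sum>i\<le>n. fps_nth (U * zeta ^ i) n * (C * ((-2 * \<rho>) ^ i / fact i * (LINT \<theta>|lborel. g i \<theta>))))"
    by (simp only: sum_distrib_left) (rule sum.cong[OF refl], simp only: mult_ac)
  also have "\<dots> = (\<Sum>i\<le>n. fps_nth (U * zeta ^ i) n * (\<Sum>k\<le>i. (?c k) * real (k choose (i - k))))"
    unfolding C_def g_def theta_moment[OF assms] ..
  also have "\<dots> = (\<Sum>i\<le>n. \<Sum>k\<le>n. if k \<le> i then (?c k) * (real (k choose (i - k)) * fps_nth (U * zeta ^ i) n) else 0)"
    unfolding sum_distrib_left
    by (intro sum.cong[OF refl] sum.mono_neutral_cong_left) auto
  also have "\<dots> = (\<Sum>k\<le>n. (?c k) * (\<Sum>i\<le>n. if k \<le> i then real (k choose (i - k)) * fps_nth (U * zeta ^ i) n else 0))"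
    by (subst sum.swap) (intro sum.cong[OF refl], auto simp: sum_distrib_left intro!: sum.cong)
  also have "\<dots> = (\<Sum>k\<le>n. (?c k) * laguerre (n - k) (2 * \<alpha> + 2 * real k) a)"
  proof (intro sum.cong[OF refl])
    fix k assume k: "k \<in> {..n}"
    define F where "F = fps_X ^ k * (1 + fps_X :: real fps) ^ k"
    have F: "fps_nth F i = (if k \<le> i then real (k choose (i - k)) else 0)" for i
      by (simp add: F_def fps_X_power_mult_nth fps_binomial_of_nat[symmetric] binomial_gbinomial)
    have "F oo zeta = (zeta * (1 + zeta)) ^ k"
      by (simp add: F_def fps_compose_mult_distrib fps_compose_power[symmetric] fps_compose_add_distrib power_mult_distrib)
    also have "1 + zeta = one_minus_powr (-1)"
      using fps_binomial_compose_zeta[of "-1"] by (simp add: fps_binomial_1 fps_compose_add_distrib)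
    also have "(zeta * one_minus_powr (-1)) ^ k = fps_X ^ k * one_minus_powr (- 2 * real k)"
    proof -
      have "zeta * one_minus_powr (-1) = fps_X * one_minus_powr (-2)"
        by (simp add: zeta_eq mult.assoc flip: one_minus_powr_add)
      moreover have "one_minus_powr (-2) ^ j = one_minus_powr (- 2 * real j)" for j
        by (induction j) (simp_all add: algebra_simps flip: one_minus_powr_add)
      ultimately show ?thesis by (simp add: power_mult_distrib)
    qed
    finally have "(\<Sum>i\<le>n. fps_nth F i * fps_nth (U * zeta ^ i) n) = fps_nth (U * (fps_X ^ k * one_minus_powr (- 2 * real k))) n"
      by (subst fps_mult_compose_nth[symmetric]) auto
    also have "U * (fps_X ^ k * one_minus_powr (- 2 * real k)) = fps_X ^ k * ((one_minus_powr (- (2 * \<alpha>) - 1) * one_minus_powr (- 2 * real k)) * (fps_exp (- a) oo zeta))"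
      by (simp add: U_def mult_ac)
    also have "one_minus_powr (- (2 * \<alpha>) - 1) * one_minus_powr (- 2 * real k) = one_minus_powr (- (2 * \<alpha> + 2 * real k) - 1)"
      unfolding one_minus_powr_add[symmetric] by (simp add: algebra_simps)
    also have "fps_nth (fps_X ^ k * (one_minus_powr (- (2 * \<alpha> + 2 * real k) - 1) * (fps_exp (- a) oo zeta))) n =
        laguerre (n - k) (2 * \<alpha> + 2 * real k) a"
      using k by (simp add: fps_X_power_mult_nth laguerre_eq)
    finally show "(?c k) * (\<Sum>i\<le>n. if k \<le> i then real (k choose (i - k)) * fps_nth (U * zeta ^ i) n else 0) =
      (?c k) * laguerre (n - k) (2 * \<alpha> + 2 * real k) a"
      unfolding F by (simp add: if_distrib[of "\<lambda>x. x * _"] cong: if_cong)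
  qed
  finally show ?thesis by (simp only: C_def)
qed

section \<open>The integral over \<open>u\<close>\<close>

lemma dunkl_fact_even: "dunkl_fact k (2 * a) = 4 ^ a * fact a * pochhammer (k + 1/2) a"
proof (induction a)
  case (Suc a)
  have "dunkl_fact k (2 * Suc a) = (2 * real a + 2) * (2 * real a + 1 + 2 * k) * dunkl_fact k (2 * a)"
    by (simp add: dunkl_step_def add_ac)
  also have "\<dots> = 4 ^ Suc a * fact (Suc a) * pochhammer (k + 1/2) (Suc a)"
    unfolding Suc.IH by (simp add: pochhammer_rec' algebra_simps)
  finally show ?case .
qed simp

lemma dunkl_fact_odd: "dunkl_fact k (Suc (2 * a)) = 2 * 4 ^ a * fact a * pochhammer (k + 1/2) (Suc a)"
  using dunkl_fact_even[of k a] by (simp add: dunkl_step_def pochhammer_rec' algebra_simps)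

lemma dunkl_fact_0: "dunkl_fact 0 n = fact n"
  by (induction n) (simp_all add: dunkl_step_def)

lemma normalized_Beta:
  assumes "k > 0"
  shows "c_const (k - 1/2) * Beta ((real (2 * a) + 1) / 2) k = fact (2 * a) / (4 ^ a * fact a * pochhammer (k + 1/2) a)"
proof -
  have a: "k + 1/2 \<notin> \<int>\<^sub>\<le>\<^sub>0" "(1/2::real) \<notin> \<int>\<^sub>\<le>\<^sub>0" using assms by (auto elim!: nonpos_Ints_cases)
  have g: "Gamma (k + 1/2) > 0" "Gamma k > 0" "Gamma (1/2 :: real) > 0" using assms by (auto intro!: Gamma_real_pos)
  have G2: "Gamma (k + 1/2 + real a) = pochhammer (k + 1/2) a * Gamma (k + 1/2)"
    using pochhammer_Gamma[OF a(1), of a] g by simp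
  have G3: "Gamma (1/2 + real a) = fact (2 * a) / (4 ^ a * fact a) * Gamma (1/2)"
    using pochhammer_Gamma[OF a(2), of a] g(3) unfolding pochhammer_half
    by (metis nonzero_divide_eq_eq less_irrefl)
  have h1: "(real (2 * a) + 1) / 2 = 1/2 + real a" by (simp add: field_simps)
  have h2: "1/2 + real a + k = k + 1/2 + real a" by simp
  have "G / (H * K) * (x * H * K / (p * G)) = x / p" if "G > 0" "H > 0" "K > 0" for G H K x p :: real
    using that by (simp add: field_simps)
  note * = this[OF g(1) g(3) g(2)]
  have h3: "k - 1/2 + 1 = k + 1/2" "k - 1/2 + 1/2 = k" by simp_all
  show ?thesis unfolding c_const_def h1 Beta_def h2 h3 G2 G3 * by simp
qed

text \<open>The factor 1 + u splits the integral into the moments of orders j and j + 1 of an even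
  weight. Exactly one of these orders is even and survives, giving the two parities of the Dunkl
  factorial.\<close>

lemma kappa_density_integrable:
  assumes "k > 0"
  shows "integrable lborel (\<lambda>u. indicator {-1..1} u * (u ^ j * (1 + u) * (1 - u\<^sup>2) powr (k - 1)) :: real)" (is ?A)
    and "c_const (k - 1/2) * (LINT u|lborel. indicator {-1..1} u * (u ^ j * (1 + u) * (1 - u\<^sup>2) powr (k - 1))) = fact j / dunkl_fact k j"
proof -
  let ?w = "\<lambda>u. u ^ j * (1 + u) * (1 - u\<^sup>2) powr (k - 1)"
  have e: "indicator {-1..1} u * (?w u) =
     indicator {-1..1} u * (u ^ j * (1 - u\<^sup>2) powr (k - 1)) + indicator {-1..1} u * (u ^ Suc j * (1 - u\<^sup>2) powr (k - 1))" for u :: real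
    by (simp add: algebra_simps)
  note I = even_weight_integral[OF assms, of j] even_weight_integral[OF assms, of "Suc j"]
  show ?A unfolding e by (intro Bochner_Integration.integrable_add I)
  have "(LINT u|lborel. indicator {-1..1} u * (?w u)) =
     (if even j then Beta ((real j + 1) / 2) k else Beta ((real (Suc j) + 1) / 2) k)"
    unfolding e by (subst Bochner_Integration.integral_add[OF I(1) I(3)]) (simp only: I, simp)
  moreover have "c_const (k - 1/2) * (if even j then Beta ((real j + 1) / 2) k else Beta ((real (Suc j) + 1) / 2) k) = fact j / dunkl_fact k j"
  proof (cases "even j")
    case True
    then obtain a where j: "j = 2 * a" by (rule evenE)
    show ?thesis using normalized_Beta[OF assms, of a] by (simp add: j dunkl_fact_even del: of_nat_mult)
  next
    case False
    then obtain a where j: "j = Suc (2 * a)" by (auto elim: oddE)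
    have 1: "Suc j = 2 * Suc a" by (simp add: j)
    have 2: "fact (2 * Suc a) / (4 ^ Suc a * fact (Suc a)) = (fact (Suc (2 * a)) / (2 * 4 ^ a * fact a) :: real)"
    proof -
      have "fact (2 * Suc a) = 2 * real (Suc a) * (fact (Suc (2 * a)) :: real)" by (simp add: algebra_simps)
      moreover have "fact (Suc a) = real (Suc a) * (fact a :: real)" by simp
      ultimately show ?thesis by (simp del: fact_Suc of_nat_Suc)
    qed
    have "c_const (k - 1/2) * Beta ((real (Suc j) + 1) / 2) k = fact (2 * Suc a) / (4 ^ Suc a * fact (Suc a)) / pochhammer (k + 1/2) (Suc a)"
      unfolding 1 normalized_Beta[OF assms] by (simp only: divide_divide_eq_left)
    also have "\<dots> = fact j / dunkl_fact k j"
      unfolding 2 unfolding j dunkl_fact_odd by (simp only: divide_divide_eq_left)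
    finally show ?thesis using False by simp
  qed
  ultimately show "c_const (k - 1/2) * (LINT u|lborel. indicator {-1..1} u * (?w u)) = fact j / dunkl_fact k j"
    by simp
qed

text \<open>A common interface for densities and for the point masses at parameter zero; the bound
  by 1 supplies all integrability.\<close>

definition unit_moments :: "real measure \<Rightarrow> (nat \<Rightarrow> real) \<Rightarrow> bool" where
  "unit_moments M m \<longleftrightarrow> prob_space M \<and> sets M = sets borel \<and> (AE u in M. \<bar>u\<bar> \<le> 1) \<and> (\<forall>j. (LINT u|M. u ^ j) = m j)"

lemma unit_moments_kappa:
  assumes "k \<ge> 0"
  shows "unit_moments (kappa_measure k) (\<lambda>j. fact j / dunkl_fact k j)"
proof (cases "k = 0")
  case True
  then show ?thesis
    by (auto simp: unit_moments_def kappa_measure_def dunkl_fact_0 integral_return AE_return intro!: prob_space_return)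
next
  case False
  then have k: "k > 0" using assms by simp
  let ?f = "\<lambda>u. indicator {-1..1} u * (c_const (k - 1/2) * ((1 + u) * (1 - u\<^sup>2) powr (k - 1)))"
  have f0: "?f u \<ge> 0" for u using c_const_nonneg[OF k] by (auto simp: indicator_def)
  have eq: "?f = (\<lambda>u. c_const (k - 1/2) * (indicator {-1..1} u * (u ^ 0 * (1 + u) * (1 - u\<^sup>2) powr (k - 1))))"
    by (simp add: mult_ac)
  have int: "integrable lborel ?f" unfolding eq by (intro integrable_mult_right kappa_density_integrable k)
  have one: "(LINT u|lborel. ?f u) = 1"
    unfolding eq using kappa_density_integrable(2)[OF k, of 0] by simp
  have "(\<integral>\<^sup>+u. ennreal (?f u) \<partial>lborel) = 1"
    using nn_integral_eq_integral[OF int] f0 one by simp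
  then have "prob_space (kappa_measure k)"
    using False by (intro prob_spaceI) (simp add: kappa_measure_def emeasure_density)
  moreover have "AE u in kappa_measure k. \<bar>u\<bar> \<le> 1"
    unfolding kappa_measure_def using False by (simp, subst AE_density) (auto simp: indicator_def)
  moreover have "(LINT u|kappa_measure k. u ^ j) = fact j / dunkl_fact k j" for j
    using integral_kappa_measure(2)[of "\<lambda>u. u ^ j" k] k kappa_density_integrable(2)[OF k, of j]
    by (simp add: set_lebesgue_integral_def)
  moreover have "sets (kappa_measure k) = sets borel" by (simp add: kappa_measure_def)
  ultimately show ?thesis by (simp add: unit_moments_def)
qed

lemma unit_moments_mu:
  assumes "k \<ge> 0"
  shows "unit_moments (mu_measure k) (\<lambda>j. if even j then fact j / dunkl_fact k j else 0)"
proof (cases "k = 0")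
  case True
  have m: "(\<lambda>u. u) \<in> measurable (uniform_count_measure {-1, 1::real}) borel"
    by (auto simp: measurable_def sets_uniform_count_measure space_uniform_count_measure)
  have "prob_space (mu_measure k)"
    using True m by (auto simp: mu_measure_def intro!: prob_space.prob_space_distr prob_space_uniform_count_measure)
  moreover have "AE u in mu_measure k. \<bar>u\<bar> \<le> 1"
    unfolding mu_measure_def using True
    by (simp, subst AE_distr_iff[OF m]) (auto simp: space_uniform_count_measure intro!: AE_I2)
  moreover have "(LINT u|mu_measure k. u ^ j) = (if even j then fact j / dunkl_fact k j else 0)" for j
    using integral_mu_measure(1)[of "\<lambda>u. u ^ j"] True by (cases "even j") (simp_all add: dunkl_fact_0)
  moreover have "sets (mu_measure k) = sets borel" by (simp add: mu_measure_def)
  ultimately show ?thesis by (simp add: unit_moments_def)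
next
  case False
  then have k: "k > 0" using assms by simp
  let ?f = "\<lambda>u. indicator {-1..1} u * (c_const (k - 1/2) * (1 - u\<^sup>2) powr (k - 1))"
  have mom: "c_const (k - 1/2) * (LINT u|lborel. indicator {-1..1} u * (u ^ j * (1 - u\<^sup>2) powr (k - 1))) = (if even j then fact j / dunkl_fact k j else 0)" for j
  proof (cases "even j")
    case True
    then obtain a where j: "j = 2 * a" by (rule evenE)
    show ?thesis using normalized_Beta[OF k, of a] even_weight_integral(2)[OF k, of j] True
      by (simp add: j dunkl_fact_even del: of_nat_mult)
  next
    case False
    then show ?thesis using even_weight_integral(2)[OF k, of j] by simp
  qed
  have f0: "?f u \<ge> 0" for u using c_const_nonneg[OF k] by (auto simp: indicator_def)
  have eq: "?f = (\<lambda>u. c_const (k - 1/2) * (indicator {-1..1} u * (u ^ 0 * (1 - u\<^sup>2) powr (k - 1))))"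
    by (simp add: mult_ac)
  have int: "integrable lborel ?f" unfolding eq by (intro integrable_mult_right even_weight_integral k)
  have one: "(LINT u|lborel. ?f u) = 1"
    unfolding eq using mom[of 0] by simp
  have "(\<integral>\<^sup>+u. ennreal (?f u) \<partial>lborel) = 1"
    using nn_integral_eq_integral[OF int] f0 one by simp
  then have "prob_space (mu_measure k)"
    using False by (intro prob_spaceI) (simp add: mu_measure_def emeasure_density)
  moreover have "AE u in mu_measure k. \<bar>u\<bar> \<le> 1"
    unfolding mu_measure_def using False by (simp, subst AE_density) (auto simp: indicator_def)
  moreover have "(LINT u|mu_measure k. u ^ j) = (if even j then fact j / dunkl_fact k j else 0)" for j
    using integral_mu_measure(2)[of "\<lambda>u. u ^ j" k] k mom[of j]
    by (simp add: set_lebesgue_integral_def)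
  moreover have "sets (mu_measure k) = sets borel" by (simp add: mu_measure_def)
  ultimately show ?thesis by (simp add: unit_moments_def)
qed

text \<open>\<open>F\<close> is the moment generating series of \<open>S\<close>; adding independent
  variables multiplies such series.\<close>

definition has_egf :: "'a measure \<Rightarrow> ('a \<Rightarrow> real) \<Rightarrow> real fps \<Rightarrow> bool" where
  "has_egf P S F \<longleftrightarrow> (\<forall>k. integrable P (\<lambda>x. S x ^ k) \<and> (LINT x|P. S x ^ k) = fact k * fps_nth F k)"

lemma unit_moments_integrable:
  assumes "unit_moments M m"
  shows "integrable M (\<lambda>u. u ^ j)" "(LINT u|M. u ^ j) = m j"
proof -
  interpret prob_space M using assms by (simp add: unit_moments_def)
  have [measurable]: "(\<lambda>u. u) \<in> borel_measurable M"
    using assms by (intro measurable_ident_sets) (simp add: unit_moments_def)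
  have "AE u in M. \<bar>u\<bar> \<le> 1" using assms by (simp add: unit_moments_def)
  then have "AE u in M. norm (u ^ j) \<le> 1" by eventually_elim (simp add: power_abs power_le_one)
  then show "integrable M (\<lambda>u. u ^ j)" by (intro integrable_const_bound[where B=1]) auto
  show "(LINT u|M. u ^ j) = m j" using assms by (simp add: unit_moments_def)
qed

text \<open>The binomial theorem, with the binomial coefficient distributed over the factorials of
  the two generating series.\<close>

lemma iterated_binomial_integral:
  assumes P: "has_egf P S F" and M: "unit_moments M m"
  shows "(LINT x|P. (LINT y|M. (S x + b * y) ^ k)) = fact k * fps_nth (F * Abs_fps (\<lambda>j. b ^ j * m j / fact j)) k"
proof -
  have inner: "(LINT y|M. (S x + b * y) ^ k) = (\<Sum>j\<le>k. (real (k choose j) * (b ^ (k - j) * m (k - j))) * S x ^ j)" for x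
  proof -
    have "(S x + b * y) ^ k = (\<Sum>j\<le>k. (real (k choose j) * S x ^ j * b ^ (k - j)) * y ^ (k - j))" for y
      unfolding binomial_ring power_mult_distrib by (simp add: mult_ac)
    then show ?thesis
      using unit_moments_integrable[OF M] by (simp add: mult_ac)
  qed
  have "(LINT x|P. (LINT y|M. (S x + b * y) ^ k)) = (\<Sum>j\<le>k. (real (k choose j) * (b ^ (k - j) * m (k - j))) * (fact j * fps_nth F j))"
    unfolding inner using P by (simp add: has_egf_def)
  also have "\<dots> = (\<Sum>j\<le>k. fact k * (fps_nth F j * (b ^ (k - j) * m (k - j) / fact (k - j))))"
    by (intro sum.cong refl) (simp add: binomial_fact)
  finally show ?thesis by (simp add: fps_mult_nth sum_distrib_left atMost_atLeast0)
qed

lemma has_egf_PiM: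
  fixes M :: "'i \<Rightarrow> real measure"
  assumes M: "\<And>i. unit_moments (M i) (m i)" and "finite I"
  shows "has_egf (PiM I M) (\<lambda>x. a + (\<Sum>i\<in>I. b i * x i)) (fps_exp a * (\<Prod>i\<in>I. Abs_fps (\<lambda>j. b i ^ j * m i j / fact j)))"
proof -
  have prob: "prob_space (M i)" and sets: "sets (M i) = sets borel" and bd: "AE u in M i. \<bar>u\<bar> \<le> 1" for i
    using M[of i] by (auto simp: unit_moments_def)
  interpret product_sigma_finite M
    by (rule product_sigma_finite.intro) (rule prob_space_imp_sigma_finite[OF prob])
  have int: "integrable (PiM I M) (\<lambda>x. (a + (\<Sum>i\<in>I. b i * x i)) ^ k)" if I: "finite I" for I k
  proof -
    interpret PI: prob_space "PiM I M" by (intro prob_space_PiM prob)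
    have "(\<lambda>x. x i) \<in> measurable (PiM I M) (M i)" if "i \<in> I" for i
      using that by (rule measurable_component_singleton)
    then have meas: "(\<lambda>x. x i) \<in> borel_measurable (PiM I M)" if "i \<in> I" for i
      using that measurable_cong_sets[OF refl sets] by blast
    have "AE x in PiM I M. \<forall>i\<in>I. \<bar>x i\<bar> \<le> 1"
      using I prob bd by (intro AE_finite_allI AE_PiM_component) auto
    then have "AE x in PiM I M. norm ((a + (\<Sum>i\<in>I. b i * x i)) ^ k) \<le> (\<bar>a\<bar> + (\<Sum>i\<in>I. \<bar>b i\<bar>)) ^ k"
    proof eventually_elim
      case (elim x)
      have "\<bar>a + (\<Sum>i\<in>I. b i * x i)\<bar> \<le> \<bar>a\<bar> + (\<Sum>i\<in>I. \<bar>b i * x i\<bar>)"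
        by (intro order_trans[OF abs_triangle_ineq] add_left_mono sum_abs)
      also have "\<dots> \<le> \<bar>a\<bar> + (\<Sum>i\<in>I. \<bar>b i\<bar>)"
        using elim by (intro add_left_mono sum_mono) (auto simp: abs_mult mult_left_le)
      finally show ?case by (simp add: power_abs power_mono)
    qed
    then show ?thesis by (rule PI.integrable_const_bound) (use meas in measurable)
  qed
  show ?thesis
    using \<open>finite I\<close>
  proof (induction I rule: finite_induct)
    case empty
    interpret P0: prob_space "PiM {} M" by (intro prob_space_PiM prob)
    show ?case by (simp add: has_egf_def P0.prob_space)
  next
    case (insert i I)
    have "(LINT x|PiM (insert i I) M. (a + (\<Sum>j\<in>insert i I. b j * x j)) ^ k) =
        fact k * fps_nth (fps_exp a * (\<Prod>j\<in>insert i I. Abs_fps (\<lambda>l. b j ^ l * m j l / fact l))) k" for k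
    proof -
      have eq: "a + (\<Sum>j\<in>insert i I. b j * (x(i := y)) j) = (a + (\<Sum>j\<in>I. b j * x j)) + b i * y" for x y
      proof -
        have "(\<Sum>j\<in>I. b j * (x(i := y)) j) = (\<Sum>j\<in>I. b j * x j)" using insert.hyps by (intro sum.cong) auto
        then show ?thesis using insert.hyps by simp
      qed
      have "(LINT x|PiM (insert i I) M. (a + (\<Sum>j\<in>insert i I. b j * x j)) ^ k) =
         (LINT x|PiM I M. (LINT y|M i. ((a + (\<Sum>j\<in>I. b j * x j)) + b i * y) ^ k))"
        unfolding product_integral_insert[OF insert.hyps int[OF finite.insertI[OF insert.hyps(1)]]] eq ..
      also have "\<dots> = fact k * fps_nth ((fps_exp a * (\<Prod>j\<in>I. Abs_fps (\<lambda>l. b j ^ l * m j l / fact l))) * Abs_fps (\<lambda>l. b i ^ l * m i l / fact l)) k"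
        by (rule iterated_binomial_integral[OF insert.IH M])
      finally show ?thesis using insert.hyps by (simp add: mult_ac)
    qed
    then show ?case unfolding has_egf_def using int[of "insert i I"] insert.hyps by simp
  qed
qed

section \<open>The moments of the square of \<rho>\<close>

abbreviation u_measure :: "real ^ 'd::finite \<Rightarrow> real \<Rightarrow> (('d \<Rightarrow> real) \<times> real) measure" where
  "u_measure \<kappa> \<mu> \<equiv> PiM UNIV (\<lambda>i. kappa_measure (\<kappa> $ i)) \<Otimes>\<^sub>M mu_measure \<mu>"

text \<open>Twice the square of \<rho>. It is affine in u, so its moments factor over the
  coordinates.\<close>

definition rho_sq :: "(real ^ 'd::finite) \<times> real \<Rightarrow> (real ^ 'd) \<times> real \<Rightarrow> ('d \<Rightarrow> real) \<times> real \<Rightarrow> real" where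
  "rho_sq z w u = snd z * snd w + (\<Sum>i\<in>UNIV. (fst z $ i * fst w $ i) * fst u i)
     + (sqrt (cone_quad z) * sqrt (cone_quad w)) * snd u"

lemma rho_eq: "rho z w u = sqrt (1/2 * rho_sq z w u)"
  by (simp add: rho_def rho_sq_def cone_quad_def case_prod_beta)

lemma sum_mult_le_norm:
  fixes x y :: "real ^ 'd::finite"
  shows "(\<Sum>i\<in>UNIV. \<bar>x $ i\<bar> * \<bar>y $ i\<bar>) \<le> norm x * norm y"
  using L2_set_mult_ineq[of "\<lambda>i. x $ i" "\<lambda>i. y $ i" UNIV] by (simp add: norm_vec_def L2_set_def)

text \<open>The Cauchy-Schwarz inequality for the vectors (x, sqrt (t^2 - |x|^2)) and (y, sqrt (s^2
  - |y|^2)), which have lengths t and s.\<close>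

lemma rho_sq_nonneg:
  assumes z: "z \<in> solid_cone" and w: "w \<in> solid_cone"
    and u: "\<And>i. \<bar>fst u i\<bar> \<le> 1" "\<bar>snd u\<bar> \<le> 1"
  shows "rho_sq z w u \<ge> 0"
proof -
  define a b t s where "a = norm (fst z)" and "b = norm (fst w)" and "t = snd z" and "s = snd w"
  have ab: "0 \<le> a" "a \<le> t" "0 \<le> b" "b \<le> s" using z w by (auto simp: solid_cone_def a_def b_def t_def s_def)
  define p q where "p = sqrt (t\<^sup>2 - a\<^sup>2)" and "q = sqrt (s\<^sup>2 - b\<^sup>2)"
  have "a\<^sup>2 \<le> t\<^sup>2" "b\<^sup>2 \<le> s\<^sup>2" using ab by (simp_all add: power_mono)
  then have pq: "p \<ge> 0" "q \<ge> 0" "p\<^sup>2 = t\<^sup>2 - a\<^sup>2" "q\<^sup>2 = s\<^sup>2 - b\<^sup>2"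
    unfolding p_def q_def by (simp_all only: real_sqrt_pow2 real_sqrt_ge_zero diff_ge_0_iff_ge)
  \<comment> \<open>The added square is the one in Lagrange's identity.\<close>
  have "(a * b + p * q)\<^sup>2 \<le> (a * b + p * q)\<^sup>2 + (a * q - b * p)\<^sup>2"
    unfolding le_add_same_cancel1 by (rule zero_le_power2)
  also have "\<dots> = (a\<^sup>2 + p\<^sup>2) * (b\<^sup>2 + q\<^sup>2)" by (simp add: power2_eq_square algebra_simps)
  also have "\<dots> = (t * s)\<^sup>2" unfolding pq(3,4) power_mult_distrib by simp
  finally have cs: "a * b + p * q \<le> t * s"
    by (rule power2_le_imp_le) (use ab in simp)
  have "\<bar>\<Sum>i\<in>UNIV. (fst z $ i * fst w $ i) * fst u i\<bar> \<le> (\<Sum>i\<in>UNIV. \<bar>fst z $ i\<bar> * \<bar>fst w $ i\<bar>)"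
    using u by (intro order_trans[OF sum_abs] sum_mono) (auto simp: abs_mult mult_left_le)
  also have "\<dots> \<le> a * b" unfolding a_def b_def by (rule sum_mult_le_norm)
  finally have 1: "- (a * b) \<le> (\<Sum>i\<in>UNIV. (fst z $ i * fst w $ i) * fst u i)" by linarith
  have "\<bar>p * q * snd u\<bar> \<le> p * q" using pq u by (simp add: abs_mult mult_left_le)
  then have 2: "- (p * q) \<le> p * q * snd u" by linarith
  have "rho_sq z w u = t * s + (\<Sum>i\<in>UNIV. (fst z $ i * fst w $ i) * fst u i) + p * q * snd u"
    by (simp add: rho_sq_def t_def s_def p_def q_def a_def b_def cone_quad_def)
  then show ?thesis using 1 2 cs by linarith
qed

text \<open>The constant ts gives the exponential factor and each u_i a Dunkl exponential. In the
  last variable the odd moments vanish, so only even powers of the two square roots enter and the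
  outcome is polynomial.\<close>

lemma
  fixes \<kappa> :: "real ^ 'd::finite"
  assumes \<kappa>: "\<And>i. 0 \<le> \<kappa> $ i" and \<mu>: "0 \<le> \<mu>"
  shows rho_sq_measurable: "rho_sq z w \<in> borel_measurable (u_measure \<kappa> \<mu>)"
    and AE_u_measure: "AE u in u_measure \<kappa> \<mu>. (\<forall>i. \<bar>fst u i\<bar> \<le> 1) \<and> \<bar>snd u\<bar> \<le> 1"
    and rho_sq_moment: "integrable (u_measure \<kappa> \<mu>) (\<lambda>u. rho_sq z w u ^ k)"
      "z \<in> solid_cone \<Longrightarrow> w \<in> solid_cone \<Longrightarrow> (LINT u|u_measure \<kappa> \<mu>. rho_sq z w u ^ k) =
        fact k * fps_nth (fps_exp (snd z * snd w) * dunkl_pairing \<kappa> \<mu> z w) k"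
proof -
  let ?M = "\<lambda>i. kappa_measure (\<kappa> $ i)" and ?N = "mu_measure \<mu>"
  have M: "unit_moments (?M i) (\<lambda>j. fact j / dunkl_fact (\<kappa> $ i) j)" for i
    using \<kappa> by (rule unit_moments_kappa)
  have N: "unit_moments ?N (\<lambda>j. if even j then fact j / dunkl_fact \<mu> j else 0)"
    using \<mu> by (rule unit_moments_mu)
  interpret P: prob_space "PiM UNIV ?M" using M by (intro prob_space_PiM) (simp add: unit_moments_def)
  interpret N: prob_space ?N using N by (simp add: unit_moments_def)
  interpret PN: pair_prob_space "PiM UNIV ?M" ?N ..
  have sM: "sets (?M i) = sets borel" for i using M by (simp add: unit_moments_def)
  have sN: "sets ?N = sets borel" using N by (simp add: unit_moments_def)
  have "(\<lambda>x. x i) \<in> measurable (PiM UNIV ?M) (?M i)" for i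
    by (rule measurable_component_singleton) simp
  then have mi[measurable]: "(\<lambda>x. x i) \<in> borel_measurable (PiM UNIV ?M)" for i
    using measurable_cong_sets[OF refl sM] by blast
  have mN: "(\<lambda>v. v) \<in> borel_measurable ?N" by (rule measurable_ident_sets) (rule sN)
  have m1[measurable]: "(\<lambda>u. fst u i) \<in> borel_measurable (u_measure \<kappa> \<mu>)" for i
    by (rule measurable_compose[OF measurable_fst mi])
  have m2[measurable]: "snd \<in> borel_measurable (u_measure \<kappa> \<mu>)"
    by (rule measurable_compose[OF measurable_snd mN])
  show meas[measurable]: "rho_sq z w \<in> borel_measurable (u_measure \<kappa> \<mu>)" for z w
    unfolding rho_sq_def[abs_def] by measurable
  have "AE x in PiM UNIV ?M. \<forall>i\<in>UNIV. \<bar>x i\<bar> \<le> 1"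
    using M by (intro AE_finite_allI AE_PiM_component) (auto simp: unit_moments_def)
  moreover have "AE v in ?N. \<bar>v\<bar> \<le> 1" using N by (simp add: unit_moments_def)
  ultimately have "AE x in PiM UNIV ?M. AE v in ?N. (\<forall>i. \<bar>fst (x, v) i\<bar> \<le> 1) \<and> \<bar>snd (x, v)\<bar> \<le> 1"
    by (auto elim!: eventually_mono)
  then show AE: "AE u in u_measure \<kappa> \<mu>. (\<forall>i. \<bar>fst u i\<bar> \<le> 1) \<and> \<bar>snd u\<bar> \<le> 1"
    by (rule PN.AE_pair_measure[rotated]) measurable
  show int: "integrable (u_measure \<kappa> \<mu>) (\<lambda>u. rho_sq z w u ^ k)" for z w k
  proof (rule PN.integrable_const_bound)
    show "AE u in u_measure \<kappa> \<mu>. norm (rho_sq z w u ^ k) \<le>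
        (\<bar>snd z * snd w\<bar> + (\<Sum>i\<in>UNIV. \<bar>fst z $ i * fst w $ i\<bar>) + \<bar>sqrt (cone_quad z) * sqrt (cone_quad w)\<bar>) ^ k"
      using AE
    proof eventually_elim
      case (elim u)
      have "\<bar>\<Sum>i\<in>UNIV. (fst z $ i * fst w $ i) * fst u i\<bar> \<le> (\<Sum>i\<in>UNIV. \<bar>fst z $ i * fst w $ i\<bar>)"
        using elim by (intro order_trans[OF sum_abs] sum_mono) (auto simp: abs_mult mult_left_le)
      moreover have "\<bar>(sqrt (cone_quad z) * sqrt (cone_quad w)) * snd u\<bar> \<le> \<bar>sqrt (cone_quad z) * sqrt (cone_quad w)\<bar>"
        using elim unfolding abs_mult[of _ "snd u"] by (intro mult_left_le) auto
      ultimately have "\<bar>rho_sq z w u\<bar> \<le> \<bar>snd z * snd w\<bar> + (\<Sum>i\<in>UNIV. \<bar>fst z $ i * fst w $ i\<bar>) + \<bar>sqrt (cone_quad z) * sqrt (cone_quad w)\<bar>"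
        unfolding rho_sq_def by linarith
      then show ?case by (simp add: power_abs power_mono)
    qed
  qed measurable
  assume z: "z \<in> solid_cone" and w: "w \<in> solid_cone"
  define c where "c = sqrt (cone_quad z) * sqrt (cone_quad w)"
  have q: "cone_quad z \<ge> 0" "cone_quad w \<ge> 0" using z w by (auto simp: cone_quad_def solid_cone_def power_mono)
  then have c2: "c\<^sup>2 = cone_quad z * cone_quad w" by (simp add: c_def power_mult_distrib)
  let ?S = "\<lambda>x. snd z * snd w + (\<Sum>i\<in>UNIV. (fst z $ i * fst w $ i) * x i)"
  have "(LINT u|u_measure \<kappa> \<mu>. rho_sq z w u ^ k) = (LINT x|PiM UNIV ?M. (LINT v|?N. rho_sq z w (x, v) ^ k))"
    using int by (rule PN.integral_fst'[symmetric])
  also have "\<dots> = (LINT x|PiM UNIV ?M. (LINT v|?N. (?S x + c * v) ^ k))"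
    by (simp add: rho_sq_def c_def)
  also have "\<dots> = fact k * fps_nth ((fps_exp (snd z * snd w) * (\<Prod>i\<in>UNIV. Abs_fps (\<lambda>j. (fst z $ i * fst w $ i) ^ j * (fact j / dunkl_fact (\<kappa> $ i) j) / fact j))) *
      Abs_fps (\<lambda>j. c ^ j * (if even j then fact j / dunkl_fact \<mu> j else 0) / fact j)) k"
    by (rule iterated_binomial_integral[OF has_egf_PiM[OF M finite_class.finite_UNIV] N])
  also have "Abs_fps (\<lambda>j. c ^ j * (if even j then fact j / dunkl_fact \<mu> j else 0) / fact j) = dunkl_exp_even \<mu> (cone_quad z * cone_quad w)"
    unfolding c2[symmetric] by (rule fps_ext) (auto simp: dunkl_exp_even_def elim!: evenE simp flip: power_mult)
  also have "(\<lambda>i. Abs_fps (\<lambda>j. (fst z $ i * fst w $ i) ^ j * (fact j / dunkl_fact (\<kappa> $ i) j) / fact j)) =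
      (\<lambda>i. fps_scale (fst z $ i * fst w $ i) (dunkl_exp (\<kappa> $ i)))"
    by (rule ext, rule fps_ext) (simp add: dunkl_exp_def)
  finally show "(LINT u|u_measure \<kappa> \<mu>. rho_sq z w u ^ k) = fact k * fps_nth (fps_exp (snd z * snd w) * dunkl_pairing \<kappa> \<mu> z w) k"
    by (simp add: dunkl_pairing_def mult.assoc)
qed

lemma bessel_j_measurable [measurable]: "bessel_j \<alpha> \<in> borel_measurable borel"
  unfolding bessel_j_def[abs_def] bessel_J_def by measurable

lemma laguerre_measurable [measurable]: "laguerre n a \<in> borel_measurable borel"
  unfolding laguerre_altdef[abs_def] by (intro borel_measurable_continuous_onI continuous_intros) auto

lemma kernel_formula_eq:
  fixes \<kappa> :: "real ^ 'd::finite"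
  assumes \<kappa>: "\<And>i. 0 \<le> \<kappa> $ i" and \<mu>: "0 \<le> \<mu>" and \<alpha>: "alpha_index \<kappa> \<mu> > 0"
    and z: "z \<in> solid_cone" and w: "w \<in> solid_cone"
  shows "kernel_formula \<kappa> \<mu> n z w = cone_reproducing \<kappa> \<mu> n z w"
proof -
  define \<alpha>' where "\<alpha>' = alpha_index \<kappa> \<mu>"
  define C where "C = 2 powr (\<alpha>' - 1) * Gamma (\<alpha>' + 1/2) / sqrt pi"
  define g where "g r = (LINT \<theta>:{0..pi}|lborel. laguerre n (2 * \<alpha>') (snd z + snd w + 2 * r * cos \<theta>)
           * exp (- r * cos \<theta>) * bessel_j (\<alpha>' - 1) (r * sin \<theta>) * sin \<theta> powr (2 * \<alpha>' - 1))" for r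
  define L where "L k = laguerre (n - k) (2 * \<alpha>' + 2 * real k) (snd z + snd w)" for k
  define d where "d k = 2 ^ k * fact k * pochhammer (\<alpha>' + 1/2) k" for k
  have g [measurable]: "g \<in> borel_measurable borel"
    unfolding g_def set_lebesgue_integral_def by measurable
  have [measurable]: "rho_sq z w \<in> borel_measurable (u_measure \<kappa> \<mu>)"
    using \<kappa> \<mu> by (rule rho_sq_measurable)
  have m1: "(\<lambda>u. C * g (rho z w u)) \<in> borel_measurable (u_measure \<kappa> \<mu>)"
    unfolding rho_eq[abs_def] by measurable
  \<comment> \<open>The angular formula needs \<rho> real and nonnegative, hence u in the cube. The
    measures live on whole lines, so this is known only almost everywhere.\<close>
  have eq: "AE u in u_measure \<kappa> \<mu>. C * g (rho z w u) = (\<Sum>k\<le>n. rho_sq z w u ^ k / d k * L k)"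
    using AE_u_measure[OF \<kappa> \<mu>]
  proof eventually_elim
    case (elim u)
    then have nn: "rho_sq z w u \<ge> 0" using z w by (intro rho_sq_nonneg) auto
    then have r: "rho z w u \<ge> 0" "rho z w u ^ (2 * k) = rho_sq z w u ^ k / 2 ^ k" for k
      by (simp_all add: rho_eq power_mult power_divide)
    show ?case
      unfolding C_def g_def L_def d_def
      using laguerre_bessel_integral[of \<alpha>' "rho z w u" n "snd z + snd w"] r \<alpha>
      by (simp add: \<alpha>'_def mult.assoc)
  qed
  have "kernel_formula \<kappa> \<mu> n z w = (LINT u|u_measure \<kappa> \<mu>. C * g (rho z w u))"
    by (simp add: kernel_formula_def Let_def C_def g_def \<alpha>'_def)
  also have "\<dots> = (LINT u|u_measure \<kappa> \<mu>. (\<Sum>k\<le>n. rho_sq z w u ^ k / d k * L k))"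
    by (rule integral_cong_AE[OF m1 _ eq]) measurable
  also have "\<dots> = (\<Sum>k\<le>n. (LINT u|u_measure \<kappa> \<mu>. rho_sq z w u ^ k) / d k * L k)"
    using rho_sq_moment(1)[OF \<kappa> \<mu>] by (subst Bochner_Integration.integral_sum) auto
  also have "\<dots> = cone_reproducing \<kappa> \<mu> n z w"
    unfolding rho_sq_moment(2)[OF \<kappa> \<mu> z w] cone_reproducing_def cone_pairing_def d_def L_def \<alpha>'_def
    by (intro sum.cong refl) simp
  finally show ?thesis .
qed

section \<open>Identification of the kernels\<close>

lemma poly_upto_cone_monom:
  "p \<in> poly_upto n \<longleftrightarrow> (\<exists>c. p = (\<lambda>z. \<Sum>\<gamma>\<in>exponents_upto n. c \<gamma> * cone_monom (fst \<gamma>) (snd \<gamma>) 0 z))"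
  by (simp add: poly_upto_def cone_monom_def case_prod_beta' mult.assoc)

lemma poly_upto_0: "(\<lambda>_. 0) \<in> poly_upto n"
  unfolding poly_upto_cone_monom by (rule exI[of _ "\<lambda>_. 0"]) simp

lemma poly_upto_add:
  assumes "p \<in> poly_upto n" "q \<in> poly_upto n"
  shows "(\<lambda>z. p z + q z) \<in> poly_upto n"
proof -
  obtain c where c: "p = (\<lambda>z. \<Sum>\<gamma>\<in>exponents_upto n. c \<gamma> * cone_monom (fst \<gamma>) (snd \<gamma>) 0 z)"
    using assms(1) unfolding poly_upto_cone_monom by blast
  obtain d where d: "q = (\<lambda>z. \<Sum>\<gamma>\<in>exponents_upto n. d \<gamma> * cone_monom (fst \<gamma>) (snd \<gamma>) 0 z)"
    using assms(2) unfolding poly_upto_cone_monom by blast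
  show ?thesis unfolding poly_upto_cone_monom c d
    by (rule exI[of _ "\<lambda>\<gamma>. c \<gamma> + d \<gamma>"]) (simp add: distrib_right sum.distrib)
qed

lemma poly_upto_cmult:
  assumes "p \<in> poly_upto n"
  shows "(\<lambda>z. a * p z) \<in> poly_upto n"
proof -
  obtain c where c: "p = (\<lambda>z. \<Sum>\<gamma>\<in>exponents_upto n. c \<gamma> * cone_monom (fst \<gamma>) (snd \<gamma>) 0 z)"
    using assms(1) unfolding poly_upto_cone_monom by blast
  show ?thesis unfolding poly_upto_cone_monom c
    by (rule exI[of _ "\<lambda>\<gamma>. a * c \<gamma>"]) (simp add: sum_distrib_left mult.assoc)
qed

lemma poly_upto_sum:
  assumes "\<And>i. i \<in> I \<Longrightarrow> f i \<in> poly_upto n"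
  shows "(\<lambda>z. \<Sum>i\<in>I. f i z) \<in> poly_upto n"
  using assms by (induction I rule: infinite_finite_induct) (auto simp: poly_upto_0 intro: poly_upto_add)

lemma poly_upto_monom:
  assumes "sum \<beta> UNIV + k \<le> n"
  shows "cone_monom \<beta> k 0 \<in> poly_upto n"
  unfolding poly_upto_cone_monom
proof (rule exI[of _ "\<lambda>\<gamma>. if \<gamma> = (\<beta>, k) then 1 else 0"], rule ext)
  fix z
  have "(\<beta>, k) \<in> exponents_upto n" using assms by (simp add: exponents_upto_def)
  then show "cone_monom \<beta> k 0 z = (\<Sum>\<gamma>\<in>exponents_upto n. (if \<gamma> = (\<beta>, k) then 1 else 0) * cone_monom (fst \<gamma>) (snd \<gamma>) 0 z)"
    by (simp add: if_distrib[of "\<lambda>x. x * _"] finite_exponents_upto cong: if_cong)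
qed

lemma poly_upto_mono:
  assumes "p \<in> poly_upto m" "m \<le> n"
  shows "p \<in> poly_upto n"
proof -
  obtain c where c: "p = (\<lambda>z. \<Sum>\<gamma>\<in>exponents_upto m. c \<gamma> * cone_monom (fst \<gamma>) (snd \<gamma>) 0 z)"
    using assms(1) unfolding poly_upto_cone_monom by blast
  show ?thesis unfolding c
    by (intro poly_upto_sum poly_upto_cmult poly_upto_monom) (use assms(2) in \<open>auto simp: exponents_upto_def\<close>)
qed

lemma poly_upto_mult:
  assumes "p \<in> poly_upto m" "q \<in> poly_upto n"
  shows "(\<lambda>z. p z * q z) \<in> poly_upto (m + n)"
proof -
  obtain c where c: "p = (\<lambda>z. \<Sum>\<gamma>\<in>exponents_upto m. c \<gamma> * cone_monom (fst \<gamma>) (snd \<gamma>) 0 z)"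
    using assms(1) unfolding poly_upto_cone_monom by blast
  obtain d where d: "q = (\<lambda>z. \<Sum>\<gamma>\<in>exponents_upto n. d \<gamma> * cone_monom (fst \<gamma>) (snd \<gamma>) 0 z)"
    using assms(2) unfolding poly_upto_cone_monom by blast
  have "(\<lambda>z. p z * q z) = (\<lambda>z. \<Sum>\<gamma>\<in>exponents_upto m. \<Sum>\<delta>\<in>exponents_upto n.
      (c \<gamma> * d \<delta>) * cone_monom (\<lambda>i. fst \<gamma> i + fst \<delta> i) (snd \<gamma> + snd \<delta>) 0 z)"
    unfolding c d sum_product by (simp add: cone_monom_def power_add prod.distrib mult_ac)
  also have "\<dots> \<in> poly_upto (m + n)"
    by (intro poly_upto_sum poly_upto_cmult poly_upto_monom) (auto simp: exponents_upto_def sum.distrib)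
  finally show ?thesis .
qed

lemma poly_upto_const: "(\<lambda>_. a) \<in> poly_upto n"
  using poly_upto_cmult[OF poly_upto_monom[of "\<lambda>_. 0" 0 n], of a] by (simp add: cone_monom_def)

lemma poly_upto_power:
  assumes "p \<in> poly_upto m"
  shows "(\<lambda>z. p z ^ k) \<in> poly_upto (k * m)"
  by (induction k) (use assms in \<open>auto intro: poly_upto_const poly_upto_mult\<close>)

lemma poly_upto_snd: "snd \<in> poly_upto 1"
proof -
  have *: "snd = cone_monom (\<lambda>_. 0) 1 0" by (simp add: cone_monom_def fun_eq_iff)
  show ?thesis unfolding * by (rule poly_upto_monom) simp
qed

lemma poly_upto_coord: "(\<lambda>z. fst z $ i) \<in> poly_upto 1"
proof -
  have "cone_monom (\<lambda>j. if j = i then 1 else 0) 0 0 z = fst z $ i" for z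
    by (simp add: cone_monom_def if_distrib[of "\<lambda>n. _ ^ n"] cong: if_cong)
  then have "(\<lambda>z. fst z $ i) = cone_monom (\<lambda>j. if j = i then 1 else 0) 0 0" by (simp add: fun_eq_iff)
  then show ?thesis using poly_upto_monom[of "\<lambda>j. if j = i then 1 else 0" 0 1] by simp
qed

lemma poly_upto_cone_quad: "cone_quad \<in> poly_upto 2"
proof -
  have "cone_quad = (\<lambda>z. snd z ^ 2 + (\<Sum>i\<in>UNIV. (-1) * (fst z $ i) ^ 2))"
    by (simp add: cone_quad_def fun_eq_iff norm_vec_def L2_set_def sum_nonneg sum_negf)
  also have "\<dots> \<in> poly_upto (2 * 1)"
    by (intro poly_upto_add poly_upto_sum poly_upto_cmult poly_upto_power poly_upto_snd poly_upto_coord)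
  finally show ?thesis by simp
qed

text \<open>The degree of a coefficient is bounded by its index; products preserve this, so
  homogeneity of the pairing is checked factor by factor.\<close>

definition fps_poly_upto :: "((real ^ 'd::finite) \<times> real \<Rightarrow> real fps) \<Rightarrow> bool" where
  "fps_poly_upto G \<longleftrightarrow> (\<forall>n. (\<lambda>z. fps_nth (G z) n) \<in> poly_upto n)"

lemma fps_poly_upto_mult:
  assumes "fps_poly_upto G" "fps_poly_upto H"
  shows "fps_poly_upto (\<lambda>z. G z * H z)"
  unfolding fps_poly_upto_def fps_mult_nth
proof (intro allI poly_upto_sum)
  fix n i :: nat assume "i \<in> {0..n}"
  then show "(\<lambda>z. fps_nth (G z) i * fps_nth (H z) (n - i)) \<in> poly_upto n"
    using poly_upto_mult[of "\<lambda>z. fps_nth (G z) i" i "\<lambda>z. fps_nth (H z) (n - i)" "n - i"] assms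
    by (simp add: fps_poly_upto_def)
qed

lemma fps_poly_upto_prod:
  assumes "\<And>i. i \<in> I \<Longrightarrow> fps_poly_upto (G i)"
  shows "fps_poly_upto (\<lambda>z. \<Prod>i\<in>I. G i z)"
  using assms
proof (induction I rule: infinite_finite_induct)
  case (insert i I)
  then show ?case by (auto intro: fps_poly_upto_mult)
qed (auto simp: fps_poly_upto_def intro: poly_upto_const)

lemma cone_pairing_poly:
  fixes w :: "(real ^ 'd::finite) \<times> real"
  shows "(\<lambda>z. cone_pairing \<kappa> \<mu> n z w) \<in> poly_upto n"
proof -
  have 1: "fps_poly_upto (\<lambda>z :: (real ^ 'd) \<times> real. fps_exp (snd z * snd w))"
    unfolding fps_poly_upto_def
  proof
    fix n
    have "(\<lambda>z :: (real ^ 'd) \<times> real. fps_nth (fps_exp (snd z * snd w)) n) = (\<lambda>z. snd w ^ n / fact n * snd z ^ n)"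
      by (simp add: fun_eq_iff power_mult_distrib)
    then show "(\<lambda>z :: (real ^ 'd) \<times> real. fps_nth (fps_exp (snd z * snd w)) n) \<in> poly_upto n"
      using poly_upto_cmult[OF poly_upto_power[OF poly_upto_snd, of n], of "snd w ^ n / fact n"]
      by (simp only: mult_1_right)
  qed
  have 2: "fps_poly_upto (\<lambda>z. fps_scale (fst z $ i * fst w $ i) (dunkl_exp (\<kappa> $ i)))" for i
    unfolding fps_poly_upto_def
  proof
    fix n
    show "(\<lambda>z. fps_nth (fps_scale (fst z $ i * fst w $ i) (dunkl_exp (\<kappa> $ i))) n) \<in> poly_upto n"
      using poly_upto_cmult[OF poly_upto_power[OF poly_upto_coord[of i], of n], of "(fst w $ i) ^ n * fps_nth (dunkl_exp (\<kappa> $ i)) n"]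
      by (simp add: power_mult_distrib mult_ac)
  qed
  have 3: "fps_poly_upto (\<lambda>z. dunkl_exp_even \<mu> (cone_quad z * cone_quad w))"
    unfolding fps_poly_upto_def
  proof
    fix n
    show "(\<lambda>z. fps_nth (dunkl_exp_even \<mu> (cone_quad z * cone_quad w)) n) \<in> poly_upto n"
    proof (cases "even n")
      case True
      then show ?thesis
        using poly_upto_cmult[OF poly_upto_power[OF poly_upto_cone_quad, of "n div 2"], of "cone_quad w ^ (n div 2) / dunkl_fact \<mu> n"]
        by (simp add: dunkl_exp_even_def power_mult_distrib mult_ac)
    qed (simp add: dunkl_exp_even_def poly_upto_0)
  qed
  have "fps_poly_upto (\<lambda>z. fps_exp (snd z * snd w) * dunkl_pairing \<kappa> \<mu> z w)"
    unfolding dunkl_pairing_def by (intro fps_poly_upto_mult fps_poly_upto_prod 1 2 3)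
  then show ?thesis
    using poly_upto_cmult[of "\<lambda>z. fps_nth (fps_exp (snd z * snd w) * dunkl_pairing \<kappa> \<mu> z w) n" n
        "1 / (2 ^ n * pochhammer (alpha_index \<kappa> \<mu> + 1/2) n)"]
    by (simp add: fps_poly_upto_def cone_pairing_def)
qed

lemma cone_reproducing_poly:
  fixes w :: "(real ^ 'd::finite) \<times> real"
  shows "(\<lambda>z. cone_reproducing \<kappa> \<mu> N z w) \<in> poly_upto N"
  unfolding cone_reproducing_def
proof (rule poly_upto_sum)
  fix n assume n: "n \<in> {..N}"
  have lag: "(\<lambda>z :: (real ^ 'd) \<times> real. laguerre M a (snd z + snd w)) \<in> poly_upto M" for M a
  proof -
    have "(\<lambda>z :: (real ^ 'd) \<times> real. ((-1) * (snd z + snd w)) ^ i) \<in> poly_upto M" if "i \<le> M" for i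
      by (rule poly_upto_mono[of _ "i * 1"],
          intro poly_upto_power poly_upto_cmult poly_upto_add poly_upto_snd poly_upto_const)
        (use that in simp)
    then have "(\<lambda>z :: (real ^ 'd) \<times> real. \<Sum>i\<le>M. (1 / fact i * ((-1) ^ (M - i) * (- a - 1 - real i gchoose (M - i)))) * ((-1) * (snd z + snd w)) ^ i) \<in> poly_upto M"
      by (intro poly_upto_sum poly_upto_cmult) simp
    then show ?thesis unfolding laguerre_altdef by (simp add: mult_ac)
  qed
  have "(\<lambda>z. cone_pairing \<kappa> \<mu> n z w *
      laguerre (N - n) (2 * alpha_index \<kappa> \<mu> + 2 * real n) (snd z + snd w)) \<in> poly_upto (n + (N - n))"
    by (rule poly_upto_mult[OF cone_pairing_poly lag])
  then show "(\<lambda>z. cone_pairing \<kappa> \<mu> n z w *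
      laguerre (N - n) (2 * alpha_index \<kappa> \<mu> + 2 * real n) (snd z + snd w)) \<in> poly_upto N"
    using n by simp
qed

section \<open>The reproducing property and uniqueness\<close>

lemma cone_reproducing_commute: "cone_reproducing \<kappa> \<mu> N z w = cone_reproducing \<kappa> \<mu> N w z"
  by (simp add: cone_reproducing_def cone_pairing_def dunkl_pairing_def mult.commute add.commute)

lemma cone_inner_commute: "cone_inner \<kappa> \<mu> f g = cone_inner \<kappa> \<mu> g f"
  by (simp add: cone_inner_def mult.commute[of "f _"])

lemma cone_inner_reproducing:
  fixes \<kappa> :: "real ^ 'd::finite"
  assumes \<kappa>: "\<And>i. 0 \<le> \<kappa> $ i" and \<mu>: "0 \<le> \<mu>" and p: "p \<in> poly_upto M"
  shows "M < N \<Longrightarrow> cone_inner \<kappa> \<mu> p (\<lambda>z. cone_reproducing \<kappa> \<mu> N z w) = 0"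
    and "(\<Sum>N\<le>M. cone_inner \<kappa> \<mu> p (\<lambda>z. cone_reproducing \<kappa> \<mu> N z w)) = p w"
proof -
  let ?E = "exponents_upto M"
  let ?K = "\<lambda>N z. cone_reproducing \<kappa> \<mu> N z w"
  obtain c where c: "p = (\<lambda>z. \<Sum>\<gamma>\<in>?E. c \<gamma> * cone_monom (fst \<gamma>) (snd \<gamma>) 0 z)"
    using p unfolding poly_upto_cone_monom by blast
  have "\<forall>\<gamma>. \<exists>R. (\<forall>N. cone_mean \<kappa> \<mu> (\<lambda>z. cone_monom (fst \<gamma>) (snd \<gamma>) 0 z * ?K N z) (R N)) \<and>
      (\<forall>N. sum (fst \<gamma>) UNIV + snd \<gamma> < N \<longrightarrow> R N = 0) \<and>
      (\<forall>L. sum (fst \<gamma>) UNIV + snd \<gamma> \<le> L \<longrightarrow> (\<Sum>N\<le>L. R N) = cone_monom (fst \<gamma>) (snd \<gamma>) 0 w)"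
    (is "\<forall>\<gamma>. \<exists>R. ?P \<gamma> R")
  proof
    fix \<gamma> :: "('d \<Rightarrow> nat) \<times> nat"
    obtain R where "\<And>N. cone_mean \<kappa> \<mu> (\<lambda>z. cone_monom (fst \<gamma>) (snd \<gamma>) 0 z * ?K N z) (R N)"
      "\<And>N. sum (fst \<gamma>) UNIV + snd \<gamma> < N \<Longrightarrow> R N = 0"
      "\<And>L. sum (fst \<gamma>) UNIV + snd \<gamma> \<le> L \<Longrightarrow> (\<Sum>N\<le>L. R N) = cone_monom (fst \<gamma>) (snd \<gamma>) 0 w"
      by (rule cone_mean_monom_reproducing[OF \<kappa> \<mu>, of "fst \<gamma>" "snd \<gamma>" w]) blast
    then show "\<exists>R. ?P \<gamma> R" by blast
  qed
  from choice[OF this] obtain R where "\<forall>\<gamma>. ?P \<gamma> (R \<gamma>)" by blast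
  then have R: "\<And>\<gamma> N. cone_mean \<kappa> \<mu> (\<lambda>z. cone_monom (fst \<gamma>) (snd \<gamma>) 0 z * ?K N z) (R \<gamma> N)"
    and R0: "\<And>\<gamma> N. sum (fst \<gamma>) UNIV + snd \<gamma> < N \<Longrightarrow> R \<gamma> N = 0"
    and R1: "\<And>\<gamma> L. sum (fst \<gamma>) UNIV + snd \<gamma> \<le> L \<Longrightarrow> (\<Sum>N\<le>L. R \<gamma> N) = cone_monom (fst \<gamma>) (snd \<gamma>) 0 w"
    by blast+
  have deg: "sum (fst \<gamma>) UNIV + snd \<gamma> \<le> M" if "\<gamma> \<in> ?E" for \<gamma>
    using that by (auto simp: exponents_upto_def)
  have val: "cone_inner \<kappa> \<mu> p (?K N) = (\<Sum>\<gamma>\<in>?E. c \<gamma> * R \<gamma> N)" for N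
  proof -
    have "cone_mean \<kappa> \<mu> (\<lambda>z. \<Sum>\<gamma>\<in>?E. c \<gamma> * (cone_monom (fst \<gamma>) (snd \<gamma>) 0 z * ?K N z)) (\<Sum>\<gamma>\<in>?E. c \<gamma> * R \<gamma> N)"
      by (intro cone_mean_sum cone_mean_cmult R)
    then have "cone_mean \<kappa> \<mu> (\<lambda>z. p z * ?K N z) (\<Sum>\<gamma>\<in>?E. c \<gamma> * R \<gamma> N)"
      by (rule cone_mean_cong) (simp_all add: c sum_distrib_right mult.assoc)
    then show ?thesis by (simp add: cone_mean_def cone_inner_def)
  qed
  show "cone_inner \<kappa> \<mu> p (?K N) = 0" if "M < N"
    unfolding val using R0[OF le_less_trans[OF deg that]] by (intro sum.neutral) simp
  have "(\<Sum>N\<le>M. cone_inner \<kappa> \<mu> p (?K N)) = (\<Sum>\<gamma>\<in>?E. c \<gamma> * (\<Sum>N\<le>M. R \<gamma> N))"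
    unfolding val sum_distrib_left by (rule sum.swap)
  also have "\<dots> = p w" unfolding c by (intro sum.cong refl) (simp only: R1[OF deg])
  finally show "(\<Sum>N\<le>M. cone_inner \<kappa> \<mu> p (?K N)) = p w" .
qed

text \<open>Uniqueness plays two representers against each other: the inner product of k with
  \<open>?K v\<close> is k v when \<open>?K v\<close> represents evaluation, and
  \<open>?K v w\<close> when k does; symmetry of the kernel then gives equality at every v.\<close>

lemma cone_kernel_eq:
  fixes \<kappa> :: "real ^ 'd::finite"
  assumes \<kappa>: "\<And>i. 0 \<le> \<kappa> $ i" and \<mu>: "0 \<le> \<mu>"
  shows "cone_kernel \<kappa> \<mu> n z w = cone_reproducing \<kappa> \<mu> n z w"
proof -
  let ?V = "cone_orth_space \<kappa> \<mu> n"
  let ?K = "\<lambda>w z. cone_reproducing \<kappa> \<mu> n z w"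
  have K: "?K w \<in> ?V" for w
    unfolding cone_orth_space_def
  proof (intro CollectI conjI allI impI ballI cone_reproducing_poly)
    fix m and q :: "(real ^ 'd) \<times> real \<Rightarrow> real" assume "m < n" "q \<in> poly_upto m"
    then show "cone_inner \<kappa> \<mu> (?K w) q = 0"
      by (subst cone_inner_commute) (rule cone_inner_reproducing(1)[OF \<kappa> \<mu>])
  qed
  have rep: "cone_inner \<kappa> \<mu> p (?K w) = p w" if p: "p \<in> ?V" for p w
  proof -
    have pn: "p \<in> poly_upto n" using p by (simp add: cone_orth_space_def)
    have "p w = (\<Sum>N\<le>n. cone_inner \<kappa> \<mu> p (\<lambda>z. cone_reproducing \<kappa> \<mu> N z w))"
      using cone_inner_reproducing(2)[OF \<kappa> \<mu> pn] by simp
    \<comment> \<open>The kernels of index N < n are polynomials of degree at most N, to which p is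
      orthogonal.\<close>
    also have "\<dots> = (\<Sum>N\<le>n. if N = n then cone_inner \<kappa> \<mu> p (?K w) else 0)"
    proof (intro sum.cong refl)
      fix N assume "N \<in> {..n}"
      moreover have "cone_inner \<kappa> \<mu> p (\<lambda>z. cone_reproducing \<kappa> \<mu> N z w) = 0" if "N < n"
        using p that cone_reproducing_poly[of \<kappa> \<mu> N w] unfolding cone_orth_space_def by blast
      ultimately show "cone_inner \<kappa> \<mu> p (\<lambda>z. cone_reproducing \<kappa> \<mu> N z w) =
          (if N = n then cone_inner \<kappa> \<mu> p (?K w) else 0)" by auto
    qed
    finally show ?thesis by simp
  qed
  have "(THE k. k \<in> ?V \<and> (\<forall>p\<in>?V. cone_inner \<kappa> \<mu> p k = p w)) = ?K w"
  proof (rule the_equality)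
    show "?K w \<in> ?V \<and> (\<forall>p\<in>?V. cone_inner \<kappa> \<mu> p (?K w) = p w)" using K rep by blast
    fix k assume k: "k \<in> ?V \<and> (\<forall>p\<in>?V. cone_inner \<kappa> \<mu> p k = p w)"
    show "k = ?K w"
    proof
      fix v
      have "k v = cone_inner \<kappa> \<mu> k (?K v)" using rep k by simp
      also have "\<dots> = cone_inner \<kappa> \<mu> (?K v) k" by (rule cone_inner_commute)
      also have "\<dots> = ?K v w" using k K by blast
      finally show "k v = ?K w v" by (simp add: cone_reproducing_commute)
    qed
  qed
  then show ?thesis by (simp add: cone_kernel_def)
qed

section \<open>Continuity in \<mu> and the limit case\<close>

lemma tendsto_pochhammer:
  fixes f :: "'a \<Rightarrow> real"
  assumes "(f \<longlongrightarrow> l) F"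
  shows "((\<lambda>x. pochhammer (f x) n) \<longlongrightarrow> pochhammer l n) F"
  unfolding pochhammer_prod by (intro tendsto_intros assms)

lemma tendsto_laguerre:
  fixes f :: "'a \<Rightarrow> real"
  assumes "(f \<longlongrightarrow> l) F"
  shows "((\<lambda>x. laguerre n (f x) t) \<longlongrightarrow> laguerre n l t) F"
  unfolding laguerre_altdef gbinomial_pochhammer by (intro tendsto_intros tendsto_pochhammer assms) auto

lemma tendsto_dunkl_fact: "((\<lambda>k. dunkl_fact k n) \<longlongrightarrow> dunkl_fact l n) (at_right l)"
  by (induction n) (auto simp: dunkl_step_def intro!: tendsto_eq_intros)

text \<open>A finite sum of rational expressions in \<mu> whose denominators, rising factorials of
  \<alpha> + 1/2 and Dunkl factorials, are nonzero also at \<alpha> = 0.\<close>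

lemma cone_reproducing_tendsto:
  fixes \<kappa> :: "real ^ 'd::finite"
  assumes "\<And>i. 0 \<le> \<kappa> $ i" and "0 \<le> \<mu>"
  shows "((\<lambda>\<mu>'. cone_reproducing \<kappa> \<mu>' n z w) \<longlongrightarrow> cone_reproducing \<kappa> \<mu> n z w) (at_right \<mu>)"
proof -
  have \<alpha>: "((\<lambda>\<mu>'. alpha_index \<kappa> \<mu>') \<longlongrightarrow> alpha_index \<kappa> \<mu>) (at_right \<mu>)"
    unfolding alpha_index_def by (intro tendsto_intros)
  have "pochhammer (alpha_index \<kappa> \<mu> + 1/2) k > 0" for k
    using alpha_index_nonneg[OF assms] by (intro pochhammer_pos) simp
  then have nz: "2 ^ k * pochhammer (alpha_index \<kappa> \<mu> + 1/2) k \<noteq> 0" for k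
    by (metis less_irrefl mult_eq_0_iff power_not_zero zero_neq_numeral)
  have e: "((\<lambda>\<mu>'. fps_nth (dunkl_exp_even \<mu>' Q) j) \<longlongrightarrow> fps_nth (dunkl_exp_even \<mu> Q) j) (at_right \<mu>)" for Q j
    using assms(2) by (cases "even j") (auto simp: dunkl_exp_even_def intro!: tendsto_intros tendsto_dunkl_fact)
  show ?thesis
    unfolding cone_reproducing_def cone_pairing_def dunkl_pairing_def mult.assoc[symmetric]
    by (subst (1 2) fps_mult_nth) (intro tendsto_intros e tendsto_pochhammer tendsto_laguerre \<alpha> nz)
qed

theorem theorem5p4:
  fixes \<kappa> :: "real ^ 'd::finite" and \<mu> :: real and n :: nat
    and x y :: "real ^ 'd" and t s :: real
  assumes "\<And>i. 0 \<le> \<kappa> $ i" and "0 \<le> \<mu>"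
    and "(x, t) \<in> solid_cone" and "(y, s) \<in> solid_cone"
  shows "(0 < alpha_index \<kappa> \<mu> \<longrightarrow>
           cone_kernel \<kappa> \<mu> n (x, t) (y, s) = kernel_formula \<kappa> \<mu> n (x, t) (y, s)) \<and>
         (CARD('d) = 1 \<and> \<kappa> = 0 \<and> \<mu> = 0 \<longrightarrow>
           ((\<lambda>\<mu>'. kernel_formula \<kappa> \<mu>' n (x, t) (y, s))
              \<longlongrightarrow> cone_kernel \<kappa> \<mu> n (x, t) (y, s)) (at_right 0))"
proof (intro conjI impI)
  assume "0 < alpha_index \<kappa> \<mu>"
  then show "cone_kernel \<kappa> \<mu> n (x, t) (y, s) = kernel_formula \<kappa> \<mu> n (x, t) (y, s)"
    using cone_kernel_eq[OF assms(1,2)] kernel_formula_eq[OF assms(1,2) _ assms(3,4)] by simp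
next
  assume *: "CARD('d) = 1 \<and> \<kappa> = 0 \<and> \<mu> = 0"
  have "((\<lambda>\<mu>'. cone_reproducing \<kappa> \<mu>' n (x, t) (y, s)) \<longlongrightarrow> cone_reproducing \<kappa> \<mu> n (x, t) (y, s)) (at_right 0)"
    using cone_reproducing_tendsto[OF assms(1,2)] * by simp
  then have "((\<lambda>\<mu>'. kernel_formula \<kappa> \<mu>' n (x, t) (y, s)) \<longlongrightarrow> cone_reproducing \<kappa> \<mu> n (x, t) (y, s)) (at_right 0)"
  proof (rule Lim_transform_eventually)
    \<comment> \<open>For d = 1 and \<kappa> = 0 the index \<alpha> equals \<mu>', so the integral
      formula is available for every positive \<mu>'.\<close>
    have "cone_reproducing \<kappa> \<mu>' n (x, t) (y, s) = kernel_formula \<kappa> \<mu>' n (x, t) (y, s)" if "\<mu>' > 0" for \<mu>'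
      using that * by (intro kernel_formula_eq[symmetric] assms) (auto simp: alpha_index_def)
    then show "\<forall>\<^sub>F \<mu>' in at_right 0. cone_reproducing \<kappa> \<mu>' n (x, t) (y, s) = kernel_formula \<kappa> \<mu>' n (x, t) (y, s)"
      by (auto simp: eventually_at_right_field intro!: exI[of _ 1])
  qed
  then show "((\<lambda>\<mu>'. kernel_formula \<kappa> \<mu>' n (x, t) (y, s)) \<longlongrightarrow> cone_kernel \<kappa> \<mu> n (x, t) (y, s)) (at_right 0)"
    by (simp add: cone_kernel_eq[OF assms(1,2)])
qed

end
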